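(* Let $Z_1,Z_2,\ldots\in\mathbb{R}^d$ be i.i.d. with distribution $F$, and let $Z\sim F$. For each fixed $\lambda\in\mathbb{R}^q$ let $\hat\theta(\lambda)\in\mathbb{R}^p$ be the unique solution in $\theta$ to $n^{-1}\sum_{i=1}^n\varphi(Z_i,\theta,\lambda)=0$. Assume that $\hat\lambda$ is the unique solution to $\mathrm{TE}'(\lambda)=o_p(1/\sqrt n)$, where $\mathrm{TE}(\lambda)=n^{-1}\sum_{i=1}^n\psi\{Z_i,\hat\theta(\lambda)\}$. Write $\alpha=(\theta^T,\lambda^T,D^T)^T\in\mathbb{R}^{p+q+pq}$ and $\hat\alpha=(\hat\theta(\hat\lambda)^T,\hat\lambda^T,\hat\theta'(\hat\lambda)^T)^T$. Define $\eta\colon\mathbb{R}^{d+p+q+pq}\to\mathbb{R}^{p+q+pq}$ by $\eta(z,\alpha)=(\eta_1(z,\alpha)^T,\eta_2(z,\alpha)^T,\eta_3(z,\alpha)^T)^T$ with $$\eta_1(z,\alpha)=\varphi(z,\theta,\lambda),\qquad \eta_2(z,\alpha)=D^T\nabla_\theta\psi(z,\theta),\qquad \eta_3(z,\alpha)=\partial_\theta\varphi(z,\theta,\lambda)D+\partial_\lambda\varphi(z,\theta,\lambda).$$ Assume that the solution to $\Psi(\alpha)=0$, where $\Psi(\alpha)=\mathrm{E}\{\eta(Z,\alpha)\}$, is unique and equal to $\alpha_0=(\theta_0^T,\lambda_0^T,D_0^T)^T$. Assume moreover that $\Psi$ is continuously differentiable in a neighbourhood of $\alpha_0$, that $\Psi'(\alpha_0)$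 is non-singular, and that in a neighbourhood of $\alpha_0$ the norm of $\eta(z,\alpha)$ and all first order partial derivatives of $\eta$ with respect to $\alpha$ are bounded by functions $m_0(z)$ and $m_1(z)$, respectively, with $\mathrm{E}\,m_0(Z)^2<\infty$ and $\mathrm{E}\,m_1(Z)^2<\infty$. Then $\hat\alpha$ is consistent for $\alpha_0$ (converges to it in probability) and $$\hat\alpha=\alpha_0-\Psi'(\alpha_0)^{-1}\,\frac1n\sum_{i=1}^n\eta(Z_i,\theta_0,\lambda_0,D_0)+o_p(1/\sqrt n)\qquad(n\to\infty).$$ In particular, $\sqrt n(\hat\alpha-\alpha_0)$ converges in law to $\mathrm{N}(0,V_\alpha)$ with $V_\alpha=\Psi'(\alpha_0)^{-1}\,\mathrm{Var}\{\eta(Z,\alpha_0)\}\,\{\Psi'(\alpha_0)^{-1}\}^T$.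
   Context: $\varphi\colon\mathbb{R}^{d+p+q}\to\mathbb{R}^p$ is the estimating function and $\psi\colon\mathbb{R}^{d+p}\to\mathbb{R}$ is the loss function; both are smooth enough in $(\theta,\lambda)$ that all derivatives appearing exist. $\nabla$ denotes gradient and $\partial$ the Jacobian matrix; a prime denotes the Jacobian matrix with respect to the argument. $\hat\theta'(\lambda)\in\mathbb{R}^{p\times q}$ is the Jacobian of $\lambda\mapsto\hat\theta(\lambda)$, which by the implicit function theorem exists when $n^{-1}\sum_{i}\partial_\theta\varphi(Z_i,\hat\theta(\lambda),\lambda)$ is invertible and satisfies $n^{-1}\sum_i\{\partial_\theta\varphi(Z_i,\hat\theta(\lambda),\lambda)\hat\theta'(\lambda)+\partial_\lambda\varphi(Z_i,\hat\theta(\lambda),\lambda)\}=0$; thus $\mathrm{TE}'(\lambda)$ is (as a column vector) $n^{-1}\sum_i\hat\theta'(\lambda)^T\nabla_\theta\psi\{Z_i,\hat\theta(\lambda)\}$. Matrices in $\mathbb{R}^{p\times q}$ (such as $D$, $\hat\theta'$ and $\eta_3$) are identified with vectors in $\mathbb{R}^{pq}$ by stacking columns, and norms of matrices are Euclidean norms of these vectors. $o_p$ is with respect to $n\to\infty$. *)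

theory Defs
  imports "HOL-Probability.Probability"
begin

section \<open>Convergence in probability and in law\<close>

text \<open>
  The outer probability of the deviation event is used, which is its probability whenever the
  event is measurable. In Isabelle the measure of a non-measurable set is 0, so plain
  \<^const>\<open>measure\<close> would make the definition hold spuriously for non-measurable \<open>X n\<close>.
\<close>

definition converges_in_prob ::
    "'w measure \<Rightarrow> (nat \<Rightarrow> 'w \<Rightarrow> 'a::metric_space) \<Rightarrow> 'a \<Rightarrow> bool" where
  "converges_in_prob M X c \<longleftrightarrow>
     (\<forall>\<epsilon>>0. (\<lambda>n. outer_measure_of M {\<omega> \<in> space M. \<epsilon> < dist (X n \<omega>) c}) \<longlonglongrightarrow> 0)"

definition small_op ::
    "'w measure \<Rightarrow> (nat \<Rightarrow> 'w \<Rightarrow> 'a::real_normed_vector) \<Rightarrow> (nat \<Rightarrow> real) \<Rightarrow> bool" where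
  "small_op M X r \<longleftrightarrow> converges_in_prob M (\<lambda>n \<omega>. X n \<omega> /\<^sub>R r n) 0"

definition converges_in_law ::
    "'w measure \<Rightarrow> (nat \<Rightarrow> 'w \<Rightarrow> 'a::metric_space) \<Rightarrow> 'a measure \<Rightarrow> bool" where
  "converges_in_law M X N \<longleftrightarrow>
     (\<forall>\<^sub>F n in sequentially. X n \<in> borel_measurable M) \<and>
     (\<forall>f :: 'a \<Rightarrow> real. continuous_on UNIV f \<longrightarrow> bounded (range f) \<longrightarrow>
        (\<lambda>n. LINT \<omega>|M. f (X n \<omega>)) \<longlonglongrightarrow> (LINT x|N. f x))"

text \<open>
  The possibly degenerate normal law: every linear functional of it is univariate normal, a
  normal law with variance 0 being a point mass.
\<close>

definition multivariate_normal ::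
    "(real^'k) measure \<Rightarrow> real^'k \<Rightarrow> real^'k^'k \<Rightarrow> bool" where
  "multivariate_normal N \<mu> V \<longleftrightarrow>
     prob_space N \<and> sets N = sets borel \<and> transpose V = V \<and>
     (\<forall>t. let s = t \<bullet> (V *v t) in
        s \<ge> 0 \<and>
        (if s = 0 then (AE x in N. t \<bullet> x = t \<bullet> \<mu>)
         else distributed N lborel (\<lambda>x. t \<bullet> x) (normal_density (t \<bullet> \<mu>) (sqrt s))))"

definition covariance_matrix :: "'z measure \<Rightarrow> ('z \<Rightarrow> real^'k) \<Rightarrow> real^'k^'k" where
  "covariance_matrix F X =
     (\<chi> k l. LINT z|F. (X z $ k - (LINT y|F. X y $ k)) * (X z $ l - (LINT y|F. X y $ l)))"

section \<open>The estimators\<close>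

definition gradient :: "(real^'n \<Rightarrow> real) \<Rightarrow> real^'n \<Rightarrow> real^'n" where
  "gradient f x = (\<chi> j. frechet_derivative f (at x) (axis j 1))"

definition sample_mean :: "nat \<Rightarrow> (nat \<Rightarrow> 'z) \<Rightarrow> ('z \<Rightarrow> 'a::real_vector) \<Rightarrow> 'a" where
  "sample_mean n z f = (1 / real n) *\<^sub>R (\<Sum>i<n. f (z i))"

text \<open>In what follows \<open>z\<close> is the data sequence; only \<open>z 0, \<dots>, z (n - 1)\<close> matter.\<close>

definition theta_hat ::
    "(real^'d \<Rightarrow> real^'p \<Rightarrow> real^'q \<Rightarrow> real^'p) \<Rightarrow> nat \<Rightarrow> (nat \<Rightarrow> real^'d) \<Rightarrow> real^'q \<Rightarrow> real^'p" where
  "theta_hat \<phi> n z l = (THE t. sample_mean n z (\<lambda>x. \<phi> x t l) = 0)"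

definition theta_hat' ::
    "(real^'d \<Rightarrow> real^'p \<Rightarrow> real^'q \<Rightarrow> real^'p) \<Rightarrow> nat \<Rightarrow> (nat \<Rightarrow> real^'d) \<Rightarrow> real^'q \<Rightarrow> real^'q^'p" where
  "theta_hat' \<phi> n z l = jacobian (theta_hat \<phi> n z) (at l)"

definition TE ::
    "(real^'d \<Rightarrow> real^'p \<Rightarrow> real^'q \<Rightarrow> real^'p) \<Rightarrow> (real^'d \<Rightarrow> real^'p \<Rightarrow> real) \<Rightarrow>
     nat \<Rightarrow> (nat \<Rightarrow> real^'d) \<Rightarrow> real^'q \<Rightarrow> real" where
  "TE \<phi> \<psi> n z l = sample_mean n z (\<lambda>x. \<psi> x (theta_hat \<phi> n z l))"

definition TE' ::
    "(real^'d \<Rightarrow> real^'p \<Rightarrow> real^'q \<Rightarrow> real^'p) \<Rightarrow> (real^'d \<Rightarrow> real^'p \<Rightarrow> real) \<Rightarrow>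
     nat \<Rightarrow> (nat \<Rightarrow> real^'d) \<Rightarrow> real^'q \<Rightarrow> real^'q" where
  "TE' \<phi> \<psi> n z l = gradient (TE \<phi> \<psi> n z) l"

section \<open>The stacked estimating function\<close>

text \<open>
  The type \<open>('p, 'q) param\<close> is the Euclidean space of dimension $p + q + pq$. The coordinate
  \<open>Inr (Inr (j, i))\<close> holds the entry of \<open>D\<close> in row \<open>i\<close> and column \<open>j\<close>.
\<close>

type_synonym ('p, 'q) param = "real^('p + 'q + 'q \<times> 'p)"

definition stack :: "real^'p \<Rightarrow> real^'q \<Rightarrow> real^'q^'p \<Rightarrow> ('p::finite, 'q::finite) param" where
  "stack t l D =
     (\<chi> k. case k of Inl i \<Rightarrow> t $ i | Inr (Inl j) \<Rightarrow> l $ j | Inr (Inr (j, i)) \<Rightarrow> D $ i $ j)"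

definition theta_of :: "('p::finite, 'q::finite) param \<Rightarrow> real^'p" where
  "theta_of \<alpha> = (\<chi> i. \<alpha> $ Inl i)"

definition lambda_of :: "('p::finite, 'q::finite) param \<Rightarrow> real^'q" where
  "lambda_of \<alpha> = (\<chi> j. \<alpha> $ Inr (Inl j))"

definition D_of :: "('p::finite, 'q::finite) param \<Rightarrow> real^'q^'p" where
  "D_of \<alpha> = (\<chi> i j. \<alpha> $ Inr (Inr (j, i)))"

definition eta ::
    "(real^'d \<Rightarrow> real^'p \<Rightarrow> real^'q \<Rightarrow> real^'p) \<Rightarrow> (real^'d \<Rightarrow> real^'p \<Rightarrow> real) \<Rightarrow>
     real^'d \<Rightarrow> ('p::finite, 'q::finite) param \<Rightarrow> ('p, 'q) param" where
  "eta \<phi> \<psi> z \<alpha> =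
     (let t = theta_of \<alpha>; l = lambda_of \<alpha>; D = D_of \<alpha> in
      stack (\<phi> z t l)
        (transpose D *v gradient (\<psi> z) t)
        (jacobian (\<lambda>t. \<phi> z t l) (at t) ** D + jacobian (\<lambda>l. \<phi> z t l) (at l)))"

definition Psi ::
    "(real^'d) measure \<Rightarrow>
     (real^'d \<Rightarrow> real^'p \<Rightarrow> real^'q \<Rightarrow> real^'p) \<Rightarrow> (real^'d \<Rightarrow> real^'p \<Rightarrow> real) \<Rightarrow>
     ('p::finite, 'q::finite) param \<Rightarrow> ('p, 'q) param" where
  "Psi F \<phi> \<psi> \<alpha> = (LINT z|F. eta \<phi> \<psi> z \<alpha>)"

definition alpha_hat ::
    "(real^'d \<Rightarrow> real^'p \<Rightarrow> real^'q \<Rightarrow> real^'p) \<Rightarrow>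
     nat \<Rightarrow> (nat \<Rightarrow> real^'d) \<Rightarrow> real^'q \<Rightarrow> ('p::finite, 'q::finite) param" where
  "alpha_hat \<phi> n z l = stack (theta_hat \<phi> n z l) l (theta_hat' \<phi> n z l)"

text \<open>
  A sequence of random vectors solves $\mathrm{TE}'(\lambda) = o_p(1/\sqrt n)$. Any sequence that
  differs from a solution by a sufficiently small perturbation, or on events of vanishing
  probability, is a solution too. Uniqueness therefore means that any two solutions differ by
  $o_p(1)$.
\<close>

definition solves_TE ::
    "'w measure \<Rightarrow> (nat \<Rightarrow> 'w \<Rightarrow> real^'d) \<Rightarrow>
     (real^'d \<Rightarrow> real^'p \<Rightarrow> real^'q \<Rightarrow> real^'p) \<Rightarrow> (real^'d \<Rightarrow> real^'p \<Rightarrow> real) \<Rightarrow>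
     (nat \<Rightarrow> 'w \<Rightarrow> real^'q) \<Rightarrow> bool" where
  "solves_TE M Z \<phi> \<psi> L \<longleftrightarrow>
     (\<forall>n. L n \<in> borel_measurable M) \<and>
     small_op M (\<lambda>n \<omega>. TE' \<phi> \<psi> n (\<lambda>i. Z i \<omega>) (L n \<omega>)) (\<lambda>n. 1 / sqrt (real n))"

definition unique_solution_TE ::
    "'w measure \<Rightarrow> (nat \<Rightarrow> 'w \<Rightarrow> real^'d) \<Rightarrow>
     (real^'d \<Rightarrow> real^'p \<Rightarrow> real^'q \<Rightarrow> real^'p) \<Rightarrow> (real^'d \<Rightarrow> real^'p \<Rightarrow> real) \<Rightarrow>
     (nat \<Rightarrow> 'w \<Rightarrow> real^'q) \<Rightarrow> bool" where
  "unique_solution_TE M Z \<phi> \<psi> L \<longleftrightarrow>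
     solves_TE M Z \<phi> \<psi> L \<and>
     (\<forall>L'. solves_TE M Z \<phi> \<psi> L' \<longrightarrow> small_op M (\<lambda>n \<omega>. L' n \<omega> - L n \<omega>) (\<lambda>_. 1))"

end

theory Submission
  imports Defs
begin

text \<open>
  Consistency. For large \<open>n\<close> the empirical mean \<open>\<Psi>\<^sub>n\<close> of \<open>\<eta>\<close> is close to its linearisation
  \<open>J (\<alpha> - \<alpha>\<^sub>0)\<close> on a small ball, because the linearisation error of \<open>\<eta>(z, \<cdot>)\<close> at \<open>\<alpha>\<^sub>0\<close>,
  relative to the distance from \<open>\<alpha>\<^sub>0\<close> and maximised over the ball, has a mean that vanishes with
  the radius (dominated convergence). Brouwer's theorem then gives a zero of \<open>\<Psi>\<^sub>n\<close> near
  \<open>\<alpha>\<^sub>0\<close>. As \<open>\<theta>\<close>-hat is the unique zero of the first block, the \<open>\<lambda>\<close>-part of this zero, or of a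
  measurably selected approximate zero, solves \<open>TE'(\<lambda>) = o\<^sub>p(1/\<surd>n)\<close>, and uniqueness brings
  \<open>\<lambda>\<close>-hat to \<open>\<lambda>\<^sub>0\<close>. The same local analysis applied to the first and third block shows
  that \<open>\<theta>\<close>-hat and its Jacobian follow.

  Asymptotic normality. By the chain rule \<open>\<Psi>\<^sub>n\<close> at \<open>\<alpha>\<close>-hat is \<open>(0, TE', 0) = o\<^sub>p(1/\<surd>n)\<close>, and
  the linearisation at \<open>\<alpha>\<^sub>0\<close> turns this into the expansion. The limit law follows from the
  univariate central limit theorem for all linear functionals together with a multivariate
  continuity theorem: a Gaussian function is an average of characters, so convergence of
  characteristic functions gives convergence of integrals of Gaussian mollifications of test
  functions.
\<close>

section \<open>The multivariate normal law\<close>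

text \<open>The derivative of \<eta> in \<alpha> is bounded but not assumed continuous, so neither a
  uniform law of large numbers for empirical Jacobians nor a contraction argument is at hand. What
  remains is a linearisation anchored at \<alpha>0: on a small ball the error of
  \<open>Psi_n\<close> is at most \<kappa> times the distance from \<alpha>0, with \<kappa> as small
  as desired. That suffices for Brouwer's theorem, which needs a continuous self-map of a ball but
  no estimate between two arbitrary points. Such pairs are compared by a Lipschitz bound that comes
  from the envelope of the partial derivatives.

  The equation for \<lambda>-hat does not place it near \<lambda>0: uniqueness only compares it with
  other measurable sequences, so a competitor has to be built. Nor is the Jacobian of \<theta>-hat
  known to be near D0; as \<eta>3 is affine in D, its error is found by inverting a matrix close to
  \<open>A\<close>, the mean \<theta>-derivative of \<phi>. The bounds hold for all \<lambda> near
  \<lambda>0 at once, since they are applied at random \<lambda>.\<close>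

lemma borel_measurable_vecI:
  fixes f :: "'a \<Rightarrow> 'b::euclidean_space^'k"
  assumes "\<And>i. (\<lambda>x. f x $ i) \<in> borel_measurable M"
  shows "f \<in> borel_measurable M"
proof (subst borel_measurable_euclidean_space, safe)
  fix b :: "'b^'k" assume "b \<in> Basis"
  then obtain i u where "b = axis i u" by (auto simp: Basis_vec_def)
  then show "(\<lambda>x. f x \<bullet> b) \<in> borel_measurable M"
    using assms[of i] by (simp add: inner_axis)
qed

text \<open>Serves twice: its linear images are the centred normal laws, and averaging characters
  over it produces the Gaussian kernels of the continuity theorem.\<close>

definition std_gaussian :: "(real^'k) measure" where
  "std_gaussian = distr (PiM UNIV (\<lambda>_. std_normal_distribution)) borel (\<lambda>f. \<chi> i. f i)"

lemma vec_lambda_measurable_PiM [measurable]: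
  "(\<lambda>f. (\<chi> i. f i) :: real^'k) \<in> borel_measurable (PiM UNIV (\<lambda>_. std_normal_distribution))"
proof (rule borel_measurable_vecI)
  fix i :: 'k
  have "(\<lambda>f. f i) \<in> measurable (PiM UNIV (\<lambda>_. std_normal_distribution)) std_normal_distribution"
    by (rule measurable_component_singleton) simp
  then show "(\<lambda>f. (\<chi> j. f j) $ i) \<in> borel_measurable (PiM UNIV (\<lambda>_. std_normal_distribution))"
    by (simp add: measurable_def)
qed

lemma sets_std_gaussian [simp, measurable_cong]: "sets std_gaussian = sets borel"
  by (simp add: std_gaussian_def)

lemma prob_space_std_gaussian: "prob_space (std_gaussian :: (real^'k) measure)"
  unfolding std_gaussian_def
  by (rule prob_space.prob_space_distr[OF prob_space_PiM]) (auto intro: prob_space_normal_density)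

text \<open>The coordinates are independent, so the integral factors into univariate characteristic
  functions.\<close>

lemma std_gaussian_char:
  fixes t :: "real^'k"
  shows "(CLINT x|std_gaussian. iexp (t \<bullet> x)) = exp (- (t \<bullet> t) / 2)"
proof -
  interpret real_distribution std_normal_distribution by (rule real_dist_normal_dist)
  interpret normal_product: product_prob_space "\<lambda>_::'k. std_normal_distribution"
    by (intro product_prob_spaceI prob_space_normal_density) simp
  have "(CLINT x|std_gaussian. iexp (t \<bullet> x)) =
      (CLINT f|PiM UNIV (\<lambda>_::'k. std_normal_distribution). (\<Prod>i\<in>UNIV. iexp (t $ i * f i)))"
    unfolding std_gaussian_def
    by (subst integral_distr)
      (auto simp: inner_vec_def sum_distrib_left exp_sum intro!: borel_measurable_continuous_onI continuous_intros)
  also have "\<dots> = (\<Prod>i\<in>UNIV. (CLINT x|std_normal_distribution. iexp (t $ i * x)))"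
    by (rule normal_product.product_integral_prod) (auto intro!: integrable_iexp)
  also have "\<dots> = (\<Prod>i\<in>UNIV. complex_of_real (exp (- (t $ i)\<^sup>2 / 2)))"
    using char_std_normal_distribution by (simp add: char_def fun_eq_iff)
  also have "\<dots> = complex_of_real (exp (\<Sum>i\<in>UNIV. - (t $ i)\<^sup>2 / 2))"
    by (simp add: exp_sum del: of_real_exp)
  also have "(\<Sum>i\<in>UNIV. - (t $ i)\<^sup>2 / 2) = - (t \<bullet> t) / 2"
    by (simp add: inner_vec_def power2_eq_square sum_negf sum_divide_distrib)
  finally show ?thesis by simp
qed

abbreviation "gauss s x y \<equiv> exp (- (s\<^sup>2 * (norm (x - y))\<^sup>2) / 2)"

text \<open>The characteristic function of the standard Gaussian, evaluated at
  \<open>s *\<^sub>R (x - a)\<close> and read backwards: a Gaussian kernel in x is an average over g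
  of characters in x.\<close>

lemma gaussian_function_eq_char:
  fixes x a :: "real^'k"
  shows "complex_of_real (gauss s x a) =
    (CLINT g|std_gaussian. iexp ((s *\<^sub>R (x - a)) \<bullet> g))"
  unfolding std_gaussian_char by (simp add: power2_norm_eq_inner) (simp add: power2_eq_square)

lemma psd_factorisation:
  fixes V :: "real^'k^'k"
  assumes "transpose V = V" "\<And>x. 0 \<le> x \<bullet> (V *v x)"
  shows "\<exists>W :: real^'k^'k. V = W ** transpose W"
proof -
  have main: "\<exists>c :: 'k \<Rightarrow> real^'k. \<forall>i j. V $ i $ j = (\<Sum>k\<in>S. c k $ i * c k $ j)"
    if "finite S" "\<And>i j. V $ i $ j = V $ j $ i" "\<And>x. 0 \<le> x \<bullet> (V *v x)"
      "\<And>i j. i \<notin> S \<Longrightarrow> V $ i $ j = 0" for S and V :: "real^'k^'k"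
    using that
  proof (induction S arbitrary: V rule: finite_induct)
    case empty then show ?case by simp
  next
    case (insert a S)
    note sym = insert.prems(1) and psd = insert.prems(2) and zero = insert.prems(3)
    define v where "v = V $ a"
    have Va: "V *v axis a 1 = v"
      by (simp add: v_def matrix_vector_mult_basis column_def vec_eq_iff sym[of _ a])
    have aV: "axis a 1 \<bullet> (V *v x) = v \<bullet> x" for x
    proof -
      have "axis a 1 \<bullet> (V *v x) = (V *v x) $ a" by (subst inner_commute) (simp add: inner_axis)
      then show ?thesis by (simp add: v_def matrix_vector_mult_def inner_vec_def)
    qed
    \<comment> \<open>The quadratic form at \<open>x + r *\<^sub>R axis a 1\<close>. Both cases
      below follow from a suitable r.\<close>
    have shift: "0 \<le> x \<bullet> (V *v x) + 2 * r * (v \<bullet> x) + r\<^sup>2 * v $ a" for r x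
      using psd[of "x + r *\<^sub>R axis a 1"] aV[of "axis a 1"]
      by (simp add: matrix_vector_right_distrib matrix_vector_mult_scaleR Va aV inner_add_left
          inner_add_right inner_axis inner_commute[of x v] power2_eq_square algebra_simps)
    have diag: "0 \<le> v $ a" using shift[of 0 1] by simp
    show ?case
    proof (cases "v $ a = 0")
      case True
      \<comment> \<open>With a zero pivot the shifted form is affine in r. If v were nonzero, the r
        used below would give it the value -1 at x = v.\<close>
      have "v \<bullet> v = 0"
      proof (rule ccontr)
        assume "v \<bullet> v \<noteq> 0"
        then show False
          using shift[of v "- (v \<bullet> (V *v v) + 1) / (2 * (v \<bullet> v))"] True by (simp add: field_simps)
      qed
      then have "V $ a $ j = 0" for j by (simp add: v_def)
      then have "V $ i $ j = 0" if "i \<notin> S" for i j using zero that by (metis insert_iff)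
      then obtain c :: "'k \<Rightarrow> real^'k" where c: "\<And>i j. V $ i $ j = (\<Sum>k\<in>S. c k $ i * c k $ j)"
        using insert.IH[OF sym psd] by blast
      have "(\<Sum>k\<in>S. (c(a := 0)) k $ i * (c(a := 0)) k $ j) = (\<Sum>k\<in>S. c k $ i * c k $ j)" for i j
        using insert.hyps by (intro sum.cong) auto
      then show ?thesis
        using insert.hyps c by (intro exI[of _ "c(a := 0)"]) simp
    next
      case False
      with diag have pos: "0 < v $ a" by simp
      \<comment> \<open>The Schur complement of the pivot. Its form at x is the shifted form at the
        minimising \<open>r = - (v \<bullet> x) / v $ a\<close>, hence non-negative, and its row a
        vanishes.\<close>
      define U where "U = (\<chi> i j. V $ i $ j - v $ i * v $ j / v $ a)"
      have U: "U $ i $ j = V $ i $ j - v $ i * v $ j / v $ a" for i j by (simp add: U_def)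
      have U_sym: "U $ i $ j = U $ j $ i" for i j
        by (simp only: U sym[of i j] mult.commute)
      have "(U *v x) $ i = (V *v x) $ i - v $ i / v $ a * (v \<bullet> x)" for x i
      proof -
        have "(\<Sum>j\<in>UNIV. U $ i $ j * x $ j) = (\<Sum>j\<in>UNIV. V $ i $ j * x $ j - v $ i / v $ a * (v $ j * x $ j))"
          by (intro sum.cong) (simp_all add: U left_diff_distrib)
        then show ?thesis
          by (simp add: matrix_vector_mult_def sum_subtractf sum_distrib_left[symmetric]
              sum_divide_distrib[symmetric] inner_vec_def)
      qed
      then have "U *v x = V *v x - ((v \<bullet> x) / v $ a) *\<^sub>R v" for x
        by (simp add: vec_eq_iff)
      then have quad_U: "x \<bullet> (U *v x) = x \<bullet> (V *v x) + 2 * (- (v \<bullet> x) / v $ a) * (v \<bullet> x) + (- (v \<bullet> x) / v $ a)\<^sup>2 * v $ a" for x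
        using pos by (simp add: inner_diff_right inner_commute[of x v] power2_eq_square)
      have U_psd: "0 \<le> x \<bullet> (U *v x)" for x unfolding quad_U by (rule shift)
      have U_zero: "U $ i $ j = 0" if "i \<notin> S" for i j
      proof (cases "i = a")
        case True
        then show ?thesis using pos by (simp add: U v_def)
      next
        case False
        then have "V $ i $ j = 0" "v $ i = 0" using zero[of i] that sym[of a i] by (simp_all add: v_def)
        then show ?thesis by (simp add: U)
      qed
      obtain c :: "'k \<Rightarrow> real^'k" where c: "\<And>i j. U $ i $ j = (\<Sum>k\<in>S. c k $ i * c k $ j)"
        using insert.IH[OF U_sym U_psd U_zero] by blast
      define c' where "c' = c(a := (1 / sqrt (v $ a)) *\<^sub>R v)"
      have "V $ i $ j = (\<Sum>k\<in>insert a S. c' k $ i * c' k $ j)" for i j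
      proof -
        have "(\<Sum>k\<in>S. c' k $ i * c' k $ j) = U $ i $ j"
          unfolding c using insert.hyps by (intro sum.cong) (auto simp: c'_def)
        moreover have "c' a $ i * c' a $ j = v $ i * v $ j / v $ a"
          using pos by (simp add: c'_def)
        ultimately show ?thesis
          unfolding sum.insert[OF insert.hyps] U by linarith
      qed
      then show ?thesis by blast
    qed
  qed
  have "V $ i $ j = transpose V $ j $ i" for i j
    by (simp only: transpose_def vec_lambda_beta)
  then have sym: "V $ i $ j = V $ j $ i" for i j
    by (simp only: assms(1))
  have "\<exists>c :: 'k \<Rightarrow> real^'k. \<forall>i j. V $ i $ j = (\<Sum>k\<in>UNIV. c k $ i * c k $ j)"
    by (rule main[OF finite sym assms(2)]) simp
  then obtain c :: "'k \<Rightarrow> real^'k" where c: "\<And>i j. V $ i $ j = (\<Sum>k\<in>UNIV. c k $ i * c k $ j)"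
    by blast
  show ?thesis
    by (rule exI[of _ "\<chi> i k. c k $ i"]) (simp add: vec_eq_iff matrix_matrix_mult_def transpose_def c)
qed

text \<open>Take the image of the standard Gaussian under a factor W of V. A direction t of zero
  variance is annihilated by the transpose of W, so the functional vanishes almost surely; in any
  other direction the standardised functional is identified by Levy uniqueness. The characteristic
  function is recorded as well, because the continuity theorem needs it and
  \<open>multivariate_normal\<close> does not mention it.\<close>

lemma multivariate_normal_exists:
  fixes V :: "real^'k^'k"
  assumes V: "transpose V = V" "\<And>x. 0 \<le> x \<bullet> (V *v x)"
  shows "\<exists>N. multivariate_normal N 0 V \<and>
    (\<forall>t. (CLINT x|N. iexp (t \<bullet> x)) = exp (- (t \<bullet> (V *v t)) / 2))"
proof -
  obtain W :: "real^'k^'k" where W: "V = W ** transpose W"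
    using psd_factorisation[OF V] by blast
  have lin: "t \<bullet> (W *v x) = (transpose W *v t) \<bullet> x" for t x
    by (metis dot_lmul_matrix transpose_matrix_vector)
  have quad: "t \<bullet> (V *v t) = (transpose W *v t) \<bullet> (transpose W *v t)" for t
    unfolding W matrix_vector_mul_assoc[symmetric] by (rule lin)
  interpret G: prob_space "std_gaussian :: (real^'k) measure" by (rule prob_space_std_gaussian)
  have W_meas [measurable]: "(*v) W \<in> borel_measurable borel"
    by (intro borel_measurable_continuous_onI matrix_vector_mult_linear_continuous_on)
  define N where "N = distr std_gaussian borel ((*v) W)"
  have sets_N [measurable_cong, simp]: "sets N = sets borel" by (simp add: N_def)
  interpret N: prob_space N unfolding N_def by (rule G.prob_space_distr) simp
  have char_N: "(CLINT x|N. iexp (t \<bullet> x)) = exp (- (t \<bullet> (V *v t)) / 2)" for t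
  proof -
    have "(CLINT x|N. iexp (t \<bullet> x)) = (CLINT x|std_gaussian. iexp (t \<bullet> (W *v x)))"
      unfolding N_def
      by (subst integral_distr) (auto intro!: borel_measurable_continuous_onI continuous_intros)
    then show ?thesis unfolding lin std_gaussian_char quad by simp
  qed
  have normal: "if s = 0 then (AE x in N. t \<bullet> x = t \<bullet> 0)
      else distributed N lborel (\<lambda>x. t \<bullet> x) (normal_density (t \<bullet> 0) (sqrt s))"
    if s: "s = t \<bullet> (V *v t)" for s t
  proof (cases "s = 0")
    case True
    then have "transpose W *v t = 0" using s quad by simp
    then have "AE x in N. t \<bullet> x = 0"
      unfolding N_def by (subst AE_distr_iff) (simp_all add: lin del: transpose_matrix_vector)
    with True show ?thesis by simp
  next
    case False
    then have pos: "0 < s" using V(2)[of t] s by simp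
    interpret D: prob_space "distr N borel (\<lambda>x. (t \<bullet> x) / sqrt s)"
      by (rule N.prob_space_distr) simp
    have "real_distribution (distr N borel (\<lambda>x. (t \<bullet> x) / sqrt s))"
      by (simp add: real_distribution_def real_distribution_axioms_def D.prob_space_axioms)
    moreover have "char (distr N borel (\<lambda>x. (t \<bullet> x) / sqrt s)) = char std_normal_distribution"
    proof
      fix u
      have "char (distr N borel (\<lambda>x. (t \<bullet> x) / sqrt s)) u = (CLINT x|N. iexp (((u / sqrt s) *\<^sub>R t) \<bullet> x))"
        unfolding char_def by (subst integral_distr) simp_all
      also have "\<dots> = complex_of_real (exp (- u\<^sup>2 / 2))"
        unfolding char_N unfolding matrix_vector_mult_scaleR inner_scaleR_left inner_scaleR_right s[symmetric]
        using pos by (simp add: power2_eq_square)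
      finally show "char (distr N borel (\<lambda>x. (t \<bullet> x) / sqrt s)) u = char std_normal_distribution u"
        by (simp add: char_std_normal_distribution)
    qed
    ultimately have eq: "distr N borel (\<lambda>x. (t \<bullet> x) / sqrt s) = std_normal_distribution"
      by (intro Levy_uniqueness real_dist_normal_dist)
    have "distributed N lborel (\<lambda>x. (t \<bullet> x - 0) / sqrt s) std_normal_density"
      unfolding distributed_def
    proof (intro conjI)
      show "distr N lborel (\<lambda>x. (t \<bullet> x - 0) / sqrt s) = std_normal_distribution"
        unfolding eq[symmetric] by (intro distr_cong) simp_all
    qed auto
    then have "distributed N lborel (\<lambda>x. t \<bullet> x) (normal_density 0 (sqrt s))"
      by (subst N.normal_standard_normal_convert) (use pos in auto)
    then show ?thesis using False by simp
  qed
  have "multivariate_normal N 0 V"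
    unfolding multivariate_normal_def Let_def
    by (intro conjI allI N.prob_space_axioms sets_N V normal refl)
  with char_N show ?thesis by blast
qed

section \<open>Convergence in law from convergence of characteristic functions\<close>

text \<open>The integrand factors over the coordinates. Only finiteness and positivity of the value
  matter later, for normalising the mollifier.\<close>

lemma gaussian_integral_lborel:
  "\<exists>c>0. has_bochner_integral lborel (\<lambda>x::'a::euclidean_space. exp (- (norm x)\<^sup>2 / 2)) c"
proof -
  have 0: "(norm x)\<^sup>2 = (\<Sum>b\<in>Basis. (x \<bullet> b)\<^sup>2)" for x :: 'a
    unfolding power2_norm_eq_inner by (subst euclidean_inner) (simp only: power2_eq_square)
  have 1: "exp (- (norm x)\<^sup>2 / 2) = (\<Prod>b\<in>Basis. exp (- (x \<bullet> b)\<^sup>2 / 2))" for x :: 'a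
    by (simp add: exp_sum[symmetric] sum_negf sum_divide_distrib[symmetric] 0)
  have 2: "(\<integral>\<^sup>+x. ennreal (exp (- x\<^sup>2 / 2)) \<partial>lborel) = ennreal (sqrt (2 * pi))"
  proof -
    have "has_bochner_integral lborel std_normal_density 1"
      using integrable_normal_density[of 1 0] integral_normal_density[of 1 0]
      by (simp add: has_bochner_integral_iff)
    then have "has_bochner_integral lborel (\<lambda>x. sqrt (2 * pi) * std_normal_density x) (sqrt (2 * pi) * 1)"
      by (rule has_bochner_integral_mult_right)
    then have "has_bochner_integral lborel (\<lambda>x::real. exp (- x\<^sup>2 / 2)) (sqrt (2 * pi))"
      by (simp add: std_normal_density_def)
    then show ?thesis
      by (subst nn_integral_eq_integral) (auto simp: has_bochner_integral_iff)
  qed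
  have "(\<integral>\<^sup>+x. ennreal (exp (- (norm x)\<^sup>2 / 2)) \<partial>(lborel :: 'a measure)) =
      (\<integral>\<^sup>+x. (\<Prod>b\<in>Basis. ennreal (exp (- (x \<bullet> b)\<^sup>2 / 2))) \<partial>(lborel :: 'a measure))"
    unfolding 1 by (simp add: prod_ennreal)
  also have "\<dots> = (\<Prod>b\<in>(Basis::'a set). \<integral>\<^sup>+x. ennreal (exp (- x\<^sup>2 / 2)) \<partial>lborel)"
    by (rule nn_integral_lborel_prod) auto
  also have "\<dots> = ennreal (sqrt (2 * pi) ^ DIM('a))"
    by (simp only: prod_constant 2) (simp add: ennreal_power)
  finally have "has_bochner_integral lborel (\<lambda>x::'a. exp (- (norm x)\<^sup>2 / 2)) (sqrt (2 * pi) ^ DIM('a))"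
    by (intro has_bochner_integral_nn_integral) auto
  then show ?thesis by (intro exI[of _ "sqrt (2 * pi) ^ DIM('a)"]) simp
qed

text \<open>By Fubini, integrating a Gaussian kernel against P is the same as averaging the
  characteristic function of P against \<open>std_gaussian\<close> with weights of modulus 1.
  Pointwise convergence of characteristic functions, all bounded by 1, then passes through dominated
  convergence.\<close>

lemma gaussian_functional_tendsto:
  fixes \<mu> :: "nat \<Rightarrow> (real^'k) measure"
  assumes \<mu>: "\<And>n. prob_space (\<mu> n)" "\<And>n. sets (\<mu> n) = sets borel"
    and N: "prob_space N" "sets N = sets borel"
    and char: "\<And>t. (\<lambda>n. CLINT x|\<mu> n. iexp (t \<bullet> x)) \<longlonglongrightarrow> (CLINT x|N. iexp (t \<bullet> x))"
  shows "(\<lambda>n. LINT x|\<mu> n. gauss s x a) \<longlonglongrightarrow> (LINT x|N. gauss s x a)"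
proof -
  define ch where "ch P g = (CLINT x|P. iexp ((s *\<^sub>R g) \<bullet> x))" for P and g :: "real^'k"
  have bound: "norm (ch P g) \<le> 1" if "prob_space P" for P g
  proof -
    interpret prob_space P by fact
    have "norm (ch P g) \<le> (LINT x|P. norm (iexp ((s *\<^sub>R g) \<bullet> x)))"
      unfolding ch_def by (rule integral_norm_bound)
    then show ?thesis by (simp add: prob_space)
  qed
  have meas: "ch P \<in> borel_measurable std_gaussian"
    if "prob_space P" and [measurable_cong]: "sets P = sets borel" for P :: "(real^'k) measure"
  proof -
    interpret prob_space P by fact
    show ?thesis unfolding ch_def by measurable
  qed
  have swap: "complex_of_real (LINT x|P. gauss s x a) =
      (CLINT g|std_gaussian. iexp (- s * (a \<bullet> g)) * ch P g)"
    if "prob_space P" and [measurable_cong]: "sets P = sets borel" for P :: "(real^'k) measure"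
  proof -
    interpret P: prob_space P by fact
    interpret G: prob_space "std_gaussian :: (real^'k) measure" by (rule prob_space_std_gaussian)
    interpret PG: pair_prob_space P "std_gaussian :: (real^'k) measure" ..
    have "complex_of_real (LINT x|P. gauss s x a) =
        (CLINT x|P. (CLINT g|std_gaussian. iexp ((s *\<^sub>R (x - a)) \<bullet> g)))"
      by (simp only: gaussian_function_eq_char[symmetric] integral_complex_of_real)
    also have "\<dots> = (CLINT g|std_gaussian. (CLINT x|P. iexp ((s *\<^sub>R (x - a)) \<bullet> g)))"
    proof (rule PG.Fubini_integral[symmetric])
      show "integrable (P \<Otimes>\<^sub>M std_gaussian) (\<lambda>(x, g). iexp ((s *\<^sub>R (x - a)) \<bullet> g))"
        by (rule PG.integrable_const_bound[where B = 1]) auto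
    qed
    also have "\<dots> = (CLINT g|std_gaussian. iexp (- s * (a \<bullet> g)) * ch P g)"
    proof (intro Bochner_Integration.integral_cong refl)
      fix g
      have "iexp ((s *\<^sub>R (x - a)) \<bullet> g) = iexp (- s * (a \<bullet> g)) * iexp ((s *\<^sub>R g) \<bullet> x)" for x
        by (simp add: exp_add[symmetric] inner_diff_left inner_commute algebra_simps)
      then show "(CLINT x|P. iexp ((s *\<^sub>R (x - a)) \<bullet> g)) = iexp (- s * (a \<bullet> g)) * ch P g"
        by (simp only: ch_def integral_mult_right_zero)
    qed
    finally show ?thesis .
  qed
  have "(\<lambda>n. CLINT g|std_gaussian. iexp (- s * (a \<bullet> g)) * ch (\<mu> n) g)
     \<longlonglongrightarrow> (CLINT g|std_gaussian. iexp (- s * (a \<bullet> g)) * ch N g)"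
  proof (rule integral_dominated_convergence[where w = "\<lambda>_. 1"])
    interpret G: prob_space "std_gaussian :: (real^'k) measure" by (rule prob_space_std_gaussian)
    show "integrable std_gaussian (\<lambda>_::real^'k. 1::real)" by simp
    show "AE g in std_gaussian. (\<lambda>n. iexp (- s * (a \<bullet> g)) * ch (\<mu> n) g) \<longlonglongrightarrow> iexp (- s * (a \<bullet> g)) * ch N g"
      unfolding ch_def by (intro AE_I2 tendsto_intros char)
    have [measurable]: "ch N \<in> borel_measurable std_gaussian" by (rule meas[OF N])
    show "(\<lambda>g. iexp (- s * (a \<bullet> g)) * ch N g) \<in> borel_measurable std_gaussian" by measurable
    fix n
    have [measurable]: "ch (\<mu> n) \<in> borel_measurable std_gaussian" by (rule meas[OF \<mu>])
    show "(\<lambda>g. iexp (- s * (a \<bullet> g)) * ch (\<mu> n) g) \<in> borel_measurable std_gaussian" by measurable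
    show "AE g in std_gaussian. norm (iexp (- s * (a \<bullet> g)) * ch (\<mu> n) g) \<le> 1"
      using bound[OF \<mu>(1)] by (auto simp: norm_mult)
  qed
  then have "(\<lambda>n. complex_of_real (LINT x|\<mu> n. gauss s x a))
      \<longlonglongrightarrow> complex_of_real (LINT x|N. gauss s x a)"
    by (simp only: swap[OF \<mu>] swap[OF N])
  then show ?thesis by (simp only: tendsto_of_real_iff)
qed

lemma uniformly_continuous_compact_support:
  fixes f :: "'a::euclidean_space \<Rightarrow> real"
  assumes cont: "continuous_on UNIV f" and supp: "\<And>x. R < norm x \<Longrightarrow> f x = 0" and "0 < e"
  shows "\<exists>d>0. \<forall>x y. dist x y < d \<longrightarrow> \<bar>f x - f y\<bar> < e"
proof -
  \<comment> \<open>The extra 1 is a safety margin: if two points at distance below 1 are not both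
    in this ball, both have norm above R, and f vanishes at both.\<close>
  have "uniformly_continuous_on (cball 0 (R + 1)) f"
    by (intro compact_uniformly_continuous continuous_on_subset[OF cont]) auto
  then obtain d where d: "0 < d" "\<And>x y. \<lbrakk>x \<in> cball 0 (R + 1); y \<in> cball 0 (R + 1); dist x y < d\<rbrakk> \<Longrightarrow> dist (f x) (f y) < e"
    using \<open>0 < e\<close> unfolding uniformly_continuous_on_def by (metis dist_commute)
  have "\<bar>f x - f y\<bar> < e" if "dist x y < min d 1" for x y
  proof (cases "norm x \<le> R + 1 \<and> norm y \<le> R + 1")
    case True
    then show ?thesis using d(2)[of x y] that by (simp add: dist_real_def)
  next
    case False
    have "\<bar>norm x - norm y\<bar> < 1"
      using that norm_triangle_ineq3[of x y] by (simp add: dist_norm)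
    with False have "R < norm x" "R < norm y" by linarith+
    then show ?thesis using supp \<open>0 < e\<close> by simp
  qed
  then show ?thesis using d(1) by (intro exI[of _ "min d 1"]) auto
qed

lemma compact_support_bounded:
  fixes f :: "'a::euclidean_space \<Rightarrow> real"
  assumes cont: "continuous_on UNIV f" and supp: "\<And>x. R < norm x \<Longrightarrow> f x = 0"
  shows "\<exists>B\<ge>0. \<forall>x. \<bar>f x\<bar> \<le> B"
proof -
  have "bounded (f ` cball 0 R)"
    by (intro compact_imp_bounded compact_continuous_image continuous_on_subset[OF cont]) auto
  then obtain B0 where B0: "\<And>x. x \<in> cball 0 R \<Longrightarrow> \<bar>f x\<bar> \<le> B0"
    unfolding bounded_iff by fastforce
  have "\<bar>f x\<bar> \<le> max B0 0" for x
    using B0[of x] supp[of x] by (cases "norm x \<le> R") auto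
  then show ?thesis by (intro exI[of _ "max B0 0"]) simp
qed

text \<open>Convolution with a Gaussian of width 1/s, normalised by \<open>k\<close>. After
  substituting y = x + u/s the error is an integral over u: on \<open>norm u < n * d\<close> uniform
  continuity of f bounds it, and beyond that the Gaussian tail does.\<close>

lemma gaussian_mollification:
  fixes f :: "'a::euclidean_space \<Rightarrow> real"
  assumes cont: "continuous_on UNIV f" and supp: "\<And>x. R < norm x \<Longrightarrow> f x = 0" and "0 < e"
  shows "\<exists>s>0. \<exists>k. \<forall>x. \<bar>k * (LINT y|lborel. f y * gauss s x y) - f x\<bar> \<le> e"
proof -
  define w where "w x = exp (- (norm x)\<^sup>2 / 2)" for x :: 'a
  obtain c where "0 < c" and c: "has_bochner_integral lborel w c"
    using gaussian_integral_lborel unfolding w_def by blast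
  have w_int [simp]: "integrable lborel w" "integral\<^sup>L lborel w = c"
    using c by (auto simp: has_bochner_integral_iff)
  have [measurable]: "f \<in> borel_measurable borel" "w \<in> borel_measurable borel"
    using cont by (auto simp: w_def[abs_def] intro!: borel_measurable_continuous_onI)
  obtain B where "0 \<le> B" and B: "\<And>x. \<bar>f x\<bar> \<le> B"
    using compact_support_bounded[OF cont supp] by blast
  obtain d where "0 < d" and d: "\<And>x y. dist x y < d \<Longrightarrow> \<bar>f x - f y\<bar> < e / 2"
    using uniformly_continuous_compact_support[OF cont supp, of R "e / 2"] \<open>0 < e\<close> by auto
  let ?tail = "\<lambda>n u. indicator {u :: 'a. real n * d \<le> norm u} u :: real"
  have "(\<lambda>n. LINT u|lborel. ?tail n u * w u) \<longlonglongrightarrow> (LINT u|(lborel :: 'a measure). 0)"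
  proof (rule integral_dominated_convergence[where w = w])
    show "AE u in (lborel :: 'a measure). (\<lambda>n. ?tail n u * w u) \<longlonglongrightarrow> 0"
    proof (rule AE_I2, rule tendsto_eventually)
      fix u :: 'a
      obtain m :: nat where m: "norm u / d < real m" using reals_Archimedean2 by blast
      show "\<forall>\<^sub>F n in sequentially. ?tail n u * w u = 0"
        using eventually_ge_at_top[of m]
      proof eventually_elim
        case (elim n)
        then have "norm u / d < real n" using m by linarith
        then show ?case using \<open>0 < d\<close> by (simp add: field_simps)
      qed
    qed
  qed (auto simp: w_def indicator_def)
  \<comment> \<open>On the tail f varies by at most 2B, and 2B times this threshold is at most c * e
    / 2, the share left over by uniform continuity. B + 1 avoids dividing by zero.\<close>
  then have "\<forall>\<^sub>F n in sequentially. (LINT u|lborel. ?tail n u * w u) < c * e / (4 * (B + 1))"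
    using \<open>0 < c\<close> \<open>0 < e\<close> \<open>0 \<le> B\<close> by (intro order_tendstoD) (auto intro!: divide_pos_pos)
  then obtain n :: nat where n: "0 < n" "(LINT u|lborel. ?tail n u * w u) < c * e / (4 * (B + 1))"
    using eventually_gt_at_top[of 0] by (metis (mono_tags, lifting) eventually_conj eventually_sequentially order_refl)
  \<comment> \<open>Tying the scale to the tail index makes \<open>norm u < n * d\<close> the same
    as a displacement u/s shorter than d.\<close>
  define s where "s = real n"
  have s: "0 < s" using n by (simp add: s_def)
  let ?f = "\<lambda>x u. f (x + (1 / s) *\<^sub>R u)" and ?I = "\<lambda>x. LINT u|lborel. f (x + (1 / s) *\<^sub>R u) * w u"
  define k where "k = s ^ DIM('a) / c"
  have "\<bar>k * (LINT y|lborel. f y * gauss s x y) - f x\<bar> \<le> e" for x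
  proof -
    have lb: "(lborel :: 'a measure) = density (distr lborel borel (\<lambda>u. x + (1 / s) *\<^sub>R u)) (\<lambda>_. \<bar>1 / s\<bar> ^ DIM('a))"
      by (rule lborel_affine) (use s in simp)
    have "(LINT y|lborel. f y * gauss s x y) =
        (LINT u|lborel. (1 / s) ^ DIM('a) * (?f x u * w u))"
      by (subst lb, subst integral_density, simp_all, subst integral_distr)
        (use s in \<open>auto simp: w_def power_mult_distrib power_divide intro!: Bochner_Integration.integral_cong\<close>)
    also have "\<dots> = (1 / s) ^ DIM('a) * ?I x"
      by (rule integral_mult_right_zero)
    finally have scaled: "k * (LINT y|lborel. f y * gauss s x y) =
        ?I x / c"
      using s by (simp add: k_def power_divide)
    have int1: "integrable lborel (\<lambda>u. ?f x u * w u)"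
    proof (rule Bochner_Integration.integrable_bound)
      show "integrable lborel (\<lambda>u. B * w u)" by simp
      show "AE u in lborel. norm (?f x u * w u) \<le> norm (B * w u)"
        using B by (auto simp: abs_mult w_def \<open>0 \<le> B\<close> intro!: mult_right_mono AE_I2)
    qed measurable
    have int2: "integrable lborel (\<lambda>u. ?tail n u * w u)"
      by (rule Bochner_Integration.integrable_bound[OF w_int(1)]) (auto simp: w_def indicator_def)
    have "\<bar>?I x - f x * c\<bar> =
        \<bar>LINT u|lborel. (?f x u - f x) * w u\<bar>"
      using int1 by (simp add: left_diff_distrib)
    also have "\<dots> \<le> (LINT u|lborel. \<bar>(?f x u - f x) * w u\<bar>)"
      by (rule integral_abs_bound)
    also have "\<dots> \<le> (LINT u|lborel. e / 2 * w u + 2 * B * (?tail n u * w u))"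
    proof (rule integral_mono)
      show "integrable lborel (\<lambda>u. \<bar>(?f x u - f x) * w u\<bar>)"
        using int1 by (simp add: left_diff_distrib)
      show "integrable lborel (\<lambda>u. e / 2 * w u + 2 * B * (?tail n u * w u))"
        using int2 by simp
      fix u :: 'a
      have wp: "0 < w u" by (simp add: w_def)
      have "\<bar>?f x u - f x\<bar> \<le> e / 2 + 2 * B * ?tail n u"
      proof (cases "real n * d \<le> norm u")
        case True
        then show ?thesis using B[of x] B[of "x + (1 / s) *\<^sub>R u"] \<open>0 < e\<close> by simp
      next
        case False
        then have "dist (x + (1 / s) *\<^sub>R u) x < d"
          using s by (simp add: dist_norm s_def field_simps)
        then show ?thesis using d[of "x + (1 / s) *\<^sub>R u" x] False by simp
      qed
      then have "\<bar>?f x u - f x\<bar> * w u \<le> (e / 2 + 2 * B * ?tail n u) * w u"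
        using wp by (intro mult_right_mono) auto
      then show "\<bar>(?f x u - f x) * w u\<bar> \<le> e / 2 * w u + 2 * B * (?tail n u * w u)"
        using wp by (simp add: abs_mult distrib_right mult.assoc)
    qed
    also have "\<dots> = e / 2 * c + 2 * B * (LINT u|lborel. ?tail n u * w u)"
      using int2 by simp
    also have "\<dots> \<le> e / 2 * c + 2 * B * (c * e / (4 * (B + 1)))"
      using n(2) by (intro add_left_mono mult_left_mono) (auto simp: \<open>0 \<le> B\<close>)
    also have "2 * B * (c * e / (4 * (B + 1))) \<le> e / 2 * c"
    proof -
      have "B / (B + 1) \<le> 1" using \<open>0 \<le> B\<close> by simp
      then have "B / (B + 1) * (c * e / 2) \<le> 1 * (c * e / 2)"
        using \<open>0 < c\<close> \<open>0 < e\<close> by (intro mult_right_mono) auto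
      then show ?thesis using \<open>0 \<le> B\<close> by (simp add: field_simps)
    qed
    finally have "\<bar>?I x - f x * c\<bar> \<le> e * c" by (simp add: mult.commute)
    moreover have "?I x / c - f x =
        (?I x - f x * c) / c"
      using \<open>0 < c\<close> by (simp add: diff_divide_distrib)
    then have "\<bar>?I x / c - f x\<bar> =
        \<bar>?I x - f x * c\<bar> / c"
      using \<open>0 < c\<close> by (simp only: abs_divide abs_of_pos)
    ultimately show ?thesis unfolding scaled using \<open>0 < c\<close> by (simp add: divide_le_eq)
  qed
  then show ?thesis using s by blast
qed

text \<open>Fubini turns the integral of a mollified f into a Lebesgue integral of f(y) times the
  integral of a Gaussian centred at y. These converge for each y and are dominated by the absolute
  value of f. The mollification error is uniform in x, hence the same for every probability
  measure.\<close>

lemma compact_support_tendsto: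
  fixes \<mu> :: "nat \<Rightarrow> (real^'k) measure" and f :: "real^'k \<Rightarrow> real"
  assumes \<mu>: "\<And>n. prob_space (\<mu> n)" "\<And>n. sets (\<mu> n) = sets borel"
    and N: "prob_space N" "sets N = sets borel"
    and char: "\<And>t. (\<lambda>n. CLINT x|\<mu> n. iexp (t \<bullet> x)) \<longlonglongrightarrow> (CLINT x|N. iexp (t \<bullet> x))"
    and cont: "continuous_on UNIV f" and supp: "\<And>x. R < norm x \<Longrightarrow> f x = 0"
  shows "(\<lambda>n. LINT x|\<mu> n. f x) \<longlonglongrightarrow> (LINT x|N. f x)"
proof -
  have [measurable]: "f \<in> borel_measurable borel"
    using cont by (rule borel_measurable_continuous_onI)
  have int_f: "integrable lborel f"
  proof -
    have "integrable lborel (\<lambda>x. indicator (cball 0 R) x *\<^sub>R f x)"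
      by (intro borel_integrable_compact continuous_on_subset[OF cont]) auto
    moreover have "(\<lambda>x. indicator (cball 0 R) x *\<^sub>R f x) = f"
      using supp by (force simp: indicator_def fun_eq_iff)
    ultimately show ?thesis by simp
  qed
  obtain B where B: "\<And>x. \<bar>f x\<bar> \<le> B"
    using compact_support_bounded[OF cont supp] by blast
  define F where "F s x = (LINT y|lborel. f y * gauss s x y)" for s x
  have F_meas [measurable]: "F s \<in> borel_measurable borel" for s
    unfolding F_def by measurable
  have F_int: "integrable P (F s)" if "prob_space P" and [measurable_cong]: "sets P = sets borel" for P s
  proof -
    interpret prob_space P by fact
    show ?thesis
    proof (rule integrable_const_bound[where B = "LINT y|lborel. \<bar>f y\<bar>"], rule AE_I2)
      fix x
      have "norm (F s x) \<le> (LINT y|lborel. norm (f y * gauss s x y))"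
        unfolding F_def by (rule integral_norm_bound)
      also have "\<dots> \<le> (LINT y|lborel. \<bar>f y\<bar>)"
      proof (rule integral_mono')
        show "integrable lborel (\<lambda>y. \<bar>f y\<bar>)" using int_f by simp
        show "norm (f y * gauss s x y) \<le> \<bar>f y\<bar>" for y
          by (simp add: abs_mult mult_left_le)
      qed simp
      finally show "norm (F s x) \<le> (LINT y|lborel. \<bar>f y\<bar>)" .
    qed measurable
  qed
  have swap: "(LINT x|P. F s x) = (LINT y|lborel. f y * (LINT x|P. gauss s x y))"
    if "prob_space P" and [measurable_cong]: "sets P = sets borel" for P s
  proof -
    interpret P: prob_space P by fact
    interpret L: pair_sigma_finite lborel P ..
    have "(LINT x|P. F s x) = (LINT y|lborel. (LINT x|P. f y * gauss s x y))"
      unfolding F_def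
    proof (rule L.Fubini_integral)
      show "integrable (lborel \<Otimes>\<^sub>M P) (\<lambda>(y, x). f y * gauss s x y)"
      proof (rule Bochner_Integration.integrable_bound)
        show "integrable (lborel \<Otimes>\<^sub>M P) (\<lambda>(y, x). f y * 1)"
          by (rule L.Fubini_integrable) (use int_f in \<open>auto simp: P.prob_space\<close>)
      qed (auto simp: abs_mult mult_left_le)
    qed
    then show ?thesis by simp
  qed
  have F_lim: "(\<lambda>n. LINT x|\<mu> n. F s x) \<longlonglongrightarrow> (LINT x|N. F s x)" for s
    unfolding swap[OF \<mu>] swap[OF N]
  proof (rule integral_dominated_convergence[where w = "\<lambda>y. \<bar>f y\<bar>"])
    have meas: "(\<lambda>y. LINT x|P. gauss s x y) \<in> borel_measurable borel"
      if "prob_space P" and [measurable_cong]: "sets P = sets borel" for P :: "(real^'k) measure"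
    proof -
      interpret prob_space P by fact
      show ?thesis by measurable
    qed
    note [measurable] = meas[OF N] meas[OF \<mu>]
    show "integrable lborel (\<lambda>y. \<bar>f y\<bar>)" using int_f by simp
    show "AE y in lborel. (\<lambda>n. f y * (LINT x|\<mu> n. gauss s x y))
       \<longlonglongrightarrow> f y * (LINT x|N. gauss s x y)"
      by (intro AE_I2 tendsto_intros gaussian_functional_tendsto[OF \<mu> N char])
    show "(\<lambda>y. f y * (LINT x|N. gauss s x y)) \<in> borel_measurable lborel"
      by measurable
    fix n
    show "(\<lambda>y. f y * (LINT x|\<mu> n. gauss s x y)) \<in> borel_measurable lborel"
      by measurable
    interpret P: prob_space "\<mu> n" by (rule \<mu>)
    have "\<bar>LINT x|\<mu> n. gauss s x y\<bar> \<le> 1" for y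
    proof -
      have "\<bar>LINT x|\<mu> n. gauss s x y\<bar> \<le> (LINT x|\<mu> n. 1)"
        by (rule order_trans[OF integral_abs_bound], rule integral_mono') auto
      then show ?thesis by (simp add: P.prob_space)
    qed
    then have "\<bar>f y\<bar> * \<bar>LINT x|\<mu> n. gauss s x y\<bar> \<le> \<bar>f y\<bar> * 1" for y
      by (rule mult_left_mono) (rule abs_ge_zero)
    then show "AE y in lborel. norm (f y * (LINT x|\<mu> n. gauss s x y)) \<le> \<bar>f y\<bar>"
      unfolding real_norm_def abs_mult mult_1_right by (intro AE_I2)
  qed
  show ?thesis
  proof (rule LIMSEQ_I)
    fix r :: real assume "0 < r"
    obtain s k where "\<And>x. \<bar>k * F s x - f x\<bar> \<le> r / 4"
      using gaussian_mollification[OF cont supp, of R "r / 4"] \<open>0 < r\<close> unfolding F_def by auto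
    then have sk: "\<bar>k * (LINT x|P. F s x) - (LINT x|P. f x)\<bar> \<le> r / 4" if P: "prob_space P" and [measurable_cong]: "sets P = sets borel" for P
    proof -
      interpret P: prob_space P by fact
      have f: "integrable P f"
        by (rule P.integrable_const_bound[where B = B]) (use B in auto)
      have "\<bar>k * (LINT x|P. F s x) - (LINT x|P. f x)\<bar> = \<bar>LINT x|P. k * F s x - f x\<bar>"
        using f F_int[OF that] by simp
      also have "\<dots> \<le> (LINT x|P. \<bar>k * F s x - f x\<bar>)" by (rule integral_abs_bound)
      also have "\<dots> \<le> (LINT x|P. r / 4)"
        by (rule integral_mono') (use \<open>\<And>x. \<bar>k * F s x - f x\<bar> \<le> r / 4\<close> \<open>0 < r\<close> in auto)
      finally show ?thesis by (simp add: P.prob_space)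
    qed
    have "(\<lambda>n. k * (LINT x|\<mu> n. F s x)) \<longlonglongrightarrow> k * (LINT x|N. F s x)"
      by (intro tendsto_intros F_lim)
    then obtain n0 where n0: "\<And>n. n0 \<le> n \<Longrightarrow> \<bar>k * (LINT x|\<mu> n. F s x) - k * (LINT x|N. F s x)\<bar> < r / 4"
      using \<open>0 < r\<close> by (metis LIMSEQ_D real_norm_def zero_less_divide_iff zero_less_numeral)
    then have "norm ((LINT x|\<mu> n. f x) - (LINT x|N. f x)) < r" if "n0 \<le> n" for n
      using sk[OF \<mu>(1,2)[of n]] sk[OF N] n0[OF that] \<open>0 < r\<close>
      unfolding real_norm_def by linarith
    then show "\<exists>n0. \<forall>n\<ge>n0. norm ((LINT x|\<mu> n. f x) - (LINT x|N. f x)) < r" by blast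
  qed
qed

text \<open>Tightness comes at no cost: the cut-off \<open>h R\<close> is itself continuous with
  compact support, so its integrals converge, and a limit law with little mass outside a ball forces
  the same on the laws of large index.\<close>

lemma weak_convergence_of_char:
  fixes \<mu> :: "nat \<Rightarrow> (real^'k) measure" and f :: "real^'k \<Rightarrow> real"
  assumes \<mu>: "\<And>n. prob_space (\<mu> n)" "\<And>n. sets (\<mu> n) = sets borel"
    and N: "prob_space N" "sets N = sets borel"
    and char: "\<And>t. (\<lambda>n. CLINT x|\<mu> n. iexp (t \<bullet> x)) \<longlonglongrightarrow> (CLINT x|N. iexp (t \<bullet> x))"
    and cont: "continuous_on UNIV f" and bdd: "bounded (range f)"
  shows "(\<lambda>n. LINT x|\<mu> n. f x) \<longlonglongrightarrow> (LINT x|N. f x)"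
proof (rule LIMSEQ_I)
  fix r :: real assume "0 < r"
  obtain B where "0 < B" and B: "\<And>x. \<bar>f x\<bar> \<le> B"
    using bdd unfolding bounded_pos by auto
  define h where "h R x = max 0 (min 1 (real R + 1 - norm x))" for R :: nat and x :: "real^'k"
  have h_cont: "continuous_on UNIV (h R)" for R
    unfolding h_def by (intro continuous_intros)
  have h01: "0 \<le> h R x" "h R x \<le> 1" for R x by (auto simp: h_def)
  have h0: "h R x = 0" if "real R + 1 < norm x" for R x using that by (simp add: h_def)
  have [measurable]: "f \<in> borel_measurable borel" "h R \<in> borel_measurable borel" for R
    using cont h_cont by (auto intro: borel_measurable_continuous_onI)
  interpret N: prob_space N by (rule N)
  note [measurable_cong] = N(2)
  have "(\<lambda>R. LINT x|N. h R x) \<longlonglongrightarrow> (LINT x|N. 1)"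
  proof (rule integral_dominated_convergence[where w = "\<lambda>_. 1"])
    show "AE x in N. (\<lambda>R. h R x) \<longlonglongrightarrow> 1"
    proof (intro AE_I2 tendsto_eventually)
      fix x :: "real^'k"
      obtain m :: nat where m: "norm x \<le> real m" using real_arch_simple by blast
      show "\<forall>\<^sub>F R in sequentially. h R x = 1"
        using eventually_ge_at_top[of m] by eventually_elim (use m in \<open>auto simp: h_def\<close>)
    qed
  qed (use h01 in auto)
  \<comment> \<open>With this threshold, replacing f by f times the cut-off costs less than r/8,
    both under N and, for large n, under the n-th law.\<close>
  then have "\<forall>\<^sub>F R in sequentially. 1 - r / (8 * B) < (LINT x|N. h R x)"
    using \<open>0 < r\<close> \<open>0 < B\<close> by (intro order_tendstoD) (auto simp: N.prob_space)
  then obtain R where R: "1 - r / (8 * B) < (LINT x|N. h R x)"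
    by (auto simp: eventually_sequentially)
  have split: "\<bar>(LINT x|P. f x) - (LINT x|P. f x * h R x)\<bar> \<le> B * (1 - (LINT x|P. h R x))"
    if "prob_space P" and [measurable_cong]: "sets P = sets borel" for P
  proof -
    interpret P: prob_space P by fact
    have f: "integrable P f"
      by (rule P.integrable_const_bound[where B = B]) (use B in auto)
    have h: "integrable P (h R)"
      by (rule P.integrable_const_bound[where B = 1]) (use h01 in auto)
    have "integrable P (\<lambda>x. f x * h R x)"
      by (rule Bochner_Integration.integrable_bound[OF f]) (use h01 in \<open>auto simp: abs_mult mult_left_le\<close>)
    note int = f h this
    have "\<bar>(LINT x|P. f x) - (LINT x|P. f x * h R x)\<bar> = \<bar>LINT x|P. f x - f x * h R x\<bar>"
      using int by simp
    also have "\<dots> \<le> (LINT x|P. \<bar>f x - f x * h R x\<bar>)" by (rule integral_abs_bound)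
    also have "\<dots> \<le> (LINT x|P. B * (1 - h R x))"
    proof (rule integral_mono)
      fix x
      have "f x - f x * h R x = f x * (1 - h R x)" by (simp add: right_diff_distrib)
      then have "\<bar>f x - f x * h R x\<bar> = \<bar>f x\<bar> * (1 - h R x)"
        using h01[of R x] by (simp add: abs_mult)
      then show "\<bar>f x - f x * h R x\<bar> \<le> B * (1 - h R x)"
        using B[of x] h01[of R x] by (simp add: mult_right_mono)
    qed (use int in auto)
    also have "\<dots> = B * (1 - (LINT x|P. h R x))" using int by (simp add: P.prob_space)
    finally show ?thesis .
  qed
  have lim: "(\<lambda>n. LINT x|\<mu> n. f x * h R x) \<longlonglongrightarrow> (LINT x|N. f x * h R x)"
    by (rule compact_support_tendsto[OF \<mu> N char, where R = "real R + 1"])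
      (use h0 cont h_cont in \<open>auto intro!: continuous_intros\<close>)
  have ev1: "\<forall>\<^sub>F n in sequentially. \<bar>(LINT x|\<mu> n. f x * h R x) - (LINT x|N. f x * h R x)\<bar> < r / 4"
    using tendstoD[OF lim, of "r / 4"] \<open>0 < r\<close> unfolding dist_real_def by simp
  have "(\<lambda>n. LINT x|\<mu> n. h R x) \<longlonglongrightarrow> (LINT x|N. h R x)"
    by (rule compact_support_tendsto[OF \<mu> N char, where R = "real R + 1"]) (use h0 h_cont in auto)
  then have ev2: "\<forall>\<^sub>F n in sequentially. 1 - r / (8 * B) < (LINT x|\<mu> n. h R x)"
    by (rule order_tendstoD(1)[OF _ R])
  have small: "B * (1 - y) < r / 8" if "1 - r / (8 * B) < y" for y
    using that \<open>0 < B\<close> by (simp add: field_simps)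
  have step: "norm ((LINT x|\<mu> n. f x) - (LINT x|N. f x)) < r"
    if *: "\<bar>(LINT x|\<mu> n. f x * h R x) - (LINT x|N. f x * h R x)\<bar> < r / 4"
      "1 - r / (8 * B) < (LINT x|\<mu> n. h R x)" for n
  proof -
    have "\<bar>(LINT x|\<mu> n. f x) - (LINT x|\<mu> n. f x * h R x)\<bar> < r / 8"
      by (rule le_less_trans[OF split[OF \<mu>] small[OF *(2)]])
    moreover have "\<bar>(LINT x|N. f x) - (LINT x|N. f x * h R x)\<bar> < r / 8"
      by (rule le_less_trans[OF split[OF N] small[OF R]])
    ultimately show ?thesis
      using *(1) \<open>0 < r\<close> unfolding real_norm_def by linarith
  qed
  have "\<forall>\<^sub>F n in sequentially. norm ((LINT x|\<mu> n. f x) - (LINT x|N. f x)) < r"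
    using ev1 ev2
  proof eventually_elim
    case (elim n)
    then show ?case by (rule step)
  qed
  then show "\<exists>n0. \<forall>n\<ge>n0. norm ((LINT x|\<mu> n. f x) - (LINT x|N. f x)) < r"
    by (simp add: eventually_sequentially)
qed

section \<open>Events of high probability and the law of large numbers\<close>

text \<open>The exceptional set need not be measurable, so it is covered by a measurable one. The
  explicit level e is kept because boundedness in probability gives a bound only after e has been
  fixed, as opposed to \<open>whp\<close>, which asks for all e.\<close>

definition evprob :: "'w measure \<Rightarrow> (nat \<Rightarrow> 'w \<Rightarrow> bool) \<Rightarrow> real \<Rightarrow> bool" where
  "evprob M P e \<longleftrightarrow>
     (\<forall>\<^sub>F n in sequentially. \<exists>B\<in>sets M. {\<omega>\<in>space M. \<not> P n \<omega>} \<subseteq> B \<and> measure M B \<le> e)"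

definition whp :: "'w measure \<Rightarrow> (nat \<Rightarrow> 'w \<Rightarrow> bool) \<Rightarrow> bool" where
  "whp M P \<longleftrightarrow> (\<forall>e>0. evprob M P e)"

context prob_space
begin

lemma evprob_mono:
  assumes "evprob M P e" "e \<le> e'" "\<forall>\<^sub>F n in sequentially. \<forall>\<omega>\<in>space M. P n \<omega> \<longrightarrow> Q n \<omega>"
  shows "evprob M Q e'"
  using assms(1,3) unfolding evprob_def
proof eventually_elim
  case (elim n)
  then obtain B where "B \<in> sets M" "{\<omega>\<in>space M. \<not> P n \<omega>} \<subseteq> B" "measure M B \<le> e" by blast
  with elim(2) assms(2) show ?case by (intro bexI[of _ B]) auto
qed

lemma evprob_conj:
  assumes "evprob M P a" "evprob M Q b"
  shows "evprob M (\<lambda>n \<omega>. P n \<omega> \<and> Q n \<omega>) (a + b)"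
  using assms unfolding evprob_def
proof eventually_elim
  case (elim n)
  then obtain A B where AB: "A \<in> sets M" "{\<omega>\<in>space M. \<not> P n \<omega>} \<subseteq> A" "measure M A \<le> a"
    "B \<in> sets M" "{\<omega>\<in>space M. \<not> Q n \<omega>} \<subseteq> B" "measure M B \<le> b" by blast
  have "measure M (A \<union> B) \<le> measure M A + measure M B"
    using AB by (intro measure_Un_le) auto
  with AB show ?case by (intro bexI[of _ "A \<union> B"]) auto
qed

lemma whp_evprob_conj:
  assumes "whp M P" "evprob M Q b" "b < c"
  shows "evprob M (\<lambda>n \<omega>. P n \<omega> \<and> Q n \<omega>) c"
  using evprob_conj[of P "c - b" Q b] assms by (simp add: whp_def)

lemma whp_mono:
  assumes "whp M P" "\<forall>\<^sub>F n in sequentially. \<forall>\<omega>\<in>space M. P n \<omega> \<longrightarrow> Q n \<omega>"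
  shows "whp M Q"
  using assms evprob_mono unfolding whp_def by blast

lemma whp_conj:
  assumes "whp M P" "whp M Q"
  shows "whp M (\<lambda>n \<omega>. P n \<omega> \<and> Q n \<omega>)"
  unfolding whp_def
proof safe
  fix e :: real assume "0 < e"
  then have "evprob M Q (e / 2)" using assms(2) by (simp add: whp_def)
  with assms(1) show "evprob M (\<lambda>n \<omega>. P n \<omega> \<and> Q n \<omega>) e"
    by (rule whp_evprob_conj) (use \<open>0 < e\<close> in simp)
qed

lemma whp_AE:
  assumes "\<forall>\<^sub>F n in sequentially. AE \<omega> in M. P n \<omega>"
  shows "whp M P"
  unfolding whp_def evprob_def
proof safe
  fix e :: real assume "0 < e"
  show "\<forall>\<^sub>F n in sequentially. \<exists>B\<in>sets M. {\<omega>\<in>space M. \<not> P n \<omega>} \<subseteq> B \<and> measure M B \<le> e"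
    using assms
  proof eventually_elim
    case (elim n)
    then obtain B where "{\<omega>\<in>space M. \<not> P n \<omega>} \<subseteq> B" "emeasure M B = 0" "B \<in> sets M"
      by (rule AE_E)
    then show ?case using \<open>0 < e\<close> by (intro bexI[of _ B]) (auto simp: measure_def)
  qed
qed

text \<open>Outer measure is attained by a measurable cover, which links the limit of outer measures
  with covers of small probability.\<close>

lemma converges_in_prob_iff_whp:
  "converges_in_prob M X c \<longleftrightarrow> (\<forall>\<epsilon>>0. whp M (\<lambda>n \<omega>. dist (X n \<omega>) c \<le> \<epsilon>))"
proof -
  have "(\<lambda>n. outer_measure_of M {\<omega> \<in> space M. \<epsilon> < dist (X n \<omega>) c}) \<longlonglongrightarrow> 0 \<longleftrightarrow>
    whp M (\<lambda>n \<omega>. dist (X n \<omega>) c \<le> \<epsilon>)" for \<epsilon>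
  proof -
    define S where "S n = {\<omega> \<in> space M. \<epsilon> < dist (X n \<omega>) c}" for n
    have S_eq: "{\<omega>\<in>space M. \<not> dist (X n \<omega>) c \<le> \<epsilon>} = S n" for n by (auto simp: S_def)
    have att: "\<exists>B\<in>sets M. S n \<subseteq> B \<and> outer_measure_of M (S n) = emeasure M B" for n
      by (rule outer_measure_of_attain) (auto simp: S_def)
    have "(\<lambda>n. outer_measure_of M (S n)) \<longlonglongrightarrow> 0 \<longleftrightarrow>
      (\<forall>e>0. \<forall>\<^sub>F n in sequentially. \<exists>B\<in>sets M. S n \<subseteq> B \<and> measure M B \<le> e)"
    proof safe
      fix e :: real assume lim: "(\<lambda>n. outer_measure_of M (S n)) \<longlonglongrightarrow> 0" and "0 < e"
      then have "\<forall>\<^sub>F n in sequentially. outer_measure_of M (S n) < ennreal e"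
        by (intro order_tendstoD) auto
      then show "\<forall>\<^sub>F n in sequentially. \<exists>B\<in>sets M. S n \<subseteq> B \<and> measure M B \<le> e"
      proof eventually_elim
        case (elim n)
        then obtain B where B: "B \<in> sets M" "S n \<subseteq> B" "emeasure M B < ennreal e"
          using att[of n] by auto
        then have "measure M B \<le> e"
          using \<open>0 < e\<close> by (simp add: emeasure_eq_measure ennreal_less_iff)
        with B show ?case by blast
      qed
    next
      assume H: "\<forall>e>0. \<forall>\<^sub>F n in sequentially. \<exists>B\<in>sets M. S n \<subseteq> B \<and> measure M B \<le> e"
      show "(\<lambda>n. outer_measure_of M (S n)) \<longlonglongrightarrow> 0"
      proof (rule order_tendstoI)
        fix a :: ennreal assume "0 < a"
        then obtain b where b: "0 < b" "b < a" by (rule dense[THEN exE]) auto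
        then obtain e where e: "0 < e" "b = ennreal e"
          by (cases b) auto
        then have "\<forall>\<^sub>F n in sequentially. \<exists>B\<in>sets M. S n \<subseteq> B \<and> measure M B \<le> e"
          using H by simp
        then show "\<forall>\<^sub>F n in sequentially. outer_measure_of M (S n) < a"
        proof eventually_elim
          case (elim n)
          then obtain B where B: "B \<in> sets M" "S n \<subseteq> B" "measure M B \<le> e" by blast
          then have "outer_measure_of M (S n) \<le> emeasure M B"
            using outer_measure_of_mono[of "S n" B M] by simp
          also have "\<dots> \<le> b" using B e by (simp add: emeasure_eq_measure)
          finally show ?case using b by simp
        qed
      qed simp
    qed
    then show ?thesis unfolding whp_def evprob_def S_eq S_def by simp
  qed
  then show ?thesis unfolding converges_in_prob_def by simp
qed

lemma small_op_iff_whp: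
  "small_op M X (\<lambda>n. 1 / sqrt (real n)) \<longleftrightarrow> (\<forall>\<epsilon>>0. whp M (\<lambda>n \<omega>. sqrt (real n) * norm (X n \<omega>) \<le> \<epsilon>))"
  unfolding small_op_def converges_in_prob_iff_whp by simp

lemma small_op_1_iff_whp:
  "small_op M X (\<lambda>_. 1) \<longleftrightarrow> (\<forall>\<epsilon>>0. whp M (\<lambda>n \<omega>. norm (X n \<omega>) \<le> \<epsilon>))"
  unfolding small_op_def converges_in_prob_iff_whp by simp

end

section \<open>Chebyshev bounds for means of independent samples\<close>

lemma sample_mean_inner: "sample_mean n z f \<bullet> b = sample_mean n z (\<lambda>x. f x \<bullet> b)"
  by (simp add: sample_mean_def inner_sum_left)

lemma (in prob_space) indep_square_expectation_sum:
  fixes Y :: "nat \<Rightarrow> 'a \<Rightarrow> real"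
  assumes indep: "indep_vars (\<lambda>_. borel) Y UNIV"
    and int: "\<And>i. integrable M (\<lambda>\<omega>. (Y i \<omega>)\<^sup>2)"
    and mean: "\<And>i. expectation (Y i) = 0" and var: "\<And>i. expectation (\<lambda>\<omega>. (Y i \<omega>)\<^sup>2) = v"
  shows "integrable M (\<lambda>\<omega>. (\<Sum>i<n. Y i \<omega>)\<^sup>2)" "expectation (\<lambda>\<omega>. (\<Sum>i<n. Y i \<omega>)\<^sup>2) = real n * v"
proof -
  have [measurable]: "Y i \<in> borel_measurable M" for i
    using indep by (auto simp: indep_vars_def)
  have Y_int: "integrable M (Y i)" for i
    by (rule square_integrable_imp_integrable[OF _ int]) simp
  have sq: "(\<Sum>i<n. Y i \<omega>)\<^sup>2 = (\<Sum>i<n. \<Sum>j<n. Y i \<omega> * Y j \<omega>)" for \<omega>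
    by (simp add: power2_eq_square sum_product)
  have prod: "integrable M (\<lambda>\<omega>. Y i \<omega> * Y j \<omega>) \<and> expectation (\<lambda>\<omega>. Y i \<omega> * Y j \<omega>) = (if i = j then v else 0)" for i j
  proof (cases "i = j")
    case True
    then show ?thesis using int[of i] var[of i] by (simp add: power2_eq_square)
  next
    case False
    have sub: "indep_vars (\<lambda>_. borel) Y {i, j}"
      by (rule indep_vars_subset[OF indep]) simp
    show ?thesis
      using indep_vars_lebesgue_integral[OF _ sub Y_int] indep_vars_integrable[OF _ sub Y_int] mean False
      by simp
  qed
  show "integrable M (\<lambda>\<omega>. (\<Sum>i<n. Y i \<omega>)\<^sup>2)"
    unfolding sq using prod by (intro Bochner_Integration.integrable_sum) auto
  have "expectation (\<lambda>\<omega>. (\<Sum>i<n. Y i \<omega>)\<^sup>2) = (\<Sum>i<n. \<Sum>j<n. if i = j then v else 0)"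
    unfolding sq using prod by (simp add: Bochner_Integration.integral_sum)
  then show "expectation (\<lambda>\<omega>. (\<Sum>i<n. Y i \<omega>)\<^sup>2) = real n * v" by simp
qed

locale iid_sample = prob_space M for M :: "'w measure" +
  fixes Z :: "nat \<Rightarrow> 'w \<Rightarrow> 'z::topological_space" and F :: "'z measure"
  assumes indep: "indep_vars (\<lambda>_. borel) Z UNIV" and distr_Z: "\<And>i. distr M borel (Z i) = F"
begin

abbreviation "emp n \<omega> \<equiv> sample_mean n (\<lambda>i. Z i \<omega>)"

abbreviation "deviation f n s \<equiv> {\<omega>\<in>space M. s \<le> norm (emp n \<omega> f - (LINT z|F. f z))}"

lemma Z_measurable [measurable]: "Z i \<in> measurable M borel"
  using indep by (auto simp: indep_vars_def)

lemma sets_F [measurable_cong, simp]: "sets F = sets borel"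
  using distr_Z[of 0] by (metis sets_distr)

lemma prob_space_F: "prob_space F"
  using distr_Z[of 0] prob_space_distr[OF Z_measurable[of 0]] by simp

lemma integrable_Z:
  fixes f :: "'z \<Rightarrow> 'b::{banach, second_countable_topology}"
  assumes "f \<in> borel_measurable borel"
  shows "integrable M (\<lambda>\<omega>. f (Z i \<omega>)) \<longleftrightarrow> integrable F f"
  unfolding distr_Z[of i, symmetric] using assms by (simp add: integrable_distr_eq)

lemma integral_Z:
  fixes f :: "'z \<Rightarrow> 'b::{banach, second_countable_topology}"
  assumes "f \<in> borel_measurable borel"
  shows "(LINT \<omega>|M. f (Z i \<omega>)) = (LINT z|F. f z)"
  unfolding distr_Z[of i, symmetric] using assms by (simp add: integral_distr)

lemma sample_mean_measurable:
  fixes f :: "'z \<Rightarrow> 'b::euclidean_space"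
  assumes [measurable]: "f \<in> borel_measurable borel"
  shows "(\<lambda>\<omega>. emp n \<omega> f) \<in> borel_measurable M"
  unfolding sample_mean_def by measurable

text \<open>The constant is the variance, the same for all n and s. Fixed s gives the weak law; s of
  order \<open>1 / sqrt n\<close> gives boundedness in probability of the scaled mean.\<close>

lemma sample_mean_chebyshev_real:
  fixes f :: "'z \<Rightarrow> real"
  assumes [measurable]: "f \<in> borel_measurable borel" and sq: "integrable F (\<lambda>z. (f z)\<^sup>2)"
  shows "\<exists>C\<ge>0. \<forall>n>0. \<forall>s>0.
    prob {\<omega>\<in>space M. s \<le> \<bar>emp n \<omega> f - (LINT z|F. f z)\<bar>} \<le> C / (real n * s\<^sup>2)"
proof -
  interpret F: prob_space F by (rule prob_space_F)
  have f_int: "integrable F f"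
    by (rule F.square_integrable_imp_integrable[OF _ sq]) simp
  define m where "m = (LINT z|F. f z)"
  define g where "g z = f z - m" for z
  have [measurable]: "g \<in> borel_measurable borel" unfolding g_def by measurable
  define v where "v = (LINT z|F. (g z)\<^sup>2)"
  have g_sq: "integrable F (\<lambda>z. (g z)\<^sup>2)"
    unfolding g_def power2_diff using sq f_int by (auto intro!: Bochner_Integration.integrable_add Bochner_Integration.integrable_diff)
  have g_mean: "(LINT z|F. g z) = 0"
    unfolding g_def using f_int by (simp add: m_def F.prob_space)
  have ind: "indep_vars (\<lambda>_. borel) (\<lambda>i \<omega>. g (Z i \<omega>)) UNIV"
    using indep by (rule indep_vars_compose2) simp
  note sum = indep_square_expectation_sum[OF ind, where v = v]
  have S: "integrable M (\<lambda>\<omega>. (\<Sum>i<n. g (Z i \<omega>))\<^sup>2)" "expectation (\<lambda>\<omega>. (\<Sum>i<n. g (Z i \<omega>))\<^sup>2) = real n * v" for n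
    by (rule sum; simp add: integrable_Z[of "\<lambda>z. (g z)\<^sup>2"] integral_Z[of "\<lambda>z. (g z)\<^sup>2"] integral_Z[of g] g_sq g_mean v_def[symmetric])+
  have "prob {\<omega>\<in>space M. s \<le> \<bar>emp n \<omega> f - m\<bar>} \<le> v / (real n * s\<^sup>2)" if "0 < n" "0 < s" for n s
  proof -
    have mean: "emp n \<omega> f - m = (\<Sum>i<n. g (Z i \<omega>)) / real n" for \<omega>
      using \<open>0 < n\<close> by (simp add: sample_mean_def g_def sum_subtractf field_simps)
    have sub: "{\<omega>\<in>space M. s \<le> \<bar>emp n \<omega> f - m\<bar>} =
      {\<omega>\<in>space M. (real n * s)\<^sup>2 \<le> (\<Sum>i<n. g (Z i \<omega>))\<^sup>2}"
    proof (intro Collect_cong conj_cong refl)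
      fix \<omega>
      have "s \<le> \<bar>emp n \<omega> f - m\<bar> \<longleftrightarrow> real n * s \<le> \<bar>\<Sum>i<n. g (Z i \<omega>)\<bar>"
        unfolding mean using \<open>0 < n\<close> by (simp add: abs_divide field_simps)
      also have "\<dots> \<longleftrightarrow> \<bar>real n * s\<bar> \<le> \<bar>\<Sum>i<n. g (Z i \<omega>)\<bar>" using that by simp
      also have "\<dots> \<longleftrightarrow> (real n * s)\<^sup>2 \<le> (\<Sum>i<n. g (Z i \<omega>))\<^sup>2" by (rule abs_le_square_iff)
      finally show "s \<le> \<bar>emp n \<omega> f - m\<bar> \<longleftrightarrow> (real n * s)\<^sup>2 \<le> (\<Sum>i<n. g (Z i \<omega>))\<^sup>2" .
    qed
    have "prob {\<omega>\<in>space M. (real n * s)\<^sup>2 \<le> (\<Sum>i<n. g (Z i \<omega>))\<^sup>2} \<le>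
        expectation (\<lambda>\<omega>. (\<Sum>i<n. g (Z i \<omega>))\<^sup>2) / (real n * s)\<^sup>2"
      by (rule integral_Markov_inequality_measure[where A = "{}"]) (use S that in auto)
    also have "\<dots> = v / (real n * s\<^sup>2)"
      unfolding S using \<open>0 < n\<close> by (simp add: power2_eq_square)
    finally show ?thesis unfolding sub .
  qed
  moreover have "0 \<le> v" unfolding v_def by simp
  ultimately show ?thesis unfolding m_def by blast
qed

text \<open>A vector of norm at least s has a coordinate of size at least s/d, d being the
  dimension, by the l1 bound on the norm. A union bound over coordinates produces the factor d
  squared.\<close>

lemma sample_mean_chebyshev:
  fixes f :: "'z \<Rightarrow> 'b::euclidean_space"
  assumes [measurable]: "f \<in> borel_measurable borel" and sq: "integrable F (\<lambda>z. (norm (f z))\<^sup>2)"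
  shows "\<exists>C\<ge>0. \<forall>n>0. \<forall>s>0.
    prob (deviation f n s) \<le> C / (real n * s\<^sup>2)"
proof -
  interpret F: prob_space F by (rule prob_space_F)
  have "integrable F (\<lambda>z. norm (f z))"
    by (rule F.square_integrable_imp_integrable) (use sq in auto)
  then have f_int: "integrable F f" by (subst (asm) integrable_norm_iff) auto
  have "integrable F (\<lambda>z. (f z \<bullet> b)\<^sup>2)" if "b \<in> Basis" for b
  proof (rule Bochner_Integration.integrable_bound[OF sq])
    have "(f z \<bullet> b)\<^sup>2 \<le> (norm (f z))\<^sup>2" for z
      using Basis_le_norm[OF that, of "f z"] abs_le_square_iff[of "f z \<bullet> b" "norm (f z)"] by simp
    then show "AE z in F. norm ((f z \<bullet> b)\<^sup>2) \<le> norm ((norm (f z))\<^sup>2)" by simp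
  qed simp
  then have "\<forall>b\<in>Basis. \<exists>C\<ge>0. \<forall>n>0. \<forall>s>0.
    prob {\<omega>\<in>space M. s \<le> \<bar>emp n \<omega> (\<lambda>z. f z \<bullet> b) - (LINT z|F. f z \<bullet> b)\<bar>} \<le> C / (real n * s\<^sup>2)"
    by (intro ballI sample_mean_chebyshev_real) auto
  then obtain C where C: "\<forall>b\<in>Basis. 0 \<le> C b \<and> (\<forall>n>0. \<forall>s>0.
      prob {\<omega>\<in>space M. s \<le> \<bar>emp n \<omega> (\<lambda>z. f z \<bullet> b) - (LINT z|F. f z \<bullet> b)\<bar>} \<le> C b / (real n * s\<^sup>2))"
    by (auto dest!: bchoice)
  define d where "d = real DIM('b)"
  have d: "0 < d" by (simp add: d_def)
  have "prob (deviation f n s) \<le> ((\<Sum>b\<in>Basis. C b) * d\<^sup>2) / (real n * s\<^sup>2)"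
    if "0 < n" "0 < s" for n s
  proof -
    define A where "A b = {\<omega>\<in>space M. s / d \<le> \<bar>emp n \<omega> (\<lambda>z. f z \<bullet> b) - (LINT z|F. f z \<bullet> b)\<bar>}" for b
    have A_meas: "A b \<in> events" for b
    proof -
      have [measurable]: "(\<lambda>\<omega>. emp n \<omega> (\<lambda>z. f z \<bullet> b)) \<in> borel_measurable M"
        by (rule sample_mean_measurable) simp
      show ?thesis unfolding A_def by measurable
    qed
    have "(deviation f n s) \<subseteq> (\<Union>b\<in>Basis. A b)"
    proof safe
      fix \<omega> assume w: "\<omega> \<in> space M" "s \<le> norm (emp n \<omega> f - (LINT z|F. f z))"
      define x where "x = emp n \<omega> f - (LINT z|F. f z)"
      have x: "x \<bullet> b = emp n \<omega> (\<lambda>z. f z \<bullet> b) - (LINT z|F. f z \<bullet> b)" for b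
        using f_int by (simp add: x_def inner_diff_left sample_mean_inner)
      show "\<omega> \<in> (\<Union>b\<in>Basis. A b)"
      proof (rule ccontr)
        assume "\<omega> \<notin> (\<Union>b\<in>Basis. A b)"
        then have "\<bar>x \<bullet> b\<bar> < s / d" if "b \<in> Basis" for b using that w by (auto simp: A_def x)
        then have "(\<Sum>b\<in>Basis. \<bar>x \<bullet> b\<bar>) < (\<Sum>b\<in>(Basis::'b set). s / d)"
          by (intro sum_strict_mono) auto
        also have "\<dots> = s" using d by (simp add: d_def)
        finally have "norm x < s" using norm_le_l1[of x] by simp
        with w show False by (simp add: x_def)
      qed
    qed
    then have "prob (deviation f n s) \<le> prob (\<Union>b\<in>Basis. A b)"
      by (rule finite_measure_mono) (use A_meas in auto)
    also have "\<dots> \<le> (\<Sum>b\<in>Basis. prob (A b))"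
      by (rule finite_measure_subadditive_finite) (use A_meas in auto)
    also have "\<dots> \<le> (\<Sum>b\<in>Basis. C b / (real n * (s / d)\<^sup>2))"
      unfolding A_def using d that by (intro sum_mono C[rule_format, THEN conjunct2, rule_format]) auto
    also have "\<dots> = (\<Sum>b\<in>Basis. C b * (d\<^sup>2 / (real n * s\<^sup>2)))"
      by (simp add: power_divide)
    also have "\<dots> = ((\<Sum>b\<in>Basis. C b) * d\<^sup>2) / (real n * s\<^sup>2)"
      unfolding sum_distrib_right[symmetric] by simp
    finally show ?thesis .
  qed
  moreover have "0 \<le> (\<Sum>b\<in>(Basis::'b set). C b) * d\<^sup>2" using C by (simp add: sum_nonneg)
  ultimately show ?thesis by blast
qed

lemma weak_law_of_large_numbers:
  fixes f :: "'z \<Rightarrow> 'b::euclidean_space"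
  assumes [measurable]: "f \<in> borel_measurable borel" and sq: "integrable F (\<lambda>z. (norm (f z))\<^sup>2)" and "0 < \<epsilon>"
  shows "whp M (\<lambda>n \<omega>. norm (emp n \<omega> f - (LINT z|F. f z)) < \<epsilon>)"
  unfolding whp_def evprob_def
proof safe
  fix e :: real assume "0 < e"
  have [measurable]: "(\<lambda>\<omega>. emp n \<omega> f) \<in> borel_measurable M" for n
    by (rule sample_mean_measurable) simp
  obtain C where C: "0 \<le> C" "\<And>n s. \<lbrakk>0 < n; 0 < s\<rbrakk> \<Longrightarrow>
      prob (deviation f n s) \<le> C / (real n * s\<^sup>2)"
    using sample_mean_chebyshev[OF assms(1,2)] by blast
  have "(\<lambda>n. (C / \<epsilon>\<^sup>2) * inverse (real n)) \<longlonglongrightarrow> (C / \<epsilon>\<^sup>2) * 0"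
    by (intro tendsto_intros lim_inverse_n)
  then have "\<forall>\<^sub>F n in sequentially. (C / \<epsilon>\<^sup>2) * inverse (real n) < e"
    using \<open>0 < e\<close> by (intro order_tendstoD) auto
  then show "\<forall>\<^sub>F n in sequentially. \<exists>B\<in>events.
      {\<omega> \<in> space M. \<not> norm (emp n \<omega> f - (LINT z|F. f z)) < \<epsilon>} \<subseteq> B \<and> prob B \<le> e"
    using eventually_gt_at_top[of 0]
  proof eventually_elim
    case (elim n)
    have "prob (deviation f n \<epsilon>) \<le> C / (real n * \<epsilon>\<^sup>2)"
      by (rule C(2)) (use elim \<open>0 < \<epsilon>\<close> in auto)
    also have "\<dots> = (C / \<epsilon>\<^sup>2) * inverse (real n)" by (simp add: divide_inverse mult_ac)
    also have "\<dots> \<le> e" using elim by simp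
    finally show ?case
      by (intro bexI[of _ "(deviation f n \<epsilon>)"]) auto
  qed
qed

lemma sample_mean_sqrt_bounded:
  fixes f :: "'z \<Rightarrow> 'b::euclidean_space"
  assumes [measurable]: "f \<in> borel_measurable borel" and sq: "integrable F (\<lambda>z. (norm (f z))\<^sup>2)" and "0 < e"
  shows "\<exists>K>0. evprob M (\<lambda>n \<omega>. sqrt (real n) * norm (emp n \<omega> f - (LINT z|F. f z)) \<le> K) e"
proof -
  have [measurable]: "(\<lambda>\<omega>. emp n \<omega> f) \<in> borel_measurable M" for n
    by (rule sample_mean_measurable) simp
  obtain C where C: "0 \<le> C" "\<And>n s. \<lbrakk>0 < n; 0 < s\<rbrakk> \<Longrightarrow>
      prob (deviation f n s) \<le> C / (real n * s\<^sup>2)"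
    using sample_mean_chebyshev[OF assms(1,2)] by blast
  \<comment> \<open>Chebyshev at distance \<open>K / sqrt n\<close> gives C divided by the square of
    K, which is below e; the added 1 keeps K positive when C = 0.\<close>
  define K where "K = sqrt ((C + 1) / e)"
  have K: "0 < K" "K\<^sup>2 = (C + 1) / e"
    using C(1) \<open>0 < e\<close> by (simp_all add: K_def)
  have "C / K\<^sup>2 = e * (C / (C + 1))" by (simp add: K(2))
  also have "\<dots> \<le> e * 1" using C(1) \<open>0 < e\<close> by (intro mult_left_mono) auto
  finally have K_le: "C / K\<^sup>2 \<le> e" by simp
  have "evprob M (\<lambda>n \<omega>. sqrt (real n) * norm (emp n \<omega> f - (LINT z|F. f z)) \<le> K) e"
    unfolding evprob_def using eventually_gt_at_top[of 0]
  proof eventually_elim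
    case (elim n)
    have bound: "K / sqrt (real n) \<le> x" if "\<not> sqrt (real n) * x \<le> K" for x
      using that elim by (simp add: pos_divide_le_eq mult.commute[of x])
    have "prob (deviation f n (K / sqrt (real n))) \<le> C / (real n * (K / sqrt (real n))\<^sup>2)"
      by (rule C(2)) (use elim K in auto)
    also have "\<dots> = C / K\<^sup>2" using elim by (simp add: power_divide)
    also have "\<dots> \<le> e" by (rule K_le)
    finally show ?case
      by (intro bexI[of _ "(deviation f n (K / sqrt (real n)))"])
        (use bound in auto)
  qed
  with K(1) show ?thesis by blast
qed

end

section \<open>The multivariate central limit theorem\<close>

lemma integrable_component_product:
  fixes f :: "'z \<Rightarrow> real^'k"
  assumes [measurable]: "f \<in> borel_measurable F" and sq: "integrable F (\<lambda>z. (norm (f z))\<^sup>2)"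
  shows "integrable F (\<lambda>z. f z $ k * f z $ l)"
proof (rule Bochner_Integration.integrable_bound[OF sq])
  have [measurable]: "(\<lambda>z. f z $ k) \<in> borel_measurable F" for k
    unfolding cart_eq_inner_axis by measurable
  show "(\<lambda>z. f z $ k * f z $ l) \<in> borel_measurable F" by measurable
  have "\<bar>f z $ k * f z $ l\<bar> \<le> norm (f z) * norm (f z)" for z
    unfolding abs_mult by (intro mult_mono component_le_norm_cart) auto
  then show "AE z in F. norm (f z $ k * f z $ l) \<le> norm ((norm (f z))\<^sup>2)"
    by (simp add: power2_eq_square)
qed

lemma quadratic_form_covariance:
  fixes f :: "'z \<Rightarrow> real^'k"
  assumes [measurable]: "f \<in> borel_measurable F" and sq: "integrable F (\<lambda>z. (norm (f z))\<^sup>2)"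
    and mean: "(LINT z|F. f z) = 0" and int: "integrable F f"
  shows "t \<bullet> (covariance_matrix F f *v t) = (LINT z|F. (t \<bullet> f z)\<^sup>2)"
proof -
  note prod = integrable_component_product[OF assms(1) sq]
  have comp: "(LINT z|F. f z $ k) = 0" for k
    using int mean by (simp add: cart_eq_inner_axis)
  have "t \<bullet> (covariance_matrix F f *v t) = (\<Sum>k\<in>UNIV. \<Sum>l\<in>UNIV. t $ k * t $ l * (LINT z|F. f z $ k * f z $ l))"
    by (simp add: covariance_matrix_def comp inner_vec_def matrix_vector_mult_def sum_distrib_left mult_ac)
  also have "\<dots> = (LINT z|F. (\<Sum>k\<in>UNIV. \<Sum>l\<in>UNIV. t $ k * t $ l * (f z $ k * f z $ l)))"
    using prod by (simp add: Bochner_Integration.integral_sum)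
  also have "\<dots> = (LINT z|F. (t \<bullet> f z)\<^sup>2)"
    by (intro Bochner_Integration.integral_cong refl)
      (simp add: inner_vec_def power2_eq_square sum_product mult_ac)
  finally show ?thesis .
qed

lemma iexp_dist_le: "cmod (iexp a - iexp b) \<le> \<bar>a - b\<bar>"
proof -
  have "iexp a = iexp b * iexp (a - b)"
    by (simp add: exp_add[symmetric] algebra_simps)
  then have "iexp a - iexp b = iexp b * (iexp (a - b) - 1)" by (simp add: right_diff_distrib)
  then have "cmod (iexp a - iexp b) = cmod (iexp (a - b) - 1)" by (simp only: norm_mult norm_exp_i_times mult_1)
  also have "\<dots> \<le> \<bar>a - b\<bar>" using iexp_approx1[of "a - b" 0] by simp
  finally show ?thesis .
qed

context iid_sample
begin

text \<open>Cramer-Wold: t applied to f gives centred real variables of variance s, to which the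
  univariate theorem applies. It requires positive variance, so s = 0 is separate; there all
  summands vanish almost surely.\<close>

lemma central_limit_char:
  fixes f :: "'z \<Rightarrow> real^'k"
  assumes [measurable]: "f \<in> borel_measurable borel" and sq: "integrable F (\<lambda>z. (norm (f z))\<^sup>2)"
    and mean: "(LINT z|F. f z) = 0"
  shows "(\<lambda>n. CLINT \<omega>|M. iexp (t \<bullet> (sqrt (real n) *\<^sub>R emp n \<omega> f)))
    \<longlonglongrightarrow> exp (- (t \<bullet> (covariance_matrix F f *v t)) / 2)"
proof -
  interpret F: prob_space F by (rule prob_space_F)
  have "integrable F (\<lambda>z. norm (f z))"
    by (rule F.square_integrable_imp_integrable) (use sq in auto)
  then have f_int: "integrable F f" by (subst (asm) integrable_norm_iff) auto
  define s where "s = t \<bullet> (covariance_matrix F f *v t)"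
  have s: "s = (LINT z|F. (t \<bullet> f z)\<^sup>2)"
    unfolding s_def by (rule quadratic_form_covariance) (use sq mean f_int in auto)
  have tf_sq: "integrable F (\<lambda>z. (t \<bullet> f z)\<^sup>2)"
  proof (rule Bochner_Integration.integrable_bound)
    show "integrable F (\<lambda>z. (norm t)\<^sup>2 * (norm (f z))\<^sup>2)" using sq by simp
    have "(t \<bullet> f z)\<^sup>2 \<le> (norm t)\<^sup>2 * (norm (f z))\<^sup>2" for z
      using Cauchy_Schwarz_ineq[of t "f z"] by (simp add: power2_norm_eq_inner)
    then show "AE z in F. norm ((t \<bullet> f z)\<^sup>2) \<le> norm ((norm t)\<^sup>2 * (norm (f z))\<^sup>2)" by simp
  qed simp
  have tf_mean: "(LINT z|F. t \<bullet> f z) = 0"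
    using f_int mean by simp
  define X where "X i \<omega> = t \<bullet> f (Z i \<omega>)" for i \<omega>
  have X_meas [measurable]: "X i \<in> borel_measurable M" for i unfolding X_def by measurable
  have arg: "t \<bullet> (sqrt (real n) *\<^sub>R emp n \<omega> f) = (\<Sum>i<n. X i \<omega>) / sqrt (real n)" for n \<omega>
  proof -
    have "sqrt (real n) * (1 / real n) = 1 / sqrt (real n)"
      by (cases "n = 0") (simp_all add: divide_simps)
    then show ?thesis
      by (simp add: sample_mean_def X_def inner_sum_right[symmetric])
  qed
  show ?thesis
  proof (cases "s = 0")
    case True
    then have "AE z in F. (t \<bullet> f z)\<^sup>2 = 0"
      using s integral_nonneg_eq_0_iff_AE[OF tf_sq] by simp
    then have "AE z in distr M borel (Z i). t \<bullet> f z = 0" for i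
      unfolding distr_Z by simp
    then have "AE \<omega> in M. X i \<omega> = 0" for i
      unfolding X_def by (subst (asm) AE_distr_iff) auto
    then have "AE \<omega> in M. \<forall>i. X i \<omega> = 0" by (simp add: AE_all_countable)
    then have "(CLINT \<omega>|M. iexp ((\<Sum>i<n. X i \<omega>) / sqrt (real n))) = (CLINT \<omega>|M. 1)" for n
      by (intro integral_cong_AE) auto
    then show ?thesis unfolding arg using True by (simp add: prob_space s_def[symmetric])
  next
    case False
    then have pos: "0 < s" using s by (metis integral_nonneg_AE AE_I2 zero_le_power2 order_less_le)
    have weak: "weak_conv_m (\<lambda>n. distr M borel (\<lambda>\<omega>. (\<Sum>i<n. X i \<omega>) / sqrt (real n * (sqrt s)\<^sup>2))) std_normal_distribution"
    proof (rule central_limit_theorem_zero_mean)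
      show "indep_vars (\<lambda>i. borel) X UNIV"
        unfolding X_def using indep by (rule indep_vars_compose2) simp
      show X0: "expectation (X n) = 0" for n
        unfolding X_def using integral_Z[of "\<lambda>z. t \<bullet> f z" n] tf_mean by simp
      show "0 < sqrt s" using pos by simp
      show "integrable M (\<lambda>x. (X n x)\<^sup>2)" for n
        unfolding X_def using integrable_Z[of "\<lambda>z. (t \<bullet> f z)\<^sup>2" n] tf_sq by simp
      show "variance (X n) = (sqrt s)\<^sup>2" for n
        unfolding X0 using integral_Z[of "\<lambda>z. (t \<bullet> f z)\<^sup>2" n] pos by (simp add: X_def s)
      show "distr M borel (X n) = distr F borel (\<lambda>z. t \<bullet> f z)" for n
        unfolding distr_Z[of n, symmetric] X_def by (subst distr_distr) (auto simp: comp_def)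
    qed
    have rd: "real_distribution (distr M borel Y)" if "Y \<in> borel_measurable M" for Y :: "'w \<Rightarrow> real"
      using prob_space_distr[OF that] by (simp add: real_distribution_def real_distribution_axioms_def)
    \<comment> \<open>Evaluating at \<open>sqrt s\<close> undoes the standardisation by the standard
      deviation and yields the limit exp(-s/2).\<close>
    have "(\<lambda>n. char (distr M borel (\<lambda>\<omega>. (\<Sum>i<n. X i \<omega>) / sqrt (real n * (sqrt s)\<^sup>2))) (sqrt s)) \<longlonglongrightarrow> char std_normal_distribution (sqrt s)"
      by (rule levy_continuity1[OF rd real_dist_normal_dist weak]) measurable
    moreover have "char (distr M borel (\<lambda>\<omega>. (\<Sum>i<n. X i \<omega>) / sqrt (real n * (sqrt s)\<^sup>2))) (sqrt s) =
        (CLINT \<omega>|M. iexp ((\<Sum>i<n. X i \<omega>) / sqrt (real n)))" for n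
    proof -
      have "sqrt s * ((\<Sum>i<n. X i \<omega>) / sqrt (real n * (sqrt s)\<^sup>2)) = (\<Sum>i<n. X i \<omega>) / sqrt (real n)" for \<omega>
        using pos by (simp add: real_sqrt_mult)
      then show ?thesis
        unfolding char_def by (subst integral_distr) (simp_all only:, auto)
    qed
    ultimately show ?thesis
      unfolding arg using pos by (simp add: char_std_normal_distribution s_def[symmetric])
  qed
qed

end

text \<open>Characters are Lipschitz and bounded, so a difference that vanishes in probability does
  not affect the limit of the characteristic functions; the continuity theorem does the
  rest.\<close>

lemma (in prob_space) converges_in_law_slutsky:
  fixes X Y :: "nat \<Rightarrow> 'a \<Rightarrow> real^'k"
  assumes X: "\<forall>\<^sub>F n in sequentially. X n \<in> borel_measurable M" and Y: "\<And>n. Y n \<in> borel_measurable M"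
    and diff: "\<And>\<epsilon>. 0 < \<epsilon> \<Longrightarrow> whp M (\<lambda>n \<omega>. norm (X n \<omega> - Y n \<omega>) \<le> \<epsilon>)"
    and N: "prob_space N" "sets N = sets borel"
    and char: "\<And>t. (\<lambda>n. CLINT \<omega>|M. iexp (t \<bullet> Y n \<omega>)) \<longlonglongrightarrow> (CLINT x|N. iexp (t \<bullet> x))"
  shows "converges_in_law M X N"
  unfolding converges_in_law_def
proof (intro conjI allI impI X)
  fix f :: "real^'k \<Rightarrow> real" assume f: "continuous_on UNIV f" "bounded (range f)"
  have [measurable]: "f \<in> borel_measurable borel"
    using f by (intro borel_measurable_continuous_onI)
  \<comment> \<open>X n is measurable only for large n; replacing it by Y n otherwise makes its
    distribution a probability law for every n, as the continuity theorem demands.\<close>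
  define X' where "X' n = (if X n \<in> borel_measurable M then X n else Y n)" for n
  have X'_meas [measurable]: "X' n \<in> borel_measurable M" for n using Y by (simp add: X'_def)
  note Y[measurable]
  have X'_eq: "\<forall>\<^sub>F n in sequentially. X' n = X n"
    using X by eventually_elim (simp add: X'_def)
  have diff': "\<forall>\<^sub>F n in sequentially. prob {\<omega>\<in>space M. \<epsilon> < norm (X' n \<omega> - Y n \<omega>)} \<le> e"
    if "0 < \<epsilon>" "0 < e" for \<epsilon> e
  proof -
    have "\<forall>\<^sub>F n in sequentially. \<exists>B\<in>events. {\<omega>\<in>space M. \<not> norm (X n \<omega> - Y n \<omega>) \<le> \<epsilon>} \<subseteq> B \<and> prob B \<le> e"
      using diff[OF that(1)] that(2) unfolding whp_def evprob_def by blast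
    then show ?thesis
      using X'_eq
    proof eventually_elim
    case (elim n)
    then obtain B where B: "B \<in> events" "{\<omega>\<in>space M. \<not> norm (X n \<omega> - Y n \<omega>) \<le> \<epsilon>} \<subseteq> B" "prob B \<le> e" by blast
    have "prob {\<omega>\<in>space M. \<epsilon> < norm (X' n \<omega> - Y n \<omega>)} \<le> prob B"
      by (rule finite_measure_mono) (use B elim in auto)
    with B show ?case by simp
    qed
  qed
  have char': "(\<lambda>n. CLINT \<omega>|M. iexp (t \<bullet> X' n \<omega>)) \<longlonglongrightarrow> (CLINT x|N. iexp (t \<bullet> x))" for t
  proof -
    have int: "integrable M (\<lambda>\<omega>. iexp (t \<bullet> X' n \<omega>))" "integrable M (\<lambda>\<omega>. iexp (t \<bullet> Y n \<omega>))" for n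
      by (rule integrable_const_bound[where B = 1]; simp)+
    let ?d = "\<lambda>n. (CLINT \<omega>|M. iexp (t \<bullet> X' n \<omega>)) - (CLINT \<omega>|M. iexp (t \<bullet> Y n \<omega>))"
      and ?e = "\<lambda>n \<omega>. iexp (t \<bullet> X' n \<omega>) - iexp (t \<bullet> Y n \<omega>)"
    have "(\<lambda>n. ?d n) \<longlonglongrightarrow> 0"
    proof (rule tendstoI)
      fix e :: real assume "0 < e"
      \<comment> \<open>Where the difference is at most d the characters differ by less than e/2.
        Elsewhere they differ by at most 2, on an event of probability at most e/4.\<close>
      define d where "d = e / (2 * (norm t + 1))"
      have d: "0 < d" using \<open>0 < e\<close> by (simp add: d_def add_nonneg_pos)
      have td: "norm t * d < e / 2"
      proof -
        have "norm t * d < (norm t + 1) * d" using d by simp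
        also have "\<dots> = e / 2" using norm_ge_zero[of t] unfolding d_def by (simp add: field_simps add_nonneg_eq_0_iff)
        finally show ?thesis .
      qed
      have "\<forall>\<^sub>F n in sequentially. prob {\<omega>\<in>space M. d < norm (X' n \<omega> - Y n \<omega>)} \<le> e / 4"
        using d \<open>0 < e\<close> by (intro diff') auto
      then show "\<forall>\<^sub>F n in sequentially. dist (?d n) 0 < e"
      proof eventually_elim
        case (elim n)
        define A where "A = {\<omega>\<in>space M. d < norm (X' n \<omega> - Y n \<omega>)}"
        have A [measurable]: "A \<in> events" unfolding A_def by measurable
        have ind: "integrable M (indicator A :: 'a \<Rightarrow> real)"
          by (intro integrable_real_indicator A) (simp add: less_top[symmetric])
        have "norm (?d n) =
            norm (CLINT \<omega>|M. ?e n \<omega>)"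
          using int by simp
        also have "\<dots> \<le> (LINT \<omega>|M. norm (?e n \<omega>))"
          by (rule integral_norm_bound)
        also have "\<dots> \<le> (LINT \<omega>|M. norm t * d + 2 * indicator A \<omega>)"
        proof (rule integral_mono)
          show "integrable M (\<lambda>\<omega>. norm (?e n \<omega>))"
            using int by simp
          show "integrable M (\<lambda>\<omega>. norm t * d + 2 * indicator A \<omega>)" using ind by simp
          fix \<omega> assume w: "\<omega> \<in> space M"
          show "norm (?e n \<omega>) \<le> norm t * d + 2 * indicator A \<omega>"
          proof (cases "\<omega> \<in> A")
            case True
            have "norm (?e n \<omega>) \<le> 1 + 1"
              by (rule order_trans[OF norm_triangle_ineq4]) simp
            moreover have "0 \<le> norm t * d" using d by simp
            ultimately show ?thesis using True by simp
          next
            case False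
            have "norm (?e n \<omega>) \<le> \<bar>t \<bullet> X' n \<omega> - t \<bullet> Y n \<omega>\<bar>"
              by (rule iexp_dist_le)
            also have "\<dots> = \<bar>t \<bullet> (X' n \<omega> - Y n \<omega>)\<bar>" by (simp add: inner_diff_right)
            also have "\<dots> \<le> norm t * norm (X' n \<omega> - Y n \<omega>)" by (rule Cauchy_Schwarz_ineq2)
            also have "\<dots> \<le> norm t * d"
              using False w by (intro mult_left_mono) (auto simp: A_def)
            finally show ?thesis using False by simp
          qed
        qed
        also have "\<dots> = norm t * d + 2 * prob A" using ind by (simp add: prob_space)
        also have "\<dots> < e" using elim td unfolding A_def by simp
        finally show ?case by (simp add: dist_norm)
      qed
    qed
    from tendsto_add[OF this char[of t]] show ?thesis by simp
  qed
  have "(\<lambda>n. LINT x|distr M borel (X' n). f x) \<longlonglongrightarrow> (LINT x|N. f x)"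
  proof (rule weak_convergence_of_char[OF _ _ N _ f])
    show "prob_space (distr M borel (X' n))" for n by (rule prob_space_distr) simp
    show "(\<lambda>n. CLINT x|distr M borel (X' n). iexp (t \<bullet> x)) \<longlonglongrightarrow> (CLINT x|N. iexp (t \<bullet> x))" for t
      using char'[of t] by (subst integral_distr) simp_all
  qed simp
  then have "(\<lambda>n. LINT \<omega>|M. f (X' n \<omega>)) \<longlonglongrightarrow> (LINT x|N. f x)"
    by (subst (asm) integral_distr) simp_all
  moreover have "\<forall>\<^sub>F n in sequentially. (LINT \<omega>|M. f (X' n \<omega>)) = (LINT \<omega>|M. f (X n \<omega>))"
    using X'_eq by eventually_elim simp
  ultimately show "(\<lambda>n. LINT \<omega>|M. f (X n \<omega>)) \<longlonglongrightarrow> (LINT x|N. f x)"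
    by (rule Lim_transform_eventually)
qed

section \<open>Stacked parameters and empirical estimating functions\<close>

lemma stack_proj [simp]:
  "theta_of (stack t l D) = t" "lambda_of (stack t l D) = l" "D_of (stack t l D) = D"
  by (simp_all add: theta_of_def lambda_of_def D_of_def stack_def vec_eq_iff)

lemma stack_collapse [simp]: "stack (theta_of \<alpha>) (lambda_of \<alpha>) (D_of \<alpha>) = \<alpha>"
  by (auto simp: theta_of_def lambda_of_def D_of_def stack_def vec_eq_iff split: sum.split)

lemma stack_cases:
  obtains t l D where "\<alpha> = stack t l D"
  by (metis stack_collapse)

lemma stack_add: "stack t l D + stack t' l' D' = stack (t + t') (l + l') (D + D')"
  and stack_diff: "stack t l D - stack t' l' D' = stack (t - t') (l - l') (D - D')"
  and stack_scaleR: "c *\<^sub>R stack t l D = stack (c *\<^sub>R t) (c *\<^sub>R l) (c *\<^sub>R D)"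
  and stack_zero: "stack 0 0 0 = 0"
  by (auto simp: stack_def vec_eq_iff split: sum.split)

lemma bounded_linear_proj:
  "bounded_linear theta_of" "bounded_linear lambda_of" "bounded_linear D_of"
  by (auto intro!: linearI simp: linear_conv_bounded_linear[symmetric]
      theta_of_def lambda_of_def D_of_def vec_eq_iff)

lemma norm_stack: "(norm (stack t l D))\<^sup>2 = (norm t)\<^sup>2 + (norm l)\<^sup>2 + (norm D)\<^sup>2"
proof -
  have n: "(norm x)\<^sup>2 = (\<Sum>i\<in>UNIV. (x $ i)\<^sup>2)" for x :: "real^'n"
    unfolding power2_norm_eq_inner inner_vec_def by (simp add: power2_eq_square inner_vec_def)
  have nD: "(norm D)\<^sup>2 = (\<Sum>i\<in>UNIV. \<Sum>j\<in>UNIV. (D $ i $ j)\<^sup>2)"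
    unfolding power2_norm_eq_inner inner_vec_def by (simp add: power2_eq_square inner_vec_def)
  have "(norm (stack t l D))\<^sup>2 = (\<Sum>k\<in>UNIV <+> (UNIV <+> UNIV). (stack t l D $ k)\<^sup>2)"
    by (simp add: n UNIV_Plus_UNIV)
  also have "\<dots> = (norm t)\<^sup>2 + ((norm l)\<^sup>2 + (\<Sum>k\<in>UNIV. (stack t l D $ Inr (Inr k))\<^sup>2))"
    by (simp add: sum.Plus n stack_def del: UNIV_Plus_UNIV)
  also have "(\<Sum>k\<in>UNIV. (stack t l D $ Inr (Inr k))\<^sup>2) = (\<Sum>j\<in>UNIV. \<Sum>i\<in>UNIV. (D $ i $ j)\<^sup>2)"
    by (simp add: stack_def sum.cartesian_product case_prod_unfold UNIV_Times_UNIV[symmetric] del: UNIV_Times_UNIV)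
  also have "\<dots> = (norm D)\<^sup>2" unfolding nD by (rule sum.swap)
  finally show ?thesis by simp
qed

lemma norm_stack_ge:
  "norm t \<le> norm (stack t l D)" "norm l \<le> norm (stack t l D)" "norm D \<le> norm (stack t l D)"
  by (rule power2_le_imp_le; simp add: norm_stack)+

lemma norm_proj_le:
  "norm (theta_of \<alpha>) \<le> norm \<alpha>" "norm (lambda_of \<alpha>) \<le> norm \<alpha>" "norm (D_of \<alpha>) \<le> norm \<alpha>"
proof -
  obtain t l D where "\<alpha> = stack t l D" by (rule stack_cases)
  then show "norm (theta_of \<alpha>) \<le> norm \<alpha>" "norm (lambda_of \<alpha>) \<le> norm \<alpha>" "norm (D_of \<alpha>) \<le> norm \<alpha>"
    by (simp_all add: norm_stack_ge)
qed

lemma norm_stack_le: "norm (stack t l D) \<le> norm t + norm l + norm D"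
  by (rule power2_le_imp_le) (simp_all add: norm_stack power2_sum)

lemma sample_mean_linear: "linear f \<Longrightarrow> f (sample_mean n z g) = sample_mean n z (\<lambda>x. f (g x))"
  by (simp add: sample_mean_def linear_sum linear_cmul)

lemma sample_mean_add: "sample_mean n z (\<lambda>x. f x + g x) = sample_mean n z f + sample_mean n z g"
  and sample_mean_diff: "sample_mean n z (\<lambda>x. f x - g x) = sample_mean n z f - sample_mean n z g"
  by (simp_all add: sample_mean_def sum.distrib sum_subtractf scaleR_add_right scaleR_diff_right)

lemma sample_mean_mono:
  fixes f g :: "'z \<Rightarrow> real"
  shows "(\<And>x. f x \<le> g x) \<Longrightarrow> sample_mean n z f \<le> sample_mean n z g"
  by (simp add: sample_mean_def sum_mono divide_right_mono)

lemma sample_mean_norm: "norm (sample_mean n z f) \<le> sample_mean n z (\<lambda>x. norm (f x))"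
  for f :: "'z \<Rightarrow> 'a::real_normed_vector"
  by (simp add: sample_mean_def norm_sum divide_right_mono)

lemma sample_mean_stack:
  "sample_mean n z (\<lambda>x. stack (a x) (b x) (c x)) = stack (sample_mean n z a) (sample_mean n z b) (sample_mean n z c)"
proof -
  have "(\<Sum>i\<in>I. stack (a (z i)) (b (z i)) (c (z i))) = stack (\<Sum>i\<in>I. a (z i)) (\<Sum>i\<in>I. b (z i)) (\<Sum>i\<in>I. c (z i))"
    if "finite I" for I
    using that by (induction I) (simp_all add: stack_zero stack_add)
  then show ?thesis by (simp add: sample_mean_def stack_scaleR)
qed

lemma sample_mean_has_derivative:
  assumes "\<And>x. (f x has_derivative f' x) F"
  shows "((\<lambda>t. sample_mean n z (\<lambda>x. f x t)) has_derivative (\<lambda>h. sample_mean n z (\<lambda>x. f' x h))) F"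
  unfolding sample_mean_def by (intro has_derivative_scaleR_right has_derivative_sum assms)

lemma sample_mean_matrix_vector:
  fixes A :: "'z \<Rightarrow> real^'n^'m"
  shows "sample_mean n z (\<lambda>x. A x *v h) = sample_mean n z A *v h"
proof -
  have "linear (\<lambda>B :: real^'n^'m. B *v h)"
    by (auto intro!: linearI simp: matrix_vector_mult_add_rdistrib scaleR_matrix_vector_assoc)
  from sample_mean_linear[OF this, of n z A] show ?thesis by simp
qed

lemma matrix_mult_linear_left: "linear (\<lambda>A :: real^'n^'m. A ** (D :: real^'k^'n))"
  and matrix_mult_linear_right: "linear (\<lambda>D :: real^'k^'n. (A :: real^'n^'m) ** D)"
  by (auto intro!: linearI simp: matrix_matrix_mult_def vec_eq_iff sum.distrib sum_distrib_left algebra_simps)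

section \<open>Gradients, Jacobians and their measurability in the data\<close>

lemma gradient_works:
  assumes "f differentiable (at x)"
  shows "(f has_derivative (\<lambda>h. gradient f x \<bullet> h)) (at x)"
proof -
  define L where "L = frechet_derivative f (at x)"
  have L: "(f has_derivative L) (at x)"
    using assms unfolding L_def frechet_derivative_works .
  have lin: "linear L" using L by (rule has_derivative_linear)
  have "L h = gradient f x \<bullet> h" for h
  proof -
    have "L h = L (\<Sum>j\<in>UNIV. h $ j *\<^sub>R axis j 1)"
      by (simp add: basis_expansion[of h, unfolded scalar_mult_eq_scaleR])
    also have "\<dots> = (\<Sum>j\<in>UNIV. h $ j * L (axis j 1))"
      by (simp add: linear_sum[OF lin] linear_cmul[OF lin])
    finally show ?thesis by (simp add: gradient_def L_def inner_vec_def mult.commute)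
  qed
  then have "L = (\<lambda>h. gradient f x \<bullet> h)" by (rule ext)
  with L show ?thesis by simp
qed

lemma gradient_eqI:
  assumes "(f has_derivative (\<lambda>h. g \<bullet> h)) (at x)"
  shows "gradient f x = g"
  unfolding gradient_def frechet_derivative_at[OF assms, symmetric]
  by (simp add: vec_eq_iff inner_axis)

lemma jacobian_eqI:
  fixes f :: "real^'n \<Rightarrow> real^'m"
  assumes "(f has_derivative (\<lambda>h. A *v h)) (at x)"
  shows "jacobian f (at x) = A"
  unfolding jacobian_def frechet_derivative_at[OF assms, symmetric] by simp

text \<open>The joint derivative L splits as L(h, 0) + L(0, k); each summand is a derivative along
  one argument, and uniqueness of derivatives identifies it with the partial Jacobian.\<close>

lemma partial_jacobians:
  fixes f :: "real^'p \<Rightarrow> real^'q \<Rightarrow> real^'m"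
  assumes "(\<lambda>x. f (fst x) (snd x)) differentiable_on UNIV"
  shows "((\<lambda>x. f (fst x) (snd x)) has_derivative
      (\<lambda>h. jacobian (\<lambda>t. f t l) (at t) *v fst h + jacobian (\<lambda>l. f t l) (at l) *v snd h)) (at (t, l))"
    and "((\<lambda>t. f t l) has_derivative (\<lambda>h. jacobian (\<lambda>t. f t l) (at t) *v h)) (at t)"
    and "((\<lambda>l. f t l) has_derivative (\<lambda>h. jacobian (\<lambda>l. f t l) (at l) *v h)) (at l)"
proof -
  obtain L where L: "((\<lambda>x. f (fst x) (snd x)) has_derivative L) (at (t, l))"
    using assms unfolding differentiable_on_def differentiable_def by auto
  have lin: "linear L" using L by (rule has_derivative_linear)
  have p: "((\<lambda>t. (t, l)) has_derivative (\<lambda>h. (h, 0))) (at t)" "(Pair t has_derivative Pair 0) (at l)"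
    by (auto intro!: derivative_eq_intros)
  have "((\<lambda>t. f t l) has_derivative (\<lambda>h. L (h, 0))) (at t)"
    using has_derivative_compose[OF p(1), of "\<lambda>x. f (fst x) (snd x)" L] L by simp
  note der1 = this
  have 1: "((\<lambda>t. f t l) has_derivative (\<lambda>h. jacobian (\<lambda>t. f t l) (at t) *v h)) (at t)"
    using differentiableI[OF der1] unfolding jacobian_works .
  have eq1: "(\<lambda>h. L (h, 0)) = (\<lambda>h. jacobian (\<lambda>t. f t l) (at t) *v h)"
    by (rule has_derivative_unique[OF der1 1])
  have "((\<lambda>l. f t l) has_derivative (\<lambda>h. L (0, h))) (at l)"
    using has_derivative_compose[OF p(2), of "\<lambda>x. f (fst x) (snd x)" L] L by simp
  note der2 = this
  have 2: "((\<lambda>l. f t l) has_derivative (\<lambda>h. jacobian (\<lambda>l. f t l) (at l) *v h)) (at l)"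
    using differentiableI[OF der2] unfolding jacobian_works .
  have eq2: "(\<lambda>h. L (0, h)) = (\<lambda>h. jacobian (\<lambda>l. f t l) (at l) *v h)"
    by (rule has_derivative_unique[OF der2 2])
  have "L h = jacobian (\<lambda>t. f t l) (at t) *v fst h + jacobian (\<lambda>l. f t l) (at l) *v snd h" for h
    using linear_add[OF lin, of "(fst h, 0)" "(0, snd h)"] fun_cong[OF eq1, of "fst h"] fun_cong[OF eq2, of "snd h"] by simp
  then have "L = (\<lambda>h. jacobian (\<lambda>t. f t l) (at t) *v fst h + jacobian (\<lambda>l. f t l) (at l) *v snd h)" by (rule ext)
  with L show "((\<lambda>x. f (fst x) (snd x)) has_derivative
      (\<lambda>h. jacobian (\<lambda>t. f t l) (at t) *v fst h + jacobian (\<lambda>l. f t l) (at l) *v snd h)) (at (t, l))"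
    by simp
  show "((\<lambda>t. f t l) has_derivative (\<lambda>h. jacobian (\<lambda>t. f t l) (at t) *v h)) (at t)" by (rule 1)
  show "((\<lambda>l. f t l) has_derivative (\<lambda>h. jacobian (\<lambda>l. f t l) (at l) *v h)) (at l)" by (rule 2)
qed

text \<open>A derivative is a pointwise limit of difference quotients, each measurable in z.\<close>

lemma gradient_measurable:
  fixes f :: "'z \<Rightarrow> 'a::real_normed_vector \<Rightarrow> real"
  assumes meas: "\<And>x. (\<lambda>z. f z x) \<in> borel_measurable M" and der: "\<And>z. (f z has_derivative f' z) (at x)"
  shows "(\<lambda>z. f' z h) \<in> borel_measurable M"
proof (rule borel_measurable_LIMSEQ_real)
  fix z
  have lin: "linear (f' z)" using der by (rule has_derivative_linear)
  have "((\<lambda>s. f z (x + s *\<^sub>R h)) has_derivative (\<lambda>s. f' z (s *\<^sub>R h))) (at 0)"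
    by (rule has_derivative_compose[of "\<lambda>s. x + s *\<^sub>R h" "\<lambda>s. s *\<^sub>R h" 0 UNIV "f z" "f' z"])
      (use der in \<open>auto intro!: derivative_eq_intros\<close>)
  moreover have "(\<lambda>s. f' z (s *\<^sub>R h)) = (*) (f' z h)"
    by (auto simp: linear_cmul[OF lin] mult.commute)
  ultimately have "((\<lambda>s. f z (x + s *\<^sub>R h)) has_field_derivative f' z h) (at 0)"
    by (simp only: has_field_derivative_def)
  then have "((\<lambda>s. (f z (x + s *\<^sub>R h) - f z x) / s) \<longlongrightarrow> f' z h) (at 0)"
    by (simp add: DERIV_def)
  moreover have "filterlim (\<lambda>n. inverse (real (Suc n))) (at 0) sequentially"
    by (intro filterlim_atI LIMSEQ_inverse_real_of_nat) auto
  ultimately show "(\<lambda>n. (f z (x + inverse (real (Suc n)) *\<^sub>R h) - f z x) / inverse (real (Suc n))) \<longlonglongrightarrow> f' z h"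
    by (rule filterlim_compose)
qed (use meas in measurable)

lemma jacobian_measurable:
  fixes f :: "'z \<Rightarrow> real^'n \<Rightarrow> real^'m"
  assumes meas: "\<And>x. (\<lambda>z. f z x) \<in> borel_measurable M" and diff: "\<And>z. f z differentiable (at x)"
  shows "(\<lambda>z. jacobian (f z) (at x) $ i $ j) \<in> borel_measurable M"
proof -
  have "(\<lambda>z. (jacobian (f z) (at x) *v axis j 1) $ i) \<in> borel_measurable M"
  proof (rule gradient_measurable[of "\<lambda>z x. f z x $ i"])
    show "(\<lambda>z. f z y $ i) \<in> borel_measurable M" for y
      using meas[of y] unfolding cart_eq_inner_axis by measurable
    show "((\<lambda>x. f z x $ i) has_derivative (\<lambda>h. (jacobian (f z) (at x) *v h) $ i)) (at x)" for z
      by (rule bounded_linear.has_derivative[OF bounded_linear_vec_nth])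
        (use diff[of z] jacobian_works in blast)
  qed
  then show ?thesis by (simp add: matrix_vector_mult_basis column_def)
qed

section \<open>The empirical estimating function and its value at the estimator\<close>

locale estimating_functions =
  fixes \<phi> :: "real^'d \<Rightarrow> real^'p \<Rightarrow> real^'q \<Rightarrow> real^'p" and \<psi> :: "real^'d \<Rightarrow> real^'p \<Rightarrow> real"
  assumes meas: "\<And>t l. (\<lambda>z. \<phi> z t l) \<in> borel_measurable borel"
      "\<And>t. (\<lambda>z. \<psi> z t) \<in> borel_measurable borel"
    and smooth_\<phi>: "\<And>z. (\<lambda>x. \<phi> z (fst x) (snd x)) differentiable_on UNIV"
    and smooth_\<psi>: "\<And>z. \<psi> z differentiable_on UNIV"
begin

definition dtheta where "dtheta z t l = jacobian (\<lambda>t. \<phi> z t l) (at t)"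
definition dlam where "dlam z t l = jacobian (\<lambda>l. \<phi> z t l) (at l)"

lemmas \<phi>_has_derivative = partial_jacobians[OF smooth_\<phi>, folded dtheta_def dlam_def]

lemma \<psi>_has_derivative: "(\<psi> z has_derivative (\<lambda>h. gradient (\<psi> z) t \<bullet> h)) (at t)"
  using smooth_\<psi>[of z] by (intro gradient_works) (simp add: differentiable_on_def)

lemma eta_stack:
  "eta \<phi> \<psi> z (stack t l D) = stack (\<phi> z t l) (transpose D *v gradient (\<psi> z) t) (dtheta z t l ** D + dlam z t l)"
  by (simp add: eta_def Let_def dtheta_def dlam_def)

lemma eta_measurable: "(\<lambda>z. eta \<phi> \<psi> z \<alpha>) \<in> borel_measurable borel"
proof -
  obtain t l D where \<alpha>: "\<alpha> = stack t l D" by (rule stack_cases)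
  have [measurable]: "(\<lambda>z. dtheta z t l $ i $ j) \<in> borel_measurable borel" for i j
    unfolding dtheta_def by (rule jacobian_measurable[OF meas(1) differentiableI[OF \<phi>_has_derivative(2)]])
  have [measurable]: "(\<lambda>z. dlam z t l $ i $ j) \<in> borel_measurable borel" for i j
    unfolding dlam_def by (rule jacobian_measurable[OF meas(1) differentiableI[OF \<phi>_has_derivative(3)]])
  have [measurable]: "(\<lambda>z. gradient (\<psi> z) t $ j) \<in> borel_measurable borel" for j
    using gradient_measurable[of \<psi> borel "\<lambda>z h. gradient (\<psi> z) t \<bullet> h" t "axis j 1"] meas \<psi>_has_derivative
    by (simp add: inner_axis)
  have [measurable]: "(\<lambda>z. \<phi> z t l $ j) \<in> borel_measurable borel" for j
    using meas(1)[of t l] unfolding cart_eq_inner_axis by measurable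
  show ?thesis
  proof (rule borel_measurable_vecI)
    fix k :: "'p + 'q + 'q \<times> 'p"
    consider i where "k = Inl i" | j where "k = Inr (Inl j)" | j i where "k = Inr (Inr (j, i))"
      by (metis sum.exhaust surj_pair)
    then show "(\<lambda>z. eta \<phi> \<psi> z \<alpha> $ k) \<in> borel_measurable borel"
      unfolding \<alpha> eta_stack unfolding stack_def matrix_vector_mult_def matrix_matrix_mult_def
      by cases simp_all
  qed
qed

definition Phi where "Phi n z t l = sample_mean n z (\<lambda>x. \<phi> x t l)"
definition A_n where "A_n n z t l = sample_mean n z (\<lambda>x. dtheta x t l)"
definition B_n where "B_n n z t l = sample_mean n z (\<lambda>x. dlam x t l)"
definition Psi_n where "Psi_n n z \<alpha> = sample_mean n z (\<lambda>x. eta \<phi> \<psi> x \<alpha>)"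

lemma A_n_mult: "sample_mean n z (\<lambda>x. dtheta x t l ** D) = A_n n z t l ** D"
  unfolding A_n_def by (rule sample_mean_linear[OF matrix_mult_linear_left, symmetric])

lemma Psi_n_stack:
  "Psi_n n z (stack t l D) =
    stack (Phi n z t l) (transpose D *v sample_mean n z (\<lambda>x. gradient (\<psi> x) t)) (A_n n z t l ** D + B_n n z t l)"
proof -
  have "sample_mean n z (\<lambda>x. transpose D *v gradient (\<psi> x) t) = transpose D *v sample_mean n z (\<lambda>x. gradient (\<psi> x) t)"
    by (rule sample_mean_linear[OF matrix_vector_mul_linear, symmetric])
  then show ?thesis
    unfolding Psi_n_def eta_stack sample_mean_stack Phi_def B_n_def
    by (simp add: sample_mean_add A_n_mult del: transpose_matrix_vector)
qed

lemma Phi_has_derivative: "((\<lambda>t. Phi n z t l) has_derivative (\<lambda>h. A_n n z t l *v h)) (at t)"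
  unfolding Phi_def A_n_def sample_mean_matrix_vector[symmetric]
  by (rule sample_mean_has_derivative) (rule \<phi>_has_derivative)

lemma theta_hat_eqI:
  assumes "\<exists>!t. sample_mean n z (\<lambda>x. \<phi> x t l) = 0" "Phi n z t l = 0"
  shows "theta_hat \<phi> n z l = t"
  unfolding theta_hat_def using assms by (intro the1_equality) (auto simp: Phi_def)

lemma theta_hat_zero:
  assumes "\<exists>!t. sample_mean n z (\<lambda>x. \<phi> x t l) = 0"
  shows "Phi n z (theta_hat \<phi> n z l) l = 0"
  using theI'[OF assms] by (simp add: theta_hat_def Phi_def)

text \<open>The first block vanishes by definition of \<theta>-hat, the third because it is the
  derivative of the identically zero map \<open>\<lambda>l'. Phi n z (T l') l'\<close>, and the
  chain rule makes the second the gradient of \<open>TE\<close>. It holds at every l, so competitors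
  of \<lambda>-hat are covered too.\<close>

lemma Psi_n_alpha_hat:
  assumes unique: "\<And>l. \<exists>!t. sample_mean n z (\<lambda>x. \<phi> x t l) = 0"
    and diff: "\<And>l. theta_hat \<phi> n z differentiable (at l)"
  shows "Psi_n n z (alpha_hat \<phi> n z l) = stack 0 (TE' \<phi> \<psi> n z l) 0"
proof -
  define T where "T = theta_hat \<phi> n z"
  define D where "D = theta_hat' \<phi> n z l"
  have T: "(T has_derivative (\<lambda>h. D *v h)) (at l)"
    using diff[of l] unfolding T_def D_def theta_hat'_def jacobian_works .
  have "((\<lambda>l'. Phi n z (T l') l') has_derivative (\<lambda>h. (A_n n z (T l) l ** D + B_n n z (T l) l) *v h)) (at l)"
  proof -
    have "((\<lambda>l'. (\<lambda>x. sample_mean n z (\<lambda>y. \<phi> y (fst x) (snd x))) (T l', l')) has_derivative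
      (\<lambda>h. sample_mean n z (\<lambda>y. dtheta y (T l) l *v fst (D *v h, h) + dlam y (T l) l *v snd (D *v h, h)))) (at l)"
      by (rule has_derivative_compose[where f = "\<lambda>l'. (T l', l')" and f' = "\<lambda>h. (D *v h, h)" and s = UNIV, simplified])
        (auto intro!: has_derivative_Pair T sample_mean_has_derivative \<phi>_has_derivative)
    then show ?thesis
      by (simp add: Phi_def A_n_mult B_n_def sample_mean_add sample_mean_matrix_vector
          matrix_vector_mult_add_rdistrib matrix_vector_mul_assoc)
  qed
  moreover have "(\<lambda>l'. Phi n z (T l') l') = (\<lambda>_. 0)"
    unfolding T_def using theta_hat_zero[OF unique] by blast
  ultimately have "(\<lambda>h. (A_n n z (T l) l ** D + B_n n z (T l) l) *v h) = (\<lambda>h. 0)"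
    by (metis has_derivative_const has_derivative_unique)
  then have 3: "A_n n z (T l) l ** D + B_n n z (T l) l = 0"
    by (metis matrix_eq matrix_vector_mult_0)
  have "(TE \<phi> \<psi> n z has_derivative (\<lambda>h. sample_mean n z (\<lambda>x. gradient (\<psi> x) (T l) \<bullet> (D *v h)))) (at l)"
    unfolding TE_def[abs_def] T_def[symmetric]
    by (rule sample_mean_has_derivative)
      (rule has_derivative_compose[OF T \<psi>_has_derivative])
  moreover have "sample_mean n z (\<lambda>x. gradient (\<psi> x) (T l) \<bullet> (D *v h)) =
      (transpose D *v sample_mean n z (\<lambda>x. gradient (\<psi> x) (T l))) \<bullet> h" for h
    by (metis sample_mean_inner dot_lmul_matrix transpose_matrix_vector)
  ultimately have "TE' \<phi> \<psi> n z l = transpose D *v sample_mean n z (\<lambda>x. gradient (\<psi> x) (T l))"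
    unfolding TE'_def by (intro gradient_eqI) simp
  moreover have "Phi n z (T l) l = 0" unfolding T_def by (rule theta_hat_zero[OF unique])
  ultimately show ?thesis
    unfolding alpha_hat_def D_def[symmetric] T_def[symmetric] Psi_n_stack 3 by (simp only:)
qed

end

section \<open>Local analysis for a fixed sample\<close>

lemma matrix_inv:
  fixes A :: "real^'n^'n"
  assumes "invertible A"
  shows "matrix_inv A ** A = mat 1" "A ** matrix_inv A = mat 1"
  using someI_ex[OF assms[unfolded invertible_def]] unfolding matrix_inv_def by auto

text \<open>One constant for the action on vectors and on matrices, since \<theta>-errors are
  vectors and D-errors are matrices.\<close>

lemma invertible_bounded_below:
  fixes A :: "real^'p^'p"
  assumes "invertible A"
  shows "\<exists>a>0. (\<forall>u. a * norm u \<le> norm (A *v u)) \<and> (\<forall>h :: real^'q^'p. a * norm h \<le> norm (A ** h))"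
proof -
  have inv: "matrix_inv A ** A = mat 1"
    by (rule matrix_inv[OF assms])
  have "inj ((*v) A)"
    by (rule injI) (metis inv matrix_vector_mul_assoc matrix_vector_mul_lid)
  then obtain a1 where a1: "0 < a1" "\<And>u. a1 * norm u \<le> norm (A *v u)"
    using linear_inj_bounded_below_pos[OF matrix_vector_mul_linear] by blast
  have "inj ((**) A :: real^'q^'p \<Rightarrow> real^'q^'p)"
    by (rule injI) (metis inv matrix_mul_assoc matrix_mul_lid)
  then obtain a2 where a2: "0 < a2" "\<And>h :: real^'q^'p. a2 * norm h \<le> norm (A ** h)"
    using linear_inj_bounded_below_pos[OF matrix_mult_linear_right] by blast
  have "min a1 a2 * norm u \<le> norm (A *v u)" for u
    using a1(2)[of u] mult_right_mono[of "min a1 a2" a1 "norm u"] by simp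
  moreover have "min a1 a2 * norm h \<le> norm (A ** h)" for h :: "real^'q^'p"
    using a2(2)[of h] mult_right_mono[of "min a1 a2" a2 "norm h"] by simp
  ultimately show ?thesis using a1(1) a2(1) by (intro exI[of _ "min a1 a2"]) auto
qed

text \<open>Carries bounds on matrix products over to matrix-vector products.\<close>

lemma column_embedding:
  fixes u :: "real^'p" and X :: "real^'p^'p"
  defines "c \<equiv> \<lambda>u :: real^'p. \<chi> i j. if j = (undefined :: 'q::finite) then u $ i else 0"
  shows "norm (c u) = norm u" "X ** c u = c (X *v u)"
proof -
  have "(norm (c u))\<^sup>2 = (norm u)\<^sup>2"
    unfolding power2_norm_eq_inner inner_vec_def c_def by (simp add: inner_vec_def if_distrib cong: if_cong)
  then show "norm (c u) = norm u" by simp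
  show "X ** c u = c (X *v u)"
    by (simp add: c_def matrix_matrix_mult_def matrix_vector_mult_def vec_eq_iff)
qed

text \<open>Isolates the linear algebra of J that the pathwise analysis uses. In
  \<open>J_theta\<close> the \<lambda>-column appears as -A D0, which expresses that \<eta>3 has
  mean zero at \<alpha>0; by \<open>J_D\<close> the same A governs the dependence of the third block
  on D.\<close>

locale linearised_estimator = estimating_functions \<phi> \<psi>
  for \<phi> :: "real^'d \<Rightarrow> real^'p \<Rightarrow> real^'q \<Rightarrow> real^'p" and \<psi> :: "real^'d \<Rightarrow> real^'p \<Rightarrow> real" +
  fixes t0 :: "real^'p" and l0 :: "real^'q" and D0 :: "real^'q^'p" and \<alpha>0 :: "('p, 'q) param"
    and J :: "real^('p + 'q + 'q \<times> 'p)^('p + 'q + 'q \<times> 'p)" and A :: "real^'p^'p"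
    and a b d j :: real
  assumes \<alpha>0_eq: "\<alpha>0 = stack t0 l0 D0"
    and J_theta: "\<And>t l D. theta_of (J *v stack t l D) = A *v (t - D0 *v l)"
    and J_D: "\<And>h. D_of (J *v stack 0 0 h) = A ** h"
    and inv_A: "invertible A" and inv_J: "invertible J"
    and a: "0 < a" "\<And>u. a * norm u \<le> norm (A *v u)" "\<And>h :: real^'q^'p. a * norm h \<le> norm (A ** h)"
    and j: "0 < j" "\<And>x. j * norm x \<le> norm (J *v x)"
    and b: "0 \<le> b" "\<And>x. norm (J *v x) \<le> b * norm x"
    and d: "0 \<le> d" "\<And>x. norm (D0 *v x) \<le> d * norm x"
begin

lemma A_inv: "A *v (matrix_inv A *v v) = v" "norm (matrix_inv A *v v) \<le> norm v / a"
proof -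
  show eq: "A *v (matrix_inv A *v v) = v"
    using matrix_inv(2)[OF inv_A] by (simp add: matrix_vector_mul_assoc)
  show "norm (matrix_inv A *v v) \<le> norm v / a"
    using a(2)[of "matrix_inv A *v v"] a(1) by (simp add: eq pos_le_divide_eq mult.commute)
qed

lemma J_inv: "J *v (matrix_inv J *v v) = v" "matrix_inv J *v (J *v v) = v" "norm (matrix_inv J *v v) \<le> norm v / j"
proof -
  show eq: "J *v (matrix_inv J *v v) = v" "matrix_inv J *v (J *v v) = v"
    using matrix_inv[OF inv_J] by (simp_all add: matrix_vector_mul_assoc)
  show "norm (matrix_inv J *v v) \<le> norm v / j"
    using j(2)[of "matrix_inv J *v v"] j(1) by (simp add: eq pos_le_divide_eq mult.commute)
qed

text \<open>All that is asked of a sample; the rest of the local analysis is deterministic. The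
  linearisation clause compares only with \<alpha>0, so two general points are compared by the
  cruder Lipschitz clause. The last clause holds for all l because competitors of \<lambda>-hat are
  evaluated as well.\<close>

definition regular :: "nat \<Rightarrow> (nat \<Rightarrow> real^'d) \<Rightarrow> real \<Rightarrow> real \<Rightarrow> real \<Rightarrow> bool" where
  "regular n z \<kappa> \<delta> K \<longleftrightarrow>
    (\<forall>\<alpha>. norm (\<alpha> - \<alpha>0) \<le> \<delta> \<longrightarrow>
      norm (Psi_n n z \<alpha> - Psi_n n z \<alpha>0 - J *v (\<alpha> - \<alpha>0)) \<le> \<kappa> * norm (\<alpha> - \<alpha>0)) \<and>
    (\<forall>\<alpha> \<beta>. norm (\<alpha> - \<alpha>0) \<le> \<delta> \<longrightarrow> norm (\<beta> - \<alpha>0) \<le> \<delta> \<longrightarrow>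
      norm (Psi_n n z \<alpha> - Psi_n n z \<beta>) \<le> K * norm (\<alpha> - \<beta>)) \<and>
    (\<forall>l. (\<exists>!t. sample_mean n z (\<lambda>x. \<phi> x t l) = 0) \<and> theta_hat \<phi> n z differentiable (at l))"

text \<open>The bound a/10 makes linearisation errors at distances 3 \<rho> and 2 \<rho> add up to a
  \<rho> / 2 in \<open>A_n_near\<close>. The bound j/2 leaves half the radius for
  \<open>Psi_n n z \<alpha>0\<close> in \<open>zero_exists\<close>, and lets the error be absorbed
  in the asymptotic expansion.\<close>

context
  fixes n :: nat and z :: "nat \<Rightarrow> real^'d" and \<kappa> \<delta> K :: real
  assumes reg: "regular n z \<kappa> \<delta> K" and \<kappa>: "0 \<le> \<kappa>" "\<kappa> \<le> a / 10" "\<kappa> \<le> j / 2" and K: "0 \<le> K"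
begin

lemma lin: "norm (\<alpha> - \<alpha>0) \<le> \<delta> \<Longrightarrow>
    norm (Psi_n n z \<alpha> - Psi_n n z \<alpha>0 - J *v (\<alpha> - \<alpha>0)) \<le> \<kappa> * norm (\<alpha> - \<alpha>0)"
  using reg by (simp add: regular_def)

lemma lipschitz: "norm (\<alpha> - \<alpha>0) \<le> \<delta> \<Longrightarrow> norm (\<beta> - \<alpha>0) \<le> \<delta> \<Longrightarrow>
    norm (Psi_n n z \<alpha> - Psi_n n z \<beta>) \<le> K * norm (\<alpha> - \<beta>)"
  using reg by (simp add: regular_def)

lemma unique: "\<exists>!t. sample_mean n z (\<lambda>x. \<phi> x t l) = 0"
  and diff: "theta_hat \<phi> n z differentiable (at l)"
  using reg by (simp_all add: regular_def)

text \<open>A Newton step with the fixed matrix J moves \<alpha> to within r of \<alpha>0: the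
  displacement is the inverse of J applied to \<open>Psi_n n z \<alpha>0 + e\<close>, both terms at
  most j r / 2. The linearisation gives no contraction, hence Brouwer; continuity comes from the
  Lipschitz clause.\<close>

lemma zero_exists:
  assumes r: "0 < r" "r \<le> \<delta>" and small: "norm (Psi_n n z \<alpha>0) \<le> j * r / 2"
  shows "\<exists>\<alpha>. norm (\<alpha> - \<alpha>0) \<le> r \<and> Psi_n n z \<alpha> = 0"
proof -
  define T where "T \<alpha> = \<alpha> - matrix_inv J *v Psi_n n z \<alpha>" for \<alpha>
  have cball: "\<alpha> \<in> cball \<alpha>0 r \<longleftrightarrow> norm (\<alpha> - \<alpha>0) \<le> r" for \<alpha>
    by (simp add: dist_norm norm_minus_commute)
  have "K-lipschitz_on (cball \<alpha>0 r) (Psi_n n z)"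
    by (rule lipschitz_onI[OF _ K]) (use lipschitz cball r(2) in \<open>auto simp: dist_norm norm_minus_commute\<close>)
  then have "continuous_on (cball \<alpha>0 r) (Psi_n n z)" by (rule lipschitz_on_continuous_on)
  then have cont: "continuous_on (cball \<alpha>0 r) T"
    unfolding T_def by (intro continuous_intros linear_continuous_on_compose[OF _ matrix_vector_mul_linear]) 
  have "T \<in> cball \<alpha>0 r \<rightarrow> cball \<alpha>0 r"
  proof
    fix \<alpha> assume "\<alpha> \<in> cball \<alpha>0 r"
    then have \<alpha>: "norm (\<alpha> - \<alpha>0) \<le> r" using cball by simp
    define e where "e = Psi_n n z \<alpha> - Psi_n n z \<alpha>0 - J *v (\<alpha> - \<alpha>0)"
    have "norm e \<le> \<kappa> * norm (\<alpha> - \<alpha>0)" unfolding e_def using lin \<alpha> r(2) by simp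
    also have "\<dots> \<le> j / 2 * r" using \<kappa> \<alpha> by (intro mult_mono) auto
    finally have e: "norm e \<le> j * r / 2" by simp
    have "Psi_n n z \<alpha> = J *v (\<alpha> - \<alpha>0) + (Psi_n n z \<alpha>0 + e)" by (simp add: e_def)
    then have "T \<alpha> - \<alpha>0 = - (matrix_inv J *v (Psi_n n z \<alpha>0 + e))"
      unfolding T_def by (simp only: matrix_vector_right_distrib J_inv(2)) simp
    then have "norm (T \<alpha> - \<alpha>0) \<le> norm (Psi_n n z \<alpha>0 + e) / j"
      using J_inv(3) by simp
    also have "\<dots> \<le> (j * r) / j"
      using norm_triangle_ineq[of "Psi_n n z \<alpha>0" e] e small j(1) by (intro divide_right_mono) auto
    finally show "T \<alpha> \<in> cball \<alpha>0 r" using j(1) cball by simp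
  qed
  then obtain \<alpha> where "\<alpha> \<in> cball \<alpha>0 r" "T \<alpha> = \<alpha>"
    using brouwer_ball[OF r(1) cont] by blast
  then have "matrix_inv J *v Psi_n n z \<alpha> = 0" by (simp add: T_def)
  then have "Psi_n n z \<alpha> = 0" using J_inv(1)[of "Psi_n n z \<alpha>"] by simp
  with \<open>\<alpha> \<in> cball \<alpha>0 r\<close> show ?thesis using cball by blast
qed

text \<open>Nothing is known beforehand about where \<theta>-hat lies. Brouwer produces a zero of
  \<open>Phi\<close> in the ball around t0, and global uniqueness of the zero forces it to be
  \<theta>-hat. The step lands within r/4 from the \<lambda>-shift, r/4 from
  \<open>Psi_n n z \<alpha>0\<close> and r/5 from the linearisation error.\<close>

lemma theta_hat_near:
  assumes r: "0 < r" "2 * r \<le> \<delta>" and l: "norm (l - l0) \<le> r / (4 * (d + 1))"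
    and small: "norm (Psi_n n z \<alpha>0) \<le> a * r / 4"
  shows "norm (theta_hat \<phi> n z l - t0) \<le> r"
proof -
  define T where "T t = t - matrix_inv A *v Phi n z t l" for t
  have cball: "t \<in> cball t0 r \<longleftrightarrow> norm (t - t0) \<le> r" for t
    by (simp add: dist_norm norm_minus_commute)
  have "r / (4 * (d + 1)) \<le> r / 4"
    using r(1) d(1) by (intro divide_left_mono) auto
  then have l': "norm (l - l0) \<le> r" using l r(1) by linarith
  have "norm (D0 *v (l - l0)) \<le> d * (r / (4 * (d + 1)))"
    using d(2)[of "l - l0"] mult_left_mono[OF l d(1)] by linarith
  also have "\<dots> = d / (d + 1) * (r / 4)" by simp
  also have "\<dots> \<le> 1 * (r / 4)" using d(1) r(1) by (intro mult_right_mono) auto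
  finally have dl: "norm (D0 *v (l - l0)) \<le> r / 4" by simp
  have "continuous_on (cball t0 r) (\<lambda>t. Phi n z t l)"
    by (intro continuous_at_imp_continuous_on ballI has_derivative_continuous[OF Phi_has_derivative])
  then have cont: "continuous_on (cball t0 r) T"
    unfolding T_def by (intro continuous_intros linear_continuous_on_compose[OF _ matrix_vector_mul_linear])
  have "T \<in> cball t0 r \<rightarrow> cball t0 r"
  proof
    fix t assume "t \<in> cball t0 r"
    then have t: "norm (t - t0) \<le> r" using cball by simp
    \<comment> \<open>The first block does not depend on D, so D0 is a free choice that keeps the
      point within 2r of \<alpha>0.\<close>
    define \<alpha> where "\<alpha> = stack t l D0"
    have \<alpha>: "\<alpha> - \<alpha>0 = stack (t - t0) (l - l0) 0" by (simp add: \<alpha>_def \<alpha>0_eq stack_diff)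
    have n\<alpha>: "norm (\<alpha> - \<alpha>0) \<le> 2 * r"
      using norm_stack_le[of "t - t0" "l - l0" "0 :: real^'q^'p"] t l' by (simp add: \<alpha>)
    define e where "e = Psi_n n z \<alpha> - Psi_n n z \<alpha>0 - J *v (\<alpha> - \<alpha>0)"
    have "norm e \<le> \<kappa> * norm (\<alpha> - \<alpha>0)" unfolding e_def using lin n\<alpha> r(2) by simp
    also have "\<dots> \<le> a / 10 * (2 * r)" using \<kappa> n\<alpha> a by (intro mult_mono) auto
    finally have e: "norm e \<le> a * r / 5" by simp
    have "Psi_n n z \<alpha> = J *v (\<alpha> - \<alpha>0) + (Psi_n n z \<alpha>0 + e)" by (simp add: e_def)
    then have "theta_of (Psi_n n z \<alpha>) = theta_of (J *v (\<alpha> - \<alpha>0)) + theta_of (Psi_n n z \<alpha>0 + e)"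
      by (simp only: linear_add[OF bounded_linear.linear[OF bounded_linear_proj(1)]])
    then have "Phi n z t l = A *v (t - t0 - D0 *v (l - l0)) + theta_of (Psi_n n z \<alpha>0 + e)"
      unfolding \<alpha> J_theta by (simp add: \<alpha>_def Psi_n_stack)
    then have "matrix_inv A *v Phi n z t l = t - t0 - D0 *v (l - l0) + matrix_inv A *v theta_of (Psi_n n z \<alpha>0 + e)"
      using matrix_inv(1)[OF inv_A] by (simp add: matrix_vector_right_distrib matrix_vector_mul_assoc)
    then have "T t - t0 = D0 *v (l - l0) - matrix_inv A *v theta_of (Psi_n n z \<alpha>0 + e)"
      unfolding T_def by simp
    then have "norm (T t - t0) \<le> norm (D0 *v (l - l0)) + norm (matrix_inv A *v theta_of (Psi_n n z \<alpha>0 + e))"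
      by (simp add: norm_triangle_ineq4)
    also have "norm (matrix_inv A *v theta_of (Psi_n n z \<alpha>0 + e)) \<le> norm (theta_of (Psi_n n z \<alpha>0 + e)) / a"
      by (rule A_inv)
    also have "\<dots> \<le> (a * r / 4 + a * r / 5) / a"
      using norm_proj_le(1)[of "Psi_n n z \<alpha>0 + e"] norm_triangle_ineq[of "Psi_n n z \<alpha>0" e] e small a(1)
      by (intro divide_right_mono) auto
    also have "\<dots> = r / 4 + r / 5" using a(1) by (simp add: add_divide_distrib)
    finally have "norm (T t - t0) \<le> r" using dl r(1) by simp
    then show "T t \<in> cball t0 r" using cball by simp
  qed
  then obtain t where t: "t \<in> cball t0 r" "T t = t"
    using brouwer_ball[OF r(1) cont] by blast
  then have "matrix_inv A *v Phi n z t l = 0" by (simp add: T_def)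
  then have "Phi n z t l = 0" using A_inv(1)[of "Phi n z t l"] by simp
  then have "theta_hat \<phi> n z l = t" by (rule theta_hat_eqI[OF unique])
  with t(1) show ?thesis using cball by simp
qed

text \<open>Since \<open>\<eta>\<close> is affine in \<open>D\<close>, the empirical Jacobian of \<open>\<phi>\<close> in \<open>\<theta>\<close> is a difference
  quotient of the empirical \<open>\<eta>\<close>; no continuity of the derivative of \<open>\<eta>\<close> is needed to control it.\<close>

lemma A_n_near:
  fixes h :: "real^'q^'p"
  assumes \<rho>: "0 < \<rho>" "3 * \<rho> \<le> \<delta>" and t: "norm (t - t0) \<le> \<rho>" and l: "norm (l - l0) \<le> \<rho>"
  shows "norm (A_n n z t l ** h - A ** h) \<le> a / 2 * norm h"
    and "a / 2 * norm h \<le> norm (A_n n z t l ** h)"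
    and "norm (A_n n z t l *v u - A *v u) \<le> a / 2 * norm u"
proof -
  have main: "norm (A_n n z t l ** h - A ** h) \<le> a / 2 * norm h" for h :: "real^'q^'p"
  proof (cases "h = 0")
    case True
    then show ?thesis by (simp add: matrix_matrix_mult_def)
  next
    case False
    \<comment> \<open>The linearisation error is proportional to the distance from \<alpha>0, not to
      the size of h. Homogeneity in h permits rescaling to norm \<rho>, where the two are
      comparable.\<close>
    define s where "s = \<rho> / norm h"
    have s: "0 < s" using False \<rho> by (simp add: s_def)
    define h' where "h' = s *\<^sub>R h"
    have nh': "norm h' = \<rho>" using False \<rho> by (simp add: h'_def s_def)
    define \<alpha> where "\<alpha> = stack t l (D0 + h')"
    define \<beta> where "\<beta> = stack t l D0"
    define E where "E \<gamma> = Psi_n n z \<gamma> - Psi_n n z \<alpha>0 - J *v (\<gamma> - \<alpha>0)" for \<gamma>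
    have \<alpha>: "norm (\<alpha> - \<alpha>0) \<le> 3 * \<rho>"
      using norm_stack_le[of "t - t0" "l - l0" h'] t l nh' by (simp add: \<alpha>_def \<alpha>0_eq stack_diff)
    have \<beta>: "norm (\<beta> - \<alpha>0) \<le> 2 * \<rho>"
      using norm_stack_le[of "t - t0" "l - l0" "0 :: real^'q^'p"] t l by (simp add: \<beta>_def \<alpha>0_eq stack_diff)
    have "norm (E \<alpha>) \<le> \<kappa> * norm (\<alpha> - \<alpha>0)" unfolding E_def using lin \<alpha> \<rho> by simp
    also have "\<dots> \<le> a / 10 * (3 * \<rho>)" using \<kappa> \<alpha> a by (intro mult_mono) auto
    finally have E\<alpha>: "norm (E \<alpha>) \<le> 3 / 10 * (a * \<rho>)" by simp
    have "norm (E \<beta>) \<le> \<kappa> * norm (\<beta> - \<alpha>0)" unfolding E_def using lin \<beta> \<rho> by simp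
    also have "\<dots> \<le> a / 10 * (2 * \<rho>)" using \<kappa> \<beta> a by (intro mult_mono) auto
    finally have E\<beta>: "norm (E \<beta>) \<le> 2 / 10 * (a * \<rho>)" by (simp add: mult.commute)
    have "J *v (\<alpha> - \<alpha>0) - J *v (\<beta> - \<alpha>0) = J *v (\<alpha> - \<beta>)"
      by (simp add: matrix_vector_mult_diff_distrib)
    also have "\<alpha> - \<beta> = stack 0 0 h'" by (simp add: \<alpha>_def \<beta>_def stack_diff)
    finally have "E \<alpha> - E \<beta> = Psi_n n z \<alpha> - Psi_n n z \<beta> - J *v stack 0 0 h'"
      unfolding E_def by (simp add: algebra_simps)
    then have "D_of (E \<alpha> - E \<beta>) = D_of (Psi_n n z \<alpha>) - D_of (Psi_n n z \<beta>) - A ** h'"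
      by (simp only: linear_diff[OF bounded_linear.linear[OF bounded_linear_proj(3)]] J_D)
    also have "D_of (Psi_n n z \<alpha>) - D_of (Psi_n n z \<beta>) = A_n n z t l ** h'"
      by (simp add: \<alpha>_def \<beta>_def Psi_n_stack linear_add[OF matrix_mult_linear_right])
    finally have "norm (A_n n z t l ** h' - A ** h') \<le> norm (E \<alpha> - E \<beta>)"
      by (metis norm_proj_le(3))
    \<comment> \<open>The two errors contribute 3/10 and 2/10 of a \<rho>.\<close>
    also have "\<dots> \<le> a / 2 * \<rho>"
      using E\<alpha> E\<beta> norm_triangle_ineq4[of "E \<alpha>" "E \<beta>"] by simp
    also have "A_n n z t l ** h' - A ** h' = s *\<^sub>R (A_n n z t l ** h - A ** h)"
      by (simp add: h'_def linear_cmul[OF matrix_mult_linear_right] scaleR_diff_right)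
    finally have "s * norm (A_n n z t l ** h - A ** h) \<le> a / 2 * \<rho>" using s by simp
    also have "a / 2 * \<rho> = s * (a / 2 * norm h)" using False by (simp add: s_def)
    finally show ?thesis using s by simp
  qed
  then show "norm (A_n n z t l ** h - A ** h) \<le> a / 2 * norm h" .
  show "a / 2 * norm h \<le> norm (A_n n z t l ** h)"
    using main[of h] a(3)[of h] norm_triangle_ineq2[of "A ** h" "A_n n z t l ** h"]
    by (simp add: norm_minus_commute)
  \<comment> \<open>The vector bound is the matrix bound for the matrix with u as its only nonzero
    column.\<close>
  define c where "c = (\<lambda>u :: real^'p. \<chi> i j. if j = (undefined :: 'q) then u $ i else 0)"
  have "A_n n z t l ** c u - A ** c u = c (A_n n z t l *v u - A *v u)"
    unfolding c_def column_embedding by (simp add: vec_eq_iff)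
  then show "norm (A_n n z t l *v u - A *v u) \<le> a / 2 * norm u"
    using main[of "c u"] by (simp add: c_def column_embedding)
qed

text \<open>The third block vanishes at the estimated Jacobian D, so with D0 in its place it equals
  \<open>A_n n z t l ** (D0 - D)\<close>. It is of order r by the linearisation, and
  \<open>A_n\<close> is bounded below by a/2. No closeness of D to D0 is presupposed, as the
  dependence on D is exactly affine. The constant adds r for \<theta>, r for \<lambda> and the
  resulting bound for D.\<close>

lemma alpha_hat_near:
  assumes r: "0 < r" "3 * r \<le> \<delta>" and l: "norm (l - l0) \<le> r / (4 * (d + 1))"
    and small: "norm (Psi_n n z \<alpha>0) \<le> a * r / 4"
  shows "norm (alpha_hat \<phi> n z l - \<alpha>0) \<le> (3 + 4 * (b + a) / a) * r"
proof -
  define t where "t = theta_hat \<phi> n z l"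
  define D where "D = theta_hat' \<phi> n z l"
  have t: "norm (t - t0) \<le> r"
    unfolding t_def by (rule theta_hat_near) (use r l small in auto)
  have "r / (4 * (d + 1)) \<le> r / 4"
    using r(1) d(1) by (intro divide_left_mono) auto
  then have l': "norm (l - l0) \<le> r" using l r(1) by linarith
  define \<beta> where "\<beta> = stack t l D0"
  have \<beta>: "norm (\<beta> - \<alpha>0) \<le> 2 * r"
    using norm_stack_le[of "t - t0" "l - l0" "0 :: real^'q^'p"] t l' by (simp add: \<beta>_def \<alpha>0_eq stack_diff)
  define e where "e = Psi_n n z \<beta> - Psi_n n z \<alpha>0 - J *v (\<beta> - \<alpha>0)"
  have "norm e \<le> \<kappa> * norm (\<beta> - \<alpha>0)" unfolding e_def using lin \<beta> r by simp
  also have "\<dots> \<le> a * (2 * r)" using \<kappa> \<beta> a by (intro mult_mono) auto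
  finally have e: "norm e \<le> 2 * (a * r)" by simp
  have Jb: "norm (J *v (\<beta> - \<alpha>0)) \<le> 2 * (b * r)"
    using b(2)[of "\<beta> - \<alpha>0"] mult_left_mono[OF \<beta> b(1)] by simp
  have "Psi_n n z \<beta> = Psi_n n z \<alpha>0 + (J *v (\<beta> - \<alpha>0) + e)" by (simp add: e_def)
  then have "norm (Psi_n n z \<beta>) \<le> norm (Psi_n n z \<alpha>0) + (norm (J *v (\<beta> - \<alpha>0)) + norm e)"
    using norm_triangle_ineq[of "Psi_n n z \<alpha>0" "J *v (\<beta> - \<alpha>0) + e"]
      norm_triangle_ineq[of "J *v (\<beta> - \<alpha>0)" e] by simp
  then have P\<beta>: "norm (Psi_n n z \<beta>) \<le> a * r / 4 + 2 * (b * r) + 2 * (a * r)"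
    using e Jb small by linarith
  have "Psi_n n z (stack t l D) = stack 0 (TE' \<phi> \<psi> n z l) 0"
    using Psi_n_alpha_hat[OF unique diff, of l] by (simp add: alpha_hat_def t_def D_def)
  then have "D_of (Psi_n n z (stack t l D)) = 0" by simp
  then have "A_n n z t l ** D + B_n n z t l = 0" by (simp add: Psi_n_stack)
  then have "D_of (Psi_n n z \<beta>) = A_n n z t l ** D0 - A_n n z t l ** D"
    by (simp add: \<beta>_def Psi_n_stack eq_neg_iff_add_eq_0[symmetric] add.commute)
  also have "\<dots> = A_n n z t l ** (D0 - D)"
    by (simp add: linear_diff[OF matrix_mult_linear_right])
  finally have "a / 2 * norm (D0 - D) \<le> norm (D_of (Psi_n n z \<beta>))"
    using A_n_near(2)[OF r t l', of "D0 - D"] by simp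
  also have "\<dots> \<le> a * r / 4 + 2 * (b * r) + 2 * (a * r)"
    using norm_proj_le(3)[of "Psi_n n z \<beta>"] P\<beta> by simp
  also have "\<dots> \<le> a / 2 * ((1 + 4 * (b + a) / a) * r)"
  proof -
    have "a * (1 + 4 * (b + a) / a) = a + 4 * (b + a)"
      using a(1) by (simp add: field_simps)
    then have "a / 2 * ((1 + 4 * (b + a) / a) * r) = (a + 4 * (b + a)) / 2 * r"
      by (simp only: times_divide_eq_left mult.assoc[symmetric])
    also have "\<dots> = a * r / 2 + 2 * (b * r) + 2 * (a * r)"
      by (simp add: algebra_simps add_divide_distrib)
    finally have eq: "a / 2 * ((1 + 4 * (b + a) / a) * r) = a * r / 2 + 2 * (b * r) + 2 * (a * r)" .
    have "0 \<le> a * r" using a(1) r(1) by simp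
    then show ?thesis unfolding eq by linarith
  qed
  finally have "norm (D - D0) \<le> (1 + 4 * (b + a) / a) * r"
    using a(1) by (simp add: norm_minus_commute)
  then have "norm (stack (t - t0) (l - l0) (D - D0)) \<le> r + r + (1 + 4 * (b + a) / a) * r"
    using norm_stack_le[of "t - t0" "l - l0" "D - D0"] t l' by linarith
  also have "\<dots> = (3 + 4 * (b + a) / a) * r" by (simp add: algebra_simps)
  finally show ?thesis
    by (simp add: alpha_hat_def t_def D_def \<alpha>0_eq stack_diff)
qed

text \<open>Converts an approximate zero of \<open>Psi_n\<close> into an approximate solution for
  \<lambda>. With \<lambda> kept, e being the norm of \<open>Psi_n n z \<alpha>\<close>: the
  \<theta>-part is within 2e/a of \<theta>-hat; the Lipschitz bound then gives (1 + 2K/a) e after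
  replacing \<theta> alone; the third block puts D within 2/a times this of the estimated Jacobian.
  A second use of the Lipschitz bound reaches \<open>alpha_hat\<close>, where \<open>Psi_n\<close>
  is (0, TE', 0).\<close>

lemma TE'_approximate_zero:
  assumes \<rho>: "0 < \<rho>" "3 * \<rho> \<le> \<delta>" and \<alpha>: "norm (\<alpha> - \<alpha>0) \<le> \<rho>"
    and hat: "norm (alpha_hat \<phi> n z (lambda_of \<alpha>) - \<alpha>0) \<le> \<rho>"
  shows "norm (TE' \<phi> \<psi> n z (lambda_of \<alpha>)) \<le>
    (1 + K * (2 / a + 2 / a * (1 + K * 2 / a))) * norm (Psi_n n z \<alpha>)"
proof -
  define e where "e = norm (Psi_n n z \<alpha>)"
  define t where "t = theta_of \<alpha>" 
  define l where "l = lambda_of \<alpha>"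
  define D where "D = D_of \<alpha>"
  define t' where "t' = theta_hat \<phi> n z l"
  define D' where "D' = theta_hat' \<phi> n z l"
  have \<alpha>_eq: "\<alpha> = stack t l D" by (simp add: t_def l_def D_def)
  have hat_eq: "alpha_hat \<phi> n z l = stack t' l D'" by (simp add: alpha_hat_def t'_def D'_def)
  have near: "norm (t - t0) \<le> \<rho>" "norm (l - l0) \<le> \<rho>" "norm (D - D0) \<le> \<rho>"
    using \<alpha> norm_stack_ge(1)[of "t - t0" "l - l0" "D - D0"] norm_stack_ge(2)[of "l - l0" "t - t0" "D - D0"]
      norm_stack_ge(3)[of "D - D0" "t - t0" "l - l0"]
    unfolding \<alpha>_eq \<alpha>0_eq stack_diff by linarith+
  have near': "norm (t' - t0) \<le> \<rho>" "norm (D' - D0) \<le> \<rho>"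
    using hat norm_stack_ge(1)[of "t' - t0" "l - l0" "D' - D0"]
      norm_stack_ge(3)[of "D' - D0" "t' - t0" "l - l0"]
    unfolding l_def[symmetric] hat_eq \<alpha>0_eq stack_diff by linarith+
  define \<beta> where "\<beta> = stack t' l D"
  have \<beta>: "norm (\<beta> - \<alpha>0) \<le> \<delta>"
    using norm_stack_le[of "t' - t0" "l - l0" "D - D0"] near near' \<rho>
    by (simp add: \<beta>_def \<alpha>0_eq stack_diff)
  have zero: "Psi_n n z (stack t' l D') = stack 0 (TE' \<phi> \<psi> n z l) 0"
    using Psi_n_alpha_hat[OF unique diff, of l] by (simp add: hat_eq)
  have theta: "norm (t' - t) \<le> 2 / a * e"
  proof -
    \<comment> \<open>The derivative of f is \<open>A_n - A\<close>, of norm at most a/2. Since A is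
      bounded below by a, \<open>Phi\<close> expands distances by at least a/2.\<close>
    define f where "f s = Phi n z s l - A *v s" for s
    have "norm (f t' - f t) \<le> a / 2 * norm (t' - t)"
    proof (rule differentiable_bound)
      show "convex (cball t0 \<rho>)" by (rule convex_cball)
      show "t \<in> cball t0 \<rho>" "t' \<in> cball t0 \<rho>"
        using near near' by (simp_all add: dist_norm norm_minus_commute)
      fix s assume "s \<in> cball t0 \<rho>"
      then have s: "norm (s - t0) \<le> \<rho>" by (simp add: dist_norm norm_minus_commute)
      have "(f has_derivative (\<lambda>h. A_n n z s l *v h - A *v h)) (at s)"
        unfolding f_def
        by (intro has_derivative_diff Phi_has_derivative
            bounded_linear_imp_has_derivative matrix_vector_mul_bounded_linear)
      then show "(f has_derivative (\<lambda>h. A_n n z s l *v h - A *v h)) (at s within cball t0 \<rho>)"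
        by (rule has_derivative_at_withinI)
      show "onorm (\<lambda>h. A_n n z s l *v h - A *v h) \<le> a / 2"
        by (rule onorm_le) (rule A_n_near(3)[OF \<rho> s near(2)])
    qed
    moreover have fd: "f t' - f t = - Phi n z t l - A *v (t' - t)"
      using zero by (simp add: f_def Psi_n_stack matrix_vector_mult_diff_distrib)
        (metis stack_proj(1) add_0)
    moreover have "norm (A *v (t' - t)) \<le> norm (- Phi n z t l) + norm (- Phi n z t l - A *v (t' - t))"
      using norm_triangle_ineq4[of "- Phi n z t l" "- Phi n z t l - A *v (t' - t)"] by simp
    moreover have "norm (- Phi n z t l) \<le> e"
      using norm_proj_le(1)[of "Psi_n n z \<alpha>"] by (simp add: e_def \<alpha>_eq Psi_n_stack)
    ultimately have "a / 2 * norm (t' - t) \<le> e"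
      using a(2)[of "t' - t"] unfolding fd by linarith
    then show ?thesis using a(1) by (simp add: field_simps)
  qed
  have P\<beta>: "norm (Psi_n n z \<beta>) \<le> (1 + K * 2 / a) * e"
  proof -
    have "norm (Psi_n n z \<beta> - Psi_n n z \<alpha>) \<le> K * norm (\<beta> - \<alpha>)"
      by (rule lipschitz) (use \<beta> \<alpha> \<rho> in auto)
    also have "norm (\<beta> - \<alpha>) \<le> norm (t' - t)"
      using norm_stack_le[of "t' - t" "0 :: real^'q" "0 :: real^'q^'p"] by (simp add: \<beta>_def \<alpha>_eq stack_diff)
    also have "\<dots> \<le> 2 / a * e" by (rule theta)
    finally have "norm (Psi_n n z \<beta> - Psi_n n z \<alpha>) \<le> K * (2 / a * e)" using K by (simp add: mult_left_mono)
    then show ?thesis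
      using norm_triangle_ineq[of "Psi_n n z \<beta> - Psi_n n z \<alpha>" "Psi_n n z \<alpha>"]
      by (simp add: e_def[symmetric] algebra_simps)
  qed
  have DD: "norm (D' - D) \<le> 2 / a * ((1 + K * 2 / a) * e)"
  proof -
    have "D_of (Psi_n n z (stack t' l D')) = 0" using zero by simp
    then have "A_n n z t' l ** D' + B_n n z t' l = 0" by (simp add: Psi_n_stack)
    then have "D_of (Psi_n n z \<beta>) = A_n n z t' l ** D - A_n n z t' l ** D'"
      by (simp add: \<beta>_def Psi_n_stack eq_neg_iff_add_eq_0[symmetric] add.commute)
    also have "\<dots> = A_n n z t' l ** (D - D')"
      by (simp add: linear_diff[OF matrix_mult_linear_right])
    finally have "a / 2 * norm (D - D') \<le> norm (D_of (Psi_n n z \<beta>))"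
      using A_n_near(2)[OF \<rho> near'(1) near(2), of "D - D'"] by simp
    then have "a / 2 * norm (D - D') \<le> (1 + K * 2 / a) * e"
      using norm_proj_le(3)[of "Psi_n n z \<beta>"] P\<beta> by linarith
    then show ?thesis using a(1) by (simp add: field_simps norm_minus_commute)
  qed
  have "norm (Psi_n n z (stack t' l D') - Psi_n n z \<alpha>) \<le> K * norm (stack t' l D' - \<alpha>)"
    by (rule lipschitz) (use hat \<alpha> \<rho> in \<open>auto simp: hat_eq l_def[symmetric]\<close>)
  also have "norm (stack t' l D' - \<alpha>) \<le> 2 / a * e + 2 / a * ((1 + K * 2 / a) * e)"
    using norm_stack_le[of "t' - t" "0 :: real^'q" "D' - D"] theta DD by (simp add: \<alpha>_eq stack_diff)
  finally have "norm (Psi_n n z (stack t' l D') - Psi_n n z \<alpha>) \<le> K * (2 / a * e + 2 / a * ((1 + K * 2 / a) * e))"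
    using K by (simp add: mult_left_mono)
  then have "norm (Psi_n n z (stack t' l D')) \<le> e + K * (2 / a * e + 2 / a * ((1 + K * 2 / a) * e))"
    using norm_triangle_ineq[of "Psi_n n z (stack t' l D') - Psi_n n z \<alpha>" "Psi_n n z \<alpha>"] by (simp add: e_def)
  also have "\<dots> = (1 + K * (2 / a + 2 / a * (1 + K * 2 / a))) * e" by (simp add: algebra_simps)
  finally have "norm (TE' \<phi> \<psi> n z l) \<le> (1 + K * (2 / a + 2 / a * (1 + K * 2 / a))) * e"
    using norm_stack_ge(2)[of "TE' \<phi> \<psi> n z l" "0 :: real^'p" "0 :: real^'q^'p"]
    unfolding zero by linarith
  then show ?thesis by (simp only: e_def l_def)
qed

end

end

section \<open>Linearisation of the estimating function in the mean\<close>

lemma norm_matrix_le_sum: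
  fixes A :: "real^'n^'m"
  assumes "\<And>i j. \<bar>A $ i $ j\<bar> \<le> B"
  shows "norm A \<le> real CARD('m) * real CARD('n) * B"
proof -
  have "norm A \<le> (\<Sum>i\<in>UNIV. norm (A $ i))"
    unfolding norm_vec_def by (rule L2_set_le_sum) simp
  also have "\<dots> \<le> (\<Sum>i\<in>(UNIV :: 'm set). real CARD('n) * B)"
  proof (rule sum_mono)
    fix i
    have "norm (A $ i) \<le> (\<Sum>j\<in>UNIV. \<bar>A $ i $ j\<bar>)" by (rule norm_le_l1_cart)
    also have "\<dots> \<le> (\<Sum>j\<in>(UNIV :: 'n set). B)" by (rule sum_mono) (rule assms)
    finally show "norm (A $ i) \<le> real CARD('n) * B" by simp
  qed
  finally show ?thesis by simp
qed

lemma norm_matrix_vector_le: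
  fixes A :: "real^'n^'m"
  assumes "\<And>i j. \<bar>A $ i $ j\<bar> \<le> B"
  shows "norm (A *v x) \<le> real CARD('m) * real CARD('n) * B * norm x"
proof -
  have "norm (A *v x) \<le> onorm ((*v) A) * norm x"
    by (rule onorm) simp
  also have "\<dots> \<le> real CARD('m) * real CARD('n) * B * norm x"
    by (intro mult_right_mono onorm_le_matrix_component assms norm_ge_zero)
  finally show ?thesis .
qed

lemma bounded_linear_matrix_vector: "bounded_linear (\<lambda>A :: real^'n^'m. A *v x)"
  by (auto intro!: linearI simp: linear_conv_bounded_linear[symmetric]
      matrix_vector_mult_add_rdistrib scaleR_matrix_vector_assoc)

locale m_estimation = iid_sample M Z F + estimating_functions \<phi> \<psi>
  for M :: "'w measure" and Z :: "nat \<Rightarrow> 'w \<Rightarrow> real^'d" and F :: "(real^'d) measure"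
    and \<phi> :: "real^'d \<Rightarrow> real^'p \<Rightarrow> real^'q \<Rightarrow> real^'p" and \<psi> :: "real^'d \<Rightarrow> real^'p \<Rightarrow> real" +
  fixes \<alpha>0 :: "('p, 'q) param" and m0 m1 :: "real^'d \<Rightarrow> real" and R :: real
  assumes theta_hat: "\<forall>\<^sub>F n in sequentially. AE \<omega> in M. \<forall>l.
      (\<exists>!t. sample_mean n (\<lambda>i. Z i \<omega>) (\<lambda>z. \<phi> z t l) = 0) \<and>
      theta_hat \<phi> n (\<lambda>i. Z i \<omega>) differentiable (at l)"
    and Psi_zero: "integrable F (\<lambda>z. eta \<phi> \<psi> z \<alpha>0)" "Psi F \<phi> \<psi> \<alpha>0 = 0"
    and J_nonsingular: "invertible (jacobian (Psi F \<phi> \<psi>) (at \<alpha>0))"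
    and R: "0 < R"
    and eta_diff: "\<And>\<alpha> z. norm (\<alpha> - \<alpha>0) \<le> R \<Longrightarrow> eta \<phi> \<psi> z differentiable (at \<alpha>)"
    and eta_m0: "\<And>\<alpha> z. norm (\<alpha> - \<alpha>0) \<le> R \<Longrightarrow> norm (eta \<phi> \<psi> z \<alpha>) \<le> m0 z"
    and eta_m1: "\<And>\<alpha> z k l. norm (\<alpha> - \<alpha>0) \<le> R \<Longrightarrow> \<bar>jacobian (eta \<phi> \<psi> z) (at \<alpha>) $ k $ l\<bar> \<le> m1 z"
    and envelopes: "m0 \<in> borel_measurable borel" "integrable F (\<lambda>z. (m0 z)\<^sup>2)"
      "m1 \<in> borel_measurable borel" "integrable F (\<lambda>z. (m1 z)\<^sup>2)"
begin

sublocale F: prob_space F by (rule prob_space_F)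

declare eta_measurable [measurable] envelopes(1,3) [measurable]

abbreviation "\<eta> \<equiv> eta \<phi> \<psi>"
abbreviation "J \<equiv> jacobian (Psi F \<phi> \<psi>) (at \<alpha>0)"

definition eta' where "eta' z = jacobian (\<eta> z) (at \<alpha>0)"
text \<open>The number of entries of a Jacobian of \<eta>; turns the entrywise envelope into bounds
  on operator and Euclidean norms.\<close>

definition c1 where "c1 = real CARD('p + 'q + 'q \<times> 'p) * real CARD('p + 'q + 'q \<times> 'p)"

lemma c1_nonneg: "0 \<le> c1" by (simp add: c1_def)

lemma m1_nonneg: "0 \<le> m1 z"
proof -
  have "\<bar>jacobian (eta \<phi> \<psi> z) (at \<alpha>0) $ undefined $ undefined\<bar> \<le> m1 z"
    by (rule eta_m1) (use R in simp)
  then show ?thesis by linarith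
qed

lemma cball_iff: "\<alpha> \<in> cball \<alpha>0 r \<longleftrightarrow> norm (\<alpha> - \<alpha>0) \<le> r"
  by (simp add: dist_norm norm_minus_commute)

lemma eta_lipschitz:
  assumes "norm (\<alpha> - \<alpha>0) \<le> R" "norm (\<beta> - \<alpha>0) \<le> R"
  shows "norm (\<eta> z \<alpha> - \<eta> z \<beta>) \<le> c1 * m1 z * norm (\<alpha> - \<beta>)"
proof (rule differentiable_bound[where S = "cball \<alpha>0 R"])
  show "convex (cball \<alpha>0 R)" by (rule convex_cball)
  show "\<alpha> \<in> cball \<alpha>0 R" "\<beta> \<in> cball \<alpha>0 R" using assms by (simp_all only: cball_iff)
  fix x assume "x \<in> cball \<alpha>0 R"
  then have x: "norm (x - \<alpha>0) \<le> R" by (simp only: cball_iff)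
  show "(\<eta> z has_derivative (\<lambda>h. jacobian (\<eta> z) (at x) *v h)) (at x within cball \<alpha>0 R)"
    using eta_diff[OF x] unfolding jacobian_works by (rule has_derivative_at_withinI)
  show "onorm (\<lambda>h. jacobian (\<eta> z) (at x) *v h) \<le> c1 * m1 z"
    unfolding c1_def by (rule onorm_le_matrix_component) (rule eta_m1[OF x])
qed

lemma eta'_derivative: "(\<eta> z has_derivative (\<lambda>h. eta' z *v h)) (at \<alpha>0)"
  using eta_diff[of \<alpha>0 z] R unfolding eta'_def jacobian_works by simp

lemma eta'_measurable [measurable]: "eta' \<in> borel_measurable borel"
proof (intro borel_measurable_vecI)
  fix i j
  show "(\<lambda>z. eta' z $ i $ j) \<in> borel_measurable borel"
    unfolding eta'_def by (rule jacobian_measurable) (use eta_measurable eta_diff[of \<alpha>0] R in auto)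
qed

lemma eta'_le: "norm (eta' z) \<le> c1 * m1 z" "norm (eta' z *v x) \<le> c1 * m1 z * norm x"
proof -
  have le: "\<bar>eta' z $ i $ j\<bar> \<le> m1 z" for i j
    unfolding eta'_def by (rule eta_m1) (use R in simp)
  show "norm (eta' z) \<le> c1 * m1 z" "norm (eta' z *v x) \<le> c1 * m1 z * norm x"
    unfolding c1_def by (rule norm_matrix_le_sum norm_matrix_vector_le, rule le)+
qed

lemma square_dominated:
  fixes f :: "real^'d \<Rightarrow> 'b::euclidean_space"
  assumes [measurable]: "f \<in> borel_measurable borel" "g \<in> borel_measurable borel"
    and le: "\<And>z. norm (f z) \<le> c * g z" and g: "integrable F (\<lambda>z. (g z)\<^sup>2)"
  shows "integrable F (\<lambda>z. (norm (f z))\<^sup>2)" "integrable F f"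
proof -
  show 1: "integrable F (\<lambda>z. (norm (f z))\<^sup>2)"
  proof (rule Bochner_Integration.integrable_bound)
    show "integrable F (\<lambda>z. c\<^sup>2 * (g z)\<^sup>2)" using g by simp
    have "(norm (f z))\<^sup>2 \<le> (c * g z)\<^sup>2" for z
      by (rule power_mono[OF le]) simp
    then show "AE z in F. norm ((norm (f z))\<^sup>2) \<le> norm (c\<^sup>2 * (g z)\<^sup>2)"
      by (simp add: power_mult_distrib)
  qed measurable
  have "integrable F (\<lambda>z. norm (f z))"
    by (rule F.square_integrable_imp_integrable[OF _ 1]) measurable
  then show "integrable F f" by (subst (asm) integrable_norm_iff) measurable
qed

lemma eta_square: "norm (\<alpha> - \<alpha>0) \<le> R \<Longrightarrow> integrable F (\<lambda>z. (norm (\<eta> z \<alpha>))\<^sup>2)"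
  and eta_integrable: "norm (\<alpha> - \<alpha>0) \<le> R \<Longrightarrow> integrable F (\<lambda>z. \<eta> z \<alpha>)"
  by (rule square_dominated[OF eta_measurable envelopes(1), of _ 1]; simp add: eta_m0 envelopes(2))+

lemma eta'_square: "integrable F (\<lambda>z. (norm (eta' z))\<^sup>2)" and eta'_integrable: "integrable F eta'"
  by (rule square_dominated[OF eta'_measurable envelopes(3) eta'_le(1) envelopes(4)])+

lemma m1_square: "integrable F (\<lambda>z. (norm (m1 z))\<^sup>2)" and m1_integrable: "integrable F m1"
  by (rule square_dominated[OF envelopes(3,3), of 1]; simp add: m1_nonneg envelopes(4))+

section \<open>Linearisation error on shrinking balls, and differentiation under the
  integral\<close>

abbreviation "lin_err z \<alpha> \<equiv> norm (\<eta> z \<alpha> - \<eta> z \<alpha>0 - eta' z *v (\<alpha> - \<alpha>0))"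

text \<open>At \<alpha>0 the quotient is 0/0 = 0, which is the right value there.\<close>

definition rel_err where
  "rel_err z \<alpha> = lin_err z \<alpha> / norm (\<alpha> - \<alpha>0)"

text \<open>A fixed countable dense set; besides the measurable supremum it provides the candidates
  among which an approximate zero is later selected.\<close>

definition net :: "('p, 'q) param set" where
  "net = (SOME C. countable C \<and> (\<forall>X. open X \<and> X \<noteq> {} \<longrightarrow> (\<exists>d\<in>C. d \<in> X)))"

lemma net: "countable net" "open X \<Longrightarrow> X \<noteq> {} \<Longrightarrow> \<exists>d\<in>net. d \<in> X"
proof -
  have "\<exists>C :: ('p, 'q) param set. countable C \<and> (\<forall>X. open X \<and> X \<noteq> {} \<longrightarrow> (\<exists>d\<in>C. d \<in> X))"
    using countable_dense_setE by metis
  then have "countable net \<and> (\<forall>X. open X \<and> X \<noteq> {} \<longrightarrow> (\<exists>d\<in>net. d \<in> X))"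
    unfolding net_def by (rule someI_ex)
  then show "countable net" "open X \<Longrightarrow> X \<noteq> {} \<Longrightarrow> \<exists>d\<in>net. d \<in> X" by simp_all
qed

text \<open>The supremum is taken over a countable dense set to make it measurable.\<close>

definition sup_err where
  "sup_err k z = (SUP \<alpha>\<in>insert \<alpha>0 (net \<inter> ball \<alpha>0 (R / real (Suc k))). rel_err z \<alpha>)"

lemma rel_err_0 [simp]: "rel_err z \<alpha>0 = 0"
  by (simp add: rel_err_def)

lemma rel_err_le: "norm (\<alpha> - \<alpha>0) \<le> R \<Longrightarrow> rel_err z \<alpha> \<le> 2 * c1 * m1 z"
proof (cases "\<alpha> = \<alpha>0")
  case True
  then show ?thesis using c1_nonneg m1_nonneg by simp
next
  case False
  assume \<alpha>: "norm (\<alpha> - \<alpha>0) \<le> R"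
  have "lin_err z \<alpha> \<le> norm (\<eta> z \<alpha> - \<eta> z \<alpha>0) + norm (eta' z *v (\<alpha> - \<alpha>0))"
    by (rule norm_triangle_ineq4)
  also have "\<dots> \<le> c1 * m1 z * norm (\<alpha> - \<alpha>0) + c1 * m1 z * norm (\<alpha> - \<alpha>0)"
    by (intro add_mono eta_lipschitz \<alpha> eta'_le) (use R in simp)
  finally show ?thesis using False by (simp add: rel_err_def divide_le_eq mult_ac)
qed

lemma small_ball: "\<alpha> \<in> ball \<alpha>0 (R / real (Suc k)) \<Longrightarrow> norm (\<alpha> - \<alpha>0) \<le> R"
proof -
  assume "\<alpha> \<in> ball \<alpha>0 (R / real (Suc k))"
  then have "norm (\<alpha> - \<alpha>0) < R / real (Suc k)" by (simp add: dist_norm norm_minus_commute)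
  also have "\<dots> \<le> R" using R by (simp add: divide_le_eq)
  finally show ?thesis by simp
qed

lemma sup_err_index_le:
  "\<alpha> \<in> insert \<alpha>0 (net \<inter> ball \<alpha>0 (R / real (Suc k))) \<Longrightarrow> rel_err z \<alpha> \<le> 2 * c1 * m1 z"
  by (rule rel_err_le) (use small_ball R in auto)

lemma sup_err_bdd: "bdd_above (rel_err z ` insert \<alpha>0 (net \<inter> ball \<alpha>0 (R / real (Suc k))))"
  using sup_err_index_le by (intro bdd_aboveI2) 

lemma sup_err_measurable [measurable]: "sup_err k \<in> borel_measurable borel"
  unfolding sup_err_def
proof (rule borel_measurable_cSUP)
  show "countable (insert \<alpha>0 (net \<inter> ball \<alpha>0 (R / real (Suc k))))" using net(1) by simp
  show "(\<lambda>z. rel_err z \<alpha>) \<in> borel_measurable borel" for \<alpha>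
  proof -
    have [measurable]: "(\<lambda>z. eta' z *v (\<alpha> - \<alpha>0)) \<in> borel_measurable borel"
      using borel_measurable_continuous_onI[OF linear_continuous_on[OF bounded_linear_matrix_vector]]
      by (rule measurable_compose[OF eta'_measurable])
    show ?thesis unfolding rel_err_def by measurable
  qed
qed (rule sup_err_bdd)

lemma sup_err_bounds: "0 \<le> sup_err k z" "sup_err k z \<le> 2 * c1 * m1 z"
proof -
  \<comment> \<open>This is what \<alpha>0 was inserted into the index set for: its value 0 bounds
    the supremum from below.\<close>
  have "rel_err z \<alpha>0 \<le> sup_err k z"
    unfolding sup_err_def by (rule cSUP_upper[OF _ sup_err_bdd]) simp
  then show "0 \<le> sup_err k z" by simp
  show "sup_err k z \<le> 2 * c1 * m1 z"
    unfolding sup_err_def by (rule cSUP_least) (use sup_err_index_le in auto)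
qed

text \<open>Away from \<alpha>0 the relative error is continuous on the ball, so exceeding the
  supremum at one point would mean exceeding it on an open set, which meets the dense set.\<close>

lemma rel_err_le_sup_err:
  assumes "\<alpha> \<in> ball \<alpha>0 (R / real (Suc k))"
  shows "rel_err z \<alpha> \<le> sup_err k z"
proof (cases "\<alpha> = \<alpha>0")
  case True
  then show ?thesis using sup_err_bounds by simp
next
  case False
  show ?thesis
  proof (rule ccontr)
    assume "\<not> rel_err z \<alpha> \<le> sup_err k z"
    then have gt: "sup_err k z < rel_err z \<alpha>" by simp
    have "isCont (\<eta> z) \<alpha>"
      using eta_diff[OF small_ball[OF assms]] by (rule differentiable_imp_continuous_within)
    then have contE: "isCont (\<lambda>\<alpha>. \<eta> z \<alpha> - \<eta> z \<alpha>0 - eta' z *v (\<alpha> - \<alpha>0)) \<alpha>"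
      by (intro continuous_diff continuous_const continuous_ident
          bounded_linear.isCont[OF matrix_vector_mul_bounded_linear])
    have "isCont (\<lambda>\<alpha>. lin_err z \<alpha> / norm (\<alpha> - \<alpha>0)) \<alpha>"
      by (intro isCont_divide isCont_norm[OF contE] isCont_norm continuous_diff continuous_const continuous_ident)
        (use False in simp)
    then have "isCont (rel_err z) \<alpha>"
      unfolding rel_err_def[abs_def] .
    then have "(rel_err z \<longlongrightarrow> rel_err z \<alpha>) (nhds \<alpha>)"
      by (simp add: isCont_def tendsto_at_iff_tendsto_nhds)
    then have "\<forall>\<^sub>F x in nhds \<alpha>. sup_err k z < rel_err z x"
      using gt by (rule order_tendstoD)
    moreover have "\<forall>\<^sub>F x in nhds \<alpha>. x \<in> ball \<alpha>0 (R / real (Suc k))"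
      using assms by (intro eventually_nhds_in_open open_ball)
    ultimately have "\<forall>\<^sub>F x in nhds \<alpha>. sup_err k z < rel_err z x \<and> x \<in> ball \<alpha>0 (R / real (Suc k))"
      by (rule eventually_conj)
    then obtain S where S: "open S" "\<alpha> \<in> S"
      "\<And>x. x \<in> S \<Longrightarrow> sup_err k z < rel_err z x \<and> x \<in> ball \<alpha>0 (R / real (Suc k))"
      unfolding eventually_nhds by blast
    then obtain x where x: "x \<in> net" "x \<in> S" using net(2)[of S] by blast
    then have "rel_err z x \<le> sup_err k z"
      unfolding sup_err_def using S(3)[of x] by (intro cSUP_upper[OF _ sup_err_bdd]) auto
    with S(3)[OF x(2)] show False by simp
  qed
qed

lemma linearisation_error:
  assumes "norm (\<alpha> - \<alpha>0) < R / real (Suc k)"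
  shows "lin_err z \<alpha> \<le> sup_err k z * norm (\<alpha> - \<alpha>0)"
proof (cases "\<alpha> = \<alpha>0")
  case False
  have "\<alpha> \<in> ball \<alpha>0 (R / real (Suc k))"
    using assms by (simp add: dist_norm norm_minus_commute)
  from rel_err_le_sup_err[OF this, of z] False show ?thesis
    by (simp add: rel_err_def divide_le_eq)
qed simp

text \<open>For fixed z this is differentiability of \<eta> at \<alpha>0, restated over balls of
  radius R/(k+1).\<close>

lemma sup_err_tendsto: "(\<lambda>k. sup_err k z) \<longlonglongrightarrow> 0"
proof (rule order_tendstoI)
  fix e :: real assume "e < 0"
  then show "\<forall>\<^sub>F k in sequentially. e < sup_err k z"
    using sup_err_bounds(1) by (intro always_eventually allI) (rule order_less_le_trans)
next
  fix e :: real assume "0 < e"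
  then obtain d where d: "0 < d" "\<And>y. norm (y - \<alpha>0) < d \<Longrightarrow>
      lin_err z y \<le> e / 2 * norm (y - \<alpha>0)"
    using eta'_derivative[of z] unfolding has_derivative_at_alt by (meson half_gt_zero)
  have "(\<lambda>k. R * inverse (real (Suc k))) \<longlonglongrightarrow> R * 0"
    by (intro tendsto_intros LIMSEQ_inverse_real_of_nat)
  then have "\<forall>\<^sub>F k in sequentially. R * inverse (real (Suc k)) < d"
    using d(1) by (intro order_tendstoD) auto
  then show "\<forall>\<^sub>F k in sequentially. sup_err k z < e"
  proof eventually_elim
    case (elim k)
    have "sup_err k z \<le> e / 2"
      unfolding sup_err_def
    proof (rule cSUP_least)
      fix \<alpha> assume "\<alpha> \<in> insert \<alpha>0 (net \<inter> ball \<alpha>0 (R / real (Suc k)))"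
      then consider "\<alpha> = \<alpha>0" | "\<alpha> \<noteq> \<alpha>0" "norm (\<alpha> - \<alpha>0) < R / real (Suc k)"
        by (auto simp: dist_norm norm_minus_commute)
      then show "rel_err z \<alpha> \<le> e / 2"
      proof cases
        case 1
        then show ?thesis using \<open>0 < e\<close> by simp
      next
        case 2
        then have "norm (\<alpha> - \<alpha>0) < d" using elim by (simp add: divide_inverse)
        from d(2)[OF this] 2(1) show ?thesis by (simp add: rel_err_def divide_le_eq)
      qed
    qed simp
    then show ?case using \<open>0 < e\<close> by simp
  qed
qed

lemma sup_err_square: "integrable F (\<lambda>z. (norm (sup_err k z))\<^sup>2)" and sup_err_integrable: "integrable F (sup_err k)"
  by (rule square_dominated[OF sup_err_measurable envelopes(3) _ envelopes(4), of _ "2 * c1"];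
      use sup_err_bounds in simp)+

text \<open>The integrable envelope \<open>2 * c1 * m1\<close> upgrades pointwise to mean
  convergence. Both the linearisation of \<Psi> and, by the law of large numbers, that of
  \<open>Psi_n\<close> rest on this.\<close>

lemma sup_err_mean_small:
  assumes "0 < e" shows "\<exists>k. (LINT z|F. sup_err k z) < e"
proof -
  have "(\<lambda>k. LINT z|F. sup_err k z) \<longlonglongrightarrow> (LINT z|F. 0)"
  proof (rule integral_dominated_convergence[where w = "\<lambda>z. 2 * c1 * m1 z"])
    show "integrable F (\<lambda>z. 2 * c1 * m1 z)" using m1_integrable by simp
    show "AE z in F. (\<lambda>k. sup_err k z) \<longlonglongrightarrow> 0" using sup_err_tendsto by simp
    show "AE z in F. norm (sup_err k z) \<le> 2 * c1 * m1 z" for k using sup_err_bounds by simp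
  qed measurable
  then have "\<forall>\<^sub>F k in sequentially. (LINT z|F. sup_err k z) < e"
    using assms by (intro order_tendstoD) auto
  then show ?thesis by (auto simp: eventually_sequentially)
qed

text \<open>Differentiation under the integral at the single point \<alpha>0: the integrated
  linearisation error is at most the mean of \<open>sup_err k\<close> times the distance. Thus J is
  the limit of the empirical Jacobians at \<alpha>0.\<close>

lemma J_eq: "J = (LINT z|F. eta' z)"
proof (rule jacobian_eqI)
  define J1 where "J1 = (LINT z|F. eta' z)"
  have "(Psi F \<phi> \<psi> has_derivative (\<lambda>h. J1 *v h)) (at \<alpha>0)"
    unfolding has_derivative_at_alt
  proof (intro conjI matrix_vector_mul_bounded_linear allI impI)
    fix e :: real assume "0 < e"
    then obtain k where k: "(LINT z|F. sup_err k z) < e" using sup_err_mean_small by blast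
    show "\<exists>d>0. \<forall>y. norm (y - \<alpha>0) < d \<longrightarrow>
      norm (Psi F \<phi> \<psi> y - Psi F \<phi> \<psi> \<alpha>0 - J1 *v (y - \<alpha>0)) \<le> e * norm (y - \<alpha>0)"
    proof (intro exI[of _ "R / real (Suc k)"] conjI allI impI)
      show "0 < R / real (Suc k)" using R by simp
      fix y assume y: "norm (y - \<alpha>0) < R / real (Suc k)"
      then have yR: "norm (y - \<alpha>0) \<le> R"
        using small_ball[of y k] by (simp add: dist_norm norm_minus_commute)
      have T: "integrable F (\<lambda>z. eta' z *v (y - \<alpha>0))" "(LINT z|F. eta' z *v (y - \<alpha>0)) = J1 *v (y - \<alpha>0)"
        unfolding J1_def
        using integrable_bounded_linear[OF bounded_linear_matrix_vector eta'_integrable]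
          integral_bounded_linear[OF bounded_linear_matrix_vector eta'_integrable] by blast+
      have "Psi F \<phi> \<psi> y - Psi F \<phi> \<psi> \<alpha>0 - J1 *v (y - \<alpha>0) = (LINT z|F. \<eta> z y - \<eta> z \<alpha>0 - eta' z *v (y - \<alpha>0))"
        unfolding Psi_def using eta_integrable[OF yR] Psi_zero(1) T by simp
      also have "norm \<dots> \<le> (LINT z|F. lin_err z y)"
        by (rule integral_norm_bound)
      also have "\<dots> \<le> (LINT z|F. sup_err k z * norm (y - \<alpha>0))"
      proof (rule integral_mono)
        show "integrable F (\<lambda>z. lin_err z y)"
          using eta_integrable[OF yR] Psi_zero(1) T by (intro integrable_norm Bochner_Integration.integrable_diff)
        show "integrable F (\<lambda>z. sup_err k z * norm (y - \<alpha>0))" using sup_err_integrable by simp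
      qed (rule linearisation_error[OF y])
      also have "\<dots> = (LINT z|F. sup_err k z) * norm (y - \<alpha>0)" by simp
      also have "\<dots> \<le> e * norm (y - \<alpha>0)" using k by (intro mult_right_mono) auto
      finally show "norm (Psi F \<phi> \<psi> y - Psi F \<phi> \<psi> \<alpha>0 - J1 *v (y - \<alpha>0)) \<le> e * norm (y - \<alpha>0)" .
    qed
  qed
  then show "(Psi F \<phi> \<psi> has_derivative (\<lambda>h. (LINT z|F. eta' z) *v h)) (at \<alpha>0)"
    unfolding J1_def .
qed

lemma J_integral:
  assumes "bounded_linear T"
  shows "T J = (LINT z|F. T (eta' z))" "integrable F (\<lambda>z. T (eta' z))"
  unfolding J_eq using integral_bounded_linear[OF assms eta'_integrable]
    integrable_bounded_linear[OF assms eta'_integrable] by simp_all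

text \<open>A deterministic Lipschitz constant for \<open>Psi_n\<close>, valid once the sample mean
  of \<open>m1\<close> exceeds its expectation by less than 1.\<close>

definition K where "K = c1 * ((LINT z|F. m1 z) + 1)"

lemma K_nonneg: "0 \<le> K"
  unfolding K_def using c1_nonneg m1_nonneg by (intro mult_nonneg_nonneg add_nonneg_nonneg integral_nonneg_AE) auto

lemma Psi_n_lipschitz:
  assumes "sample_mean n z m1 < (LINT z|F. m1 z) + 1" "norm (\<alpha> - \<alpha>0) \<le> R" "norm (\<beta> - \<alpha>0) \<le> R"
  shows "norm (Psi_n n z \<alpha> - Psi_n n z \<beta>) \<le> K * norm (\<alpha> - \<beta>)"
proof -
  have "norm (Psi_n n z \<alpha> - Psi_n n z \<beta>) \<le> sample_mean n z (\<lambda>x. norm (\<eta> x \<alpha> - \<eta> x \<beta>))"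
    unfolding Psi_n_def sample_mean_diff[symmetric] by (rule sample_mean_norm)
  also have "\<dots> \<le> sample_mean n z (\<lambda>x. m1 x *\<^sub>R (c1 * norm (\<alpha> - \<beta>)))"
    by (rule sample_mean_mono) (use eta_lipschitz[OF assms(2,3)] in \<open>simp add: mult_ac\<close>)
  also have "\<dots> = sample_mean n z m1 * (c1 * norm (\<alpha> - \<beta>))"
    by (simp add: sample_mean_def sum_distrib_right)
  also have "\<dots> \<le> ((LINT z|F. m1 z) + 1) * (c1 * norm (\<alpha> - \<beta>))"
    using assms(1) c1_nonneg by (intro mult_right_mono) auto
  finally show ?thesis by (simp add: K_def mult_ac)
qed

text \<open>The error splits into the mean of the pointwise linearisation errors and the deviation
  of the mean Jacobian from J; each receives e/2.\<close>

lemma Psi_n_linearisation: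
  assumes "norm (sample_mean n z eta' - J) < e / (2 * (c1 + 1))" "sample_mean n z (sup_err k) < e / 2"
    and \<alpha>: "norm (\<alpha> - \<alpha>0) < R / real (Suc k)"
  shows "norm (Psi_n n z \<alpha> - Psi_n n z \<alpha>0 - J *v (\<alpha> - \<alpha>0)) \<le> e * norm (\<alpha> - \<alpha>0)"
proof -
  define E where "E = sample_mean n z eta' - J"
  define h where "h = \<alpha> - \<alpha>0"
  have "norm (E *v h) \<le> c1 * norm E * norm h"
    unfolding c1_def
  proof (rule norm_matrix_vector_le)
    fix i j
    have "\<bar>E $ i $ j\<bar> \<le> norm (E $ i)" by (rule component_le_norm_cart)
    also have "\<dots> \<le> norm E" by (rule Finite_Cartesian_Product.norm_nth_le)
    finally show "\<bar>E $ i $ j\<bar> \<le> norm E" .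
  qed
  also have "c1 * norm E * norm h \<le> e / 2 * norm h"
  proof (intro mult_right_mono norm_ge_zero)
    have "c1 * norm E \<le> (c1 + 1) * norm E" by (simp add: mult_right_mono)
    also have "\<dots> \<le> (c1 + 1) * (e / (2 * (c1 + 1)))"
      using assms(1) c1_nonneg unfolding E_def by (intro mult_left_mono) auto
    also have "\<dots> = e / 2"
    proof -
      have "c * (e / (2 * c)) = e / 2" if "0 < c" for c using that by simp
      from this[of "c1 + 1"] show ?thesis using c1_nonneg by simp
    qed
    finally show "c1 * norm E \<le> e / 2" .
  qed
  finally have 1: "norm (E *v h) \<le> e / 2 * norm h" .
  have eq: "Psi_n n z \<alpha> - Psi_n n z \<alpha>0 - J *v h = sample_mean n z (\<lambda>x. \<eta> x \<alpha> - \<eta> x \<alpha>0 - eta' x *v h) + E *v h"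
    unfolding E_def Psi_n_def sample_mean_diff sample_mean_matrix_vector by (simp add: matrix_vector_mult_diff_rdistrib)
  have "norm (sample_mean n z (\<lambda>x. \<eta> x \<alpha> - \<eta> x \<alpha>0 - eta' x *v h)) \<le> sample_mean n z (\<lambda>x. norm (\<eta> x \<alpha> - \<eta> x \<alpha>0 - eta' x *v h))"
    by (rule sample_mean_norm)
  also have "\<dots> \<le> sample_mean n z (\<lambda>x. sup_err k x *\<^sub>R norm h)"
    by (rule sample_mean_mono) (use linearisation_error[OF \<alpha>] in \<open>simp add: h_def\<close>)
  also have "\<dots> = sample_mean n z (sup_err k) * norm h"
    by (simp add: sample_mean_def sum_distrib_right)
  also have "\<dots> \<le> e / 2 * norm h" using assms(2) by (intro mult_right_mono) auto
  finally show ?thesis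
    using 1 norm_triangle_ineq[of "sample_mean n z (\<lambda>x. \<eta> x \<alpha> - \<eta> x \<alpha>0 - eta' x *v h)" "E *v h"]
    unfolding eq[unfolded h_def] h_def by simp
qed

section \<open>Block structure of the Jacobian of \<Psi> at \<alpha>0\<close>

definition t0 where "t0 = theta_of \<alpha>0"
definition l0 where "l0 = lambda_of \<alpha>0"
definition D0 where "D0 = D_of \<alpha>0"
text \<open>The \<theta>-block of J, identified in \<open>A_eq\<close> as the mean of
  \<open>dtheta\<close>.\<close>

definition A where "A = matrix (\<lambda>t. theta_of (J *v stack t 0 0))"

lemma \<alpha>0_stack: "\<alpha>0 = stack t0 l0 D0" by (simp add: t0_def l0_def D0_def)

lemma eta_\<alpha>0: "D_of (\<eta> z \<alpha>0) = dtheta z t0 l0 ** D0 + dlam z t0 l0"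
  using eta_stack[of z t0 l0 D0] by (simp only: \<alpha>0_stack[symmetric] stack_proj)

lemma \<alpha>0_shift: "\<alpha>0 + stack 0 0 h = stack t0 l0 (D0 + h)"
  using stack_add[of t0 l0 D0 0 0 h] by (simp only: \<alpha>0_stack[symmetric] add_0_right)

lemma theta_eta': "theta_of (eta' z *v stack t l D) = dtheta z t0 l0 *v t + dlam z t0 l0 *v l"
proof -
  have "((\<lambda>\<alpha>. theta_of (\<eta> z \<alpha>)) has_derivative (\<lambda>h. theta_of (eta' z *v h))) (at \<alpha>0)"
    by (rule bounded_linear.has_derivative[OF bounded_linear_proj(1) eta'_derivative])
  moreover have "(\<lambda>\<alpha>. theta_of (\<eta> z \<alpha>)) = (\<lambda>\<alpha>. \<phi> z (theta_of \<alpha>) (lambda_of \<alpha>))"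
    by (simp add: eta_def Let_def fun_eq_iff)
  moreover have "((\<lambda>\<alpha>. \<phi> z (theta_of \<alpha>) (lambda_of \<alpha>)) has_derivative
      (\<lambda>h. dtheta z t0 l0 *v theta_of h + dlam z t0 l0 *v lambda_of h)) (at \<alpha>0)"
  proof -
    have p: "((\<lambda>\<alpha>. (theta_of \<alpha>, lambda_of \<alpha>)) has_derivative (\<lambda>h. (theta_of h, lambda_of h))) (at \<alpha>0)"
      by (intro has_derivative_Pair bounded_linear_imp_has_derivative bounded_linear_proj)
    show ?thesis
      using has_derivative_compose[OF p \<phi>_has_derivative(1)[of z "theta_of \<alpha>0" "lambda_of \<alpha>0"]]
      by (simp add: t0_def l0_def)
  qed
  ultimately have "(\<lambda>h. theta_of (eta' z *v h)) = (\<lambda>h. dtheta z t0 l0 *v theta_of h + dlam z t0 l0 *v lambda_of h)"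
    by (intro has_derivative_unique[of "\<lambda>\<alpha>. theta_of (\<eta> z \<alpha>)"]) (simp_all only:)
  from fun_cong[OF this, of "stack t l D"] show ?thesis by simp
qed

text \<open>\<eta>3 is affine in D with linear part \<open>dtheta\<close>, the matrix that also
  governs \<eta>1 in \<theta>. Hence a single matrix A appears in both blocks of J.\<close>

lemma D_eta': "D_of (eta' z *v stack 0 0 h) = dtheta z t0 l0 ** h"
proof -
  have bl: "bounded_linear (\<lambda>h. stack 0 0 h :: ('p, 'q) param)"
    by (auto intro!: linearI simp: linear_conv_bounded_linear[symmetric] stack_add stack_scaleR)
  have "((\<lambda>h. \<alpha>0 + stack 0 0 h) has_derivative (\<lambda>h. stack 0 0 h)) (at (0 :: real^'q^'p))"
    using has_derivative_add[OF has_derivative_const bounded_linear_imp_has_derivative[OF bl], of \<alpha>0 "at 0"] by simp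
  then have "((\<lambda>h. \<eta> z (\<alpha>0 + stack 0 0 h)) has_derivative (\<lambda>h. eta' z *v stack 0 0 h)) (at 0)"
    by (rule has_derivative_compose) (simp add: stack_zero eta'_derivative)
  then have d1: "((\<lambda>h. D_of (\<eta> z (\<alpha>0 + stack 0 0 h))) has_derivative (\<lambda>h. D_of (eta' z *v stack 0 0 h))) (at 0)"
    by (rule bounded_linear.has_derivative[OF bounded_linear_proj(3)])
  have eq: "(\<lambda>h. D_of (\<eta> z (\<alpha>0 + stack 0 0 h))) = (\<lambda>h. dtheta z t0 l0 ** h + (dtheta z t0 l0 ** D0 + dlam z t0 l0))"
    unfolding \<alpha>0_shift eta_stack
    by (simp add: fun_eq_iff linear_add[OF matrix_mult_linear_right])
  have "bounded_linear (\<lambda>h :: real^'q^'p. dtheta z t0 l0 ** h)"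
    using matrix_mult_linear_right by (simp add: linear_conv_bounded_linear)
  then have "((\<lambda>h :: real^'q^'p. dtheta z t0 l0 ** h + (dtheta z t0 l0 ** D0 + dlam z t0 l0)) has_derivative
      (\<lambda>h. dtheta z t0 l0 ** h + 0)) (at 0)"
    by (intro has_derivative_add has_derivative_const bounded_linear_imp_has_derivative)
  then have "(\<lambda>h. D_of (eta' z *v stack 0 0 h)) = (\<lambda>h. dtheta z t0 l0 ** h + 0)"
    by (rule has_derivative_unique[OF d1[unfolded eq]])
  from fun_cong[OF this] show ?thesis by simp
qed

lemma bl_theta: "bounded_linear (\<lambda>B. theta_of (B *v x))" and bl_D: "bounded_linear (\<lambda>B. D_of (B *v x))"
  by (rule bounded_linear_compose[OF bounded_linear_proj(1) bounded_linear_matrix_vector]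
      bounded_linear_compose[OF bounded_linear_proj(3) bounded_linear_matrix_vector])+

lemma A_eq: "A *v t = (LINT z|F. dtheta z t0 l0 *v t)" "integrable F (\<lambda>z. dtheta z t0 l0 *v t)"
  "integrable F (\<lambda>z. dlam z t0 l0 *v l)"
proof -
  have "linear (theta_of \<circ> ((*v) J \<circ> (\<lambda>t. stack t 0 0)))"
    by (intro linear_compose bounded_linear.linear[OF bounded_linear_proj(1)] matrix_vector_mul_linear linearI)
      (simp_all add: stack_add stack_scaleR)
  then have "linear (\<lambda>t. theta_of (J *v stack t 0 0))" by (simp only: o_def)
  then have "A *v t = theta_of (J *v stack t 0 0)" unfolding A_def by (rule matrix_works[OF linear_matrix_vector_mul_eq[THEN iffD2]])
  then show "A *v t = (LINT z|F. dtheta z t0 l0 *v t)"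
    by (simp add: J_integral(1)[OF bl_theta] theta_eta')
  show "integrable F (\<lambda>z. dtheta z t0 l0 *v t)" "integrable F (\<lambda>z. dlam z t0 l0 *v l)"
    using J_integral(2)[OF bl_theta[of "stack t 0 0"]] J_integral(2)[OF bl_theta[of "stack 0 l 0"]]
    by (simp_all add: theta_eta')
qed

text \<open>The third block of \<Psi> vanishes at \<alpha>0, which says that the mean of
  \<open>dlam\<close> is -A D0. The \<lambda>-column of the first block row is thereby expressed
  through A.\<close>

lemma J_theta: "theta_of (J *v stack t l D) = A *v (t - D0 *v l)"
proof -
  have "theta_of (J *v stack t l D) = (LINT z|F. dtheta z t0 l0 *v t + dlam z t0 l0 *v l)"
    by (simp add: J_integral(1)[OF bl_theta] theta_eta')
  also have "\<dots> = A *v t + (LINT z|F. dlam z t0 l0 *v l)"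
    using A_eq by simp
  also have "(LINT z|F. dlam z t0 l0 *v l) = - (A *v (D0 *v l))"
  proof -
    have "A *v (D0 *v l) + (LINT z|F. dlam z t0 l0 *v l) = (LINT z|F. dtheta z t0 l0 *v (D0 *v l) + dlam z t0 l0 *v l)"
      using A_eq by simp
    also have "\<dots> = (LINT z|F. D_of (\<eta> z \<alpha>0) *v l)"
      unfolding eta_\<alpha>0 by (simp add: matrix_vector_mult_add_rdistrib matrix_vector_mul_assoc)
    also have "\<dots> = D_of (Psi F \<phi> \<psi> \<alpha>0) *v l"
      unfolding Psi_def
      by (rule integral_bounded_linear[OF bounded_linear_compose[OF bounded_linear_matrix_vector bounded_linear_proj(3)] Psi_zero(1)])
    also have "\<dots> = 0" by (simp add: Psi_zero(2) D_of_def vec_eq_iff matrix_vector_mult_def)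
    finally show ?thesis by (rule iffD1[OF add_eq_0_iff])
  qed
  finally show ?thesis by (simp add: matrix_vector_mult_diff_distrib)
qed

lemma J_D: "D_of (J *v stack 0 0 h) = A ** h"
proof (subst matrix_eq, safe)
  fix x
  have "D_of (J *v stack 0 0 h) = (LINT z|F. dtheta z t0 l0 ** h)" "integrable F (\<lambda>z. dtheta z t0 l0 ** h)"
    using J_integral[OF bl_D[of "stack 0 0 h"]] by (simp_all add: D_eta')
  then have "D_of (J *v stack 0 0 h) *v x = (LINT z|F. (dtheta z t0 l0 ** h) *v x)"
    using integral_bounded_linear[OF bounded_linear_matrix_vector] by metis
  also have "\<dots> = A *v (h *v x)" unfolding A_eq(1) by (simp only: matrix_vector_mul_assoc)
  finally show "D_of (J *v stack 0 0 h) *v x = (A ** h) *v x" by (simp add: matrix_vector_mul_assoc)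
qed

text \<open>The first block of rows of \<open>J\<close> factors through \<open>A\<close>, because \<open>\<eta>\<^sub>3\<close> has mean zero at \<open>\<alpha>0\<close>;
  hence \<open>A\<close> inherits surjectivity from \<open>J\<close>.\<close>

lemma A_invertible: "invertible A"
proof -
  have "\<exists>u. A *v u = v" for v
  proof -
    have "J *v (matrix_inv J *v stack v 0 0) = stack v 0 0"
      using matrix_inv(2)[OF J_nonsingular] by (simp add: matrix_vector_mul_assoc)
    then have "v = theta_of (J *v (matrix_inv J *v stack v 0 0))" by simp
    then show ?thesis using J_theta by (metis stack_collapse)
  qed
  then have "surj ((*v) A)" by (metis surjI surj_def)
  then show ?thesis
    by (metis invertible_right_inverse matrix_right_invertible_surjective)
qed

end

section \<open>Consistency and asymptotic normality\<close>

lemma covariance_matrix_linear_image: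
  fixes g :: "'z \<Rightarrow> real^'k" and B :: "real^'k^'k"
  assumes [measurable]: "g \<in> borel_measurable F" and sq: "integrable F (\<lambda>z. (norm (g z))\<^sup>2)"
    and int: "integrable F g" and mean: "(LINT z|F. g z) = 0"
  shows "covariance_matrix F (\<lambda>z. - (B *v g z)) = B ** covariance_matrix F g ** transpose B"
proof -
  note prod = integrable_component_product[OF assms(1) sq]
  have comp_int: "integrable F (\<lambda>z. g z $ k)" for k
    using int by (simp add: cart_eq_inner_axis)
  have comp: "(LINT z|F. g z $ k) = 0" for k
    using int mean by (simp add: cart_eq_inner_axis)
  have Bg: "(B *v g z) $ k = (\<Sum>i\<in>UNIV. B $ k $ i * g z $ i)" for z k
    by (simp add: matrix_vector_mult_def)
  have mean': "(LINT z|F. (B *v g z) $ k) = 0" for k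
    unfolding Bg using comp comp_int by (simp add: Bochner_Integration.integral_sum)
  have "covariance_matrix F (\<lambda>z. - (B *v g z)) $ k $ l = (B ** covariance_matrix F g ** transpose B) $ k $ l" for k l
  proof -
    have "covariance_matrix F (\<lambda>z. - (B *v g z)) $ k $ l = (LINT z|F. (B *v g z) $ k * (B *v g z) $ l)"
      by (simp add: covariance_matrix_def mean')
    also have "\<dots> = (LINT z|F. (\<Sum>i\<in>UNIV. \<Sum>j\<in>UNIV. B $ k $ i * B $ l $ j * (g z $ i * g z $ j)))"
      unfolding Bg sum_product by (simp add: mult_ac)
    also have "\<dots> = (\<Sum>i\<in>UNIV. \<Sum>j\<in>UNIV. B $ k $ i * B $ l $ j * (LINT z|F. g z $ i * g z $ j))"
      using prod by (simp add: Bochner_Integration.integral_sum)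
    also have "\<dots> = (\<Sum>j\<in>UNIV. \<Sum>i\<in>UNIV. B $ k $ i * B $ l $ j * (LINT z|F. g z $ i * g z $ j))"
      by (rule sum.swap)
    also have "\<dots> = (B ** covariance_matrix F g ** transpose B) $ k $ l"
      by (simp add: matrix_matrix_mult_def transpose_def covariance_matrix_def comp sum_distrib_left sum_distrib_right mult_ac)
    finally show ?thesis .
  qed
  then show ?thesis by (simp add: vec_eq_iff)
qed

context m_estimation
begin

lemma linearised_estimator_exists:
  "\<exists>a b d j. linearised_estimator \<phi> \<psi> t0 l0 D0 \<alpha>0 J A a b d j"
proof -
  obtain a where a: "0 < a" "\<And>u. a * norm u \<le> norm (A *v u)" "\<And>h :: real^'q^'p. a * norm h \<le> norm (A ** h)"
    using invertible_bounded_below[OF A_invertible] by blast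
  obtain j where j: "0 < j" "\<And>u. j * norm u \<le> norm (J *v u)"
    using invertible_bounded_below[OF J_nonsingular] by blast
  obtain b where b: "0 < b" "\<And>x. norm (J *v x) \<le> norm x * b"
    using bounded_linear.pos_bounded[OF matrix_vector_mul_bounded_linear[of J]] by blast
  obtain d where d: "0 < d" "\<And>x. norm (D0 *v x) \<le> norm x * d"
    using bounded_linear.pos_bounded[OF matrix_vector_mul_bounded_linear[of D0]] by blast
  have "linearised_estimator \<phi> \<psi> t0 l0 D0 \<alpha>0 J A a b d j"
  proof (intro linearised_estimator.intro estimating_functions_axioms linearised_estimator_axioms.intro)
    show "norm (J *v x) \<le> b * norm x" for x using b(2)[of x] by (simp only: mult.commute)
    show "norm (D0 *v x) \<le> d * norm x" for x using d(2)[of x] by (simp only: mult.commute)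
    show "0 \<le> b" "0 \<le> d" using b(1) d(1) by simp_all
  qed (rule \<alpha>0_stack J_theta J_D A_invertible J_nonsingular a j)+
  then show ?thesis by blast
qed

end

text \<open>Turns the constants whose existence was just shown into parameters, so that
  abbreviations and definitions can refer to them.\<close>

locale tuned_estimation = m_estimation M Z F \<phi> \<psi> \<alpha>0 m0 m1 R
  for M :: "'w measure" and Z :: "nat \<Rightarrow> 'w \<Rightarrow> real^'d" and F :: "(real^'d) measure"
    and \<phi> :: "real^'d \<Rightarrow> real^'p \<Rightarrow> real^'q \<Rightarrow> real^'p" and \<psi> :: "real^'d \<Rightarrow> real^'p \<Rightarrow> real"
    and \<alpha>0 :: "('p, 'q) param" and m0 m1 R +
  fixes lambda_hat :: "nat \<Rightarrow> 'w \<Rightarrow> real^'q" and a b d j :: real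
  assumes linearised: "linearised_estimator \<phi> \<psi> t0 l0 D0 \<alpha>0 J A a b d j"
    and lambda_hat: "unique_solution_TE M Z \<phi> \<psi> lambda_hat"
begin

sublocale lin: linearised_estimator \<phi> \<psi> t0 l0 D0 \<alpha>0 J A a b d j
  by (rule linearised)

abbreviation "data \<omega> \<equiv> (\<lambda>i. Z i \<omega>)"
abbreviation "\<Psi> n \<omega> \<equiv> Psi_n n (data \<omega>)"
abbreviation "dTE n \<omega> \<equiv> TE' \<phi> \<psi> n (data \<omega>)"
abbreviation "ahat n \<omega> \<equiv> alpha_hat \<phi> n (data \<omega>)"
text \<open>Quantified over l inside the event, so that it can be applied to random l such as
  \<lambda>-hat and its competitors.\<close>

abbreviation "tracks s \<rho> n \<omega> \<equiv> \<forall>l. norm (l - l0) \<le> s \<longrightarrow> norm (ahat n \<omega> l - \<alpha>0) \<le> \<rho>"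
abbreviation "reg n \<omega> \<equiv> lin.regular n (data \<omega>)"
abbreviation "ah n \<omega> \<equiv> ahat n \<omega> (lambda_hat n \<omega>)"

definition \<kappa>0 where "\<kappa>0 = min (a / 10) (j / 2)"

lemma \<kappa>0: "0 < \<kappa>0" "\<kappa>0 \<le> a / 10" "\<kappa>0 \<le> j / 2"
  using lin.a(1) lin.j(1) by (simp_all add: \<kappa>0_def)

text \<open>Uniformity over the ball reduces to laws of large numbers for three fixed functions:
  \<open>eta'\<close>, \<open>sup_err k\<close> and \<open>m1\<close>.\<close>

lemma whp_regular:
  assumes "0 < \<kappa>"
  shows "\<exists>\<delta>>0. whp M (\<lambda>n \<omega>. reg n \<omega> \<kappa> \<delta> K)"
proof -
  obtain k where k: "(LINT z|F. sup_err k z) < \<kappa> / 4"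
    using sup_err_mean_small[of "\<kappa> / 4"] assms by auto
  \<comment> \<open>Halved because \<open>regular\<close> speaks of a closed ball and the
    linearisation of an open one.\<close>
  define \<delta> where "\<delta> = R / real (Suc k) / 2"
  have \<delta>: "0 < \<delta>" "\<delta> < R / real (Suc k)" "\<delta> \<le> R"
  proof -
    have pos: "0 < R / real (Suc k)" using R by simp
    have le: "R / real (Suc k) \<le> R" using R by (simp add: divide_le_eq)
    have half: "0 < x / 2 \<and> x / 2 < x" if "0 < x" for x :: real using that by simp
    show "0 < \<delta>" "\<delta> < R / real (Suc k)" unfolding \<delta>_def using half[OF pos] by blast+
    then show "\<delta> \<le> R" using le by (meson less_imp_le less_le_trans)
  qed
  have 1: "whp M (\<lambda>n \<omega>. norm (emp n \<omega> eta' - (LINT z|F. eta' z)) < \<kappa> / (2 * (c1 + 1)))"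
    by (rule weak_law_of_large_numbers[OF eta'_measurable eta'_square]) (use assms c1_nonneg in simp)
  have 2: "whp M (\<lambda>n \<omega>. norm (emp n \<omega> (sup_err k) - (LINT z|F. sup_err k z)) < \<kappa> / 4)"
    by (rule weak_law_of_large_numbers[OF sup_err_measurable sup_err_square]) (use assms in simp)
  have 3: "whp M (\<lambda>n \<omega>. norm (emp n \<omega> m1 - (LINT z|F. m1 z)) < 1)"
    by (rule weak_law_of_large_numbers[OF envelopes(3) m1_square]) simp
  have "whp M (\<lambda>n \<omega>. reg n \<omega> \<kappa> \<delta> K)"
  proof (rule whp_mono[OF whp_conj[OF whp_conj[OF 1 2] whp_conj[OF 3 whp_AE[OF theta_hat]]]], intro always_eventually allI ballI impI)
    fix n \<omega>
    assume ev: "(norm (emp n \<omega> eta' - (LINT z|F. eta' z)) < \<kappa> / (2 * (c1 + 1)) \<and>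
        norm (emp n \<omega> (sup_err k) - (LINT z|F. sup_err k z)) < \<kappa> / 4) \<and>
      norm (emp n \<omega> m1 - (LINT z|F. m1 z)) < 1 \<and>
      (\<forall>l. (\<exists>!t. emp n \<omega> (\<lambda>z. \<phi> z t l) = 0) \<and> theta_hat \<phi> n (data \<omega>) differentiable (at l))"
    have e1: "norm (emp n \<omega> eta' - J) < \<kappa> / (2 * (c1 + 1))"
      using ev J_eq by simp
    have e2: "emp n \<omega> (sup_err k) < \<kappa> / 2"
      using ev k unfolding real_norm_def by linarith
    have e3: "emp n \<omega> m1 < (LINT z|F. m1 z) + 1"
      using ev unfolding real_norm_def by linarith
    show "reg n \<omega> \<kappa> \<delta> K"
      unfolding lin.regular_def
    proof (intro conjI allI impI)
      show "norm (\<Psi> n \<omega> \<alpha> - \<Psi> n \<omega> \<alpha>0 - J *v (\<alpha> - \<alpha>0)) \<le> \<kappa> * norm (\<alpha> - \<alpha>0)"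
        if "norm (\<alpha> - \<alpha>0) \<le> \<delta>" for \<alpha>
        using that \<delta>(2) by (intro Psi_n_linearisation[OF e1 e2]) linarith
      show "norm (\<Psi> n \<omega> \<alpha> - \<Psi> n \<omega> \<beta>) \<le> K * norm (\<alpha> - \<beta>)"
        if "norm (\<alpha> - \<alpha>0) \<le> \<delta>" "norm (\<beta> - \<alpha>0) \<le> \<delta>" for \<alpha> \<beta>
        using that \<delta>(3) by (intro Psi_n_lipschitz[OF e3]) linarith+
    qed (use ev in simp_all)
  qed
  with \<delta>(1) show ?thesis by blast
qed

lemma eta_mean_zero: "(LINT z|F. \<eta> z \<alpha>0) = 0"
  using Psi_zero(2) by (simp add: Psi_def)

lemma eta0_square: "integrable F (\<lambda>z. (norm (\<eta> z \<alpha>0))\<^sup>2)"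
  by (rule eta_square) (use R in simp)

lemma whp_Psi_n_small:
  assumes "0 < e"
  shows "whp M (\<lambda>n \<omega>. norm (\<Psi> n \<omega> \<alpha>0) < e)"
  using weak_law_of_large_numbers[OF eta_measurable eta0_square assms]
  by (simp add: eta_mean_zero Psi_n_def)

lemma whp_alpha_hat_near:
  assumes "0 < \<rho>"
  shows "\<exists>s>0. whp M (\<lambda>n \<omega>. tracks s \<rho> n \<omega>)"
proof -
  obtain \<delta> where \<delta>: "0 < \<delta>" "whp M (\<lambda>n \<omega>. reg n \<omega> \<kappa>0 \<delta> K)"
    using whp_regular[OF \<kappa>0(1)] by blast
  define C where "C = 3 + 4 * (b + a) / a"
  have C: "0 < C" using lin.a(1) lin.b(1) by (simp add: C_def add_pos_nonneg)
  \<comment> \<open>The first bound keeps all points used in \<open>alpha_hat_near\<close> inside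
    the regular ball, the second makes its conclusion C r at most \<rho>.\<close>
  define r where "r = min (\<delta> / 3) (\<rho> / C)"
  have r: "0 < r" "3 * r \<le> \<delta>" "C * r \<le> \<rho>"
    using \<delta>(1) C assms by (auto simp: r_def min_def field_simps)
  define s where "s = r / (4 * (d + 1))"
  have s: "0 < s" using r(1) lin.d(1) by (simp add: s_def)
  have ar: "0 < a * r / 4" using lin.a(1) r(1) by simp
  have "whp M (\<lambda>n \<omega>. tracks s \<rho> n \<omega>)"
  proof (rule whp_mono[OF whp_conj[OF \<delta>(2) whp_Psi_n_small[OF ar]]], intro always_eventually allI ballI impI)
    fix n \<omega> l
    assume ev: "reg n \<omega> \<kappa>0 \<delta> K \<and> norm (\<Psi> n \<omega> \<alpha>0) < a * r / 4"
      and l: "norm (l - l0) \<le> s"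
    have "norm (ahat n \<omega> l - \<alpha>0) \<le> C * r"
      unfolding C_def
      by (rule lin.alpha_hat_near[OF conjunct1[OF ev] less_imp_le[OF \<kappa>0(1)] \<kappa>0(2,3) K_nonneg r(1,2)])
        (use l ev in \<open>simp_all add: s_def\<close>)
    with r(3) show "norm (ahat n \<omega> l - \<alpha>0) \<le> \<rho>" by linarith
  qed
  with s show ?thesis by blast
qed

text \<open>Selecting the first point of a countable dense set at which the empirical \<open>\<eta>\<close> is small
  gives a measurable solution near \<open>\<lambda>\<^sub>0\<close>; the exact zero provided by Brouwer's theorem need not
  depend measurably on the data.\<close>

lemma local_solution_exists:
  assumes "0 < \<rho>"
  shows "\<exists>L. solves_TE M Z \<phi> \<psi> L \<and> whp M (\<lambda>n \<omega>. norm (L n \<omega> - l0) \<le> \<rho>)"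
proof -
  obtain \<delta> where \<delta>: "0 < \<delta>" "whp M (\<lambda>n \<omega>. reg n \<omega> \<kappa>0 \<delta> K)"
    using whp_regular[OF \<kappa>0(1)] by blast
  have \<delta>3: "0 < \<delta> / 3" using \<delta>(1) by simp
  obtain s where s: "0 < s" "whp M (\<lambda>n \<omega>. tracks s (\<delta> / 3) n \<omega>)"
    using whp_alpha_hat_near[OF \<delta>3] by blast
  define r where "r = min \<rho> (min (\<delta> / 3) s)"
  have r: "0 < r" "r \<le> \<rho>" "r \<le> \<delta> / 3" "r \<le> s"
    using assms \<delta>(1) s(1) by (auto simp: r_def)
  \<comment> \<open>The zero is sought within r/2, so that points of \<open>net\<close> close to it
    still lie strictly within r of \<alpha>0.\<close>
  have jr: "0 < j * (r / 2) / 2" using lin.j(1) r(1) by simp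
  define C where "C = 1 + K * (2 / a + 2 / a * (1 + K * 2 / a))"
  have C: "0 < C" unfolding C_def using K_nonneg lin.a(1) by (intro add_pos_nonneg mult_nonneg_nonneg add_nonneg_nonneg) auto
  define q where "q = from_nat_into net"
  have net_ne: "net \<noteq> {}" using net(2)[of UNIV] by auto
  \<comment> \<open>The tolerance 1/(n+1) is of smaller order than \<open>1 / sqrt n\<close>. Where
    no k qualifies, \<open>LEAST\<close> returns an unspecified fixed number, so L stays measurable
    and is arbitrary only on an event of vanishing probability.\<close>
  define P where "P n k \<omega> \<longleftrightarrow> norm (q k - \<alpha>0) < r \<and> norm (\<Psi> n \<omega> (q k)) < 1 / real (Suc n)" for n k \<omega>
  define L where "L n \<omega> = lambda_of (q (LEAST k. P n k \<omega>))" for n \<omega>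
  have P_meas: "Measurable.pred M (P n k)" for n k
  proof -
    have [measurable]: "(\<lambda>\<omega>. \<Psi> n \<omega> (q k)) \<in> borel_measurable M"
      unfolding Psi_n_def by (rule sample_mean_measurable) measurable
    show ?thesis unfolding P_def by measurable
  qed
  have L_meas: "L n \<in> borel_measurable M" for n
  proof -
    have "(\<lambda>\<omega>. LEAST k. P n k \<omega>) \<in> measurable M (count_space UNIV)"
      by (rule measurable_Least) (rule P_meas)
    then show ?thesis unfolding L_def
      by (rule measurable_compose) simp
  qed
  have key: "whp M (\<lambda>n \<omega>. norm (L n \<omega> - l0) \<le> \<rho> \<and> norm (dTE n \<omega> (L n \<omega>)) \<le> C * (1 / real (Suc n)))"
  proof (rule whp_mono[OF whp_conj[OF whp_conj[OF \<delta>(2) s(2)] whp_Psi_n_small[OF jr]]], intro always_eventually allI ballI impI)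
    fix n \<omega>
    assume ev: "(reg n \<omega> \<kappa>0 \<delta> K \<and>
        (tracks s (\<delta> / 3) n \<omega>)) \<and>
      norm (\<Psi> n \<omega> \<alpha>0) < j * (r / 2) / 2"
    note reg = conjunct1[OF conjunct1[OF ev]] less_imp_le[OF \<kappa>0(1)] \<kappa>0(2,3) K_nonneg
    have r2: "0 < r / 2" "r / 2 \<le> \<delta>" "norm (\<Psi> n \<omega> \<alpha>0) \<le> j * (r / 2) / 2" using r \<delta>(1) ev by auto
    obtain z where z: "norm (z - \<alpha>0) \<le> r / 2" "\<Psi> n \<omega> z = 0"
      using lin.zero_exists[OF reg r2] by blast
    \<comment> \<open>Moving by less than e changes \<open>Psi_n\<close> by at most K/(K+1) times
      1/(n+1), strictly below the tolerance; r/2 keeps the point in the ball.\<close>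
    define e where "e = min (r / 2) (1 / (real (Suc n) * (K + 1)))"
    have e: "0 < e" using r(1) K_nonneg by (simp add: e_def)
    obtain x where x: "x \<in> net" "x \<in> ball z e"
      using net(2)[of "ball z e"] e by auto
    have xz: "norm (x - z) < e" using x(2) by (simp add: dist_norm norm_minus_commute)
    have xr: "norm (x - \<alpha>0) < r"
      using norm_triangle_ineq[of "x - z" "z - \<alpha>0"] xz z(1) by (simp add: e_def)
    have "norm (\<Psi> n \<omega> x - \<Psi> n \<omega> z) \<le> K * norm (x - z)"
      by (rule lin.lipschitz[OF reg]) (use xr z(1) r in auto)
    also have "\<dots> \<le> K * (1 / (real (Suc n) * (K + 1)))"
      using xz K_nonneg by (intro mult_left_mono) (auto simp: e_def)
    also have "\<dots> = K / (K + 1) * (1 / real (Suc n))" by simp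
    also have "\<dots> < 1 * (1 / real (Suc n))"
      using K_nonneg by (intro mult_strict_right_mono) auto
    finally have "norm (\<Psi> n \<omega> x) < 1 / real (Suc n)" using z(2) by simp
    moreover obtain k where "q k = x"
      using x(1) from_nat_into_surj[OF net(1)] unfolding q_def by blast
    ultimately have "P n k \<omega>" using xr by (simp add: P_def)
    then have least: "P n (LEAST k. P n k \<omega>) \<omega>" by (rule LeastI)
    define \<alpha> where "\<alpha> = q (LEAST k. P n k \<omega>)"
    have \<alpha>: "norm (\<alpha> - \<alpha>0) < r" "norm (\<Psi> n \<omega> \<alpha>) < 1 / real (Suc n)"
      using least unfolding P_def \<alpha>_def by blast+
    have L_eq: "L n \<omega> = lambda_of \<alpha>" by (simp add: L_def \<alpha>_def)
    have "lambda_of \<alpha> - l0 = lambda_of (\<alpha> - \<alpha>0)"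
      unfolding l0_def by (rule linear_diff[OF bounded_linear.linear[OF bounded_linear_proj(2)], symmetric])
    then have near: "norm (lambda_of \<alpha> - l0) \<le> r" using norm_proj_le(2)[of "\<alpha> - \<alpha>0"] \<alpha>(1) by simp
    then have "norm (ahat n \<omega> (lambda_of \<alpha>) - \<alpha>0) \<le> \<delta> / 3" using ev r(4) by auto
    then have "norm (dTE n \<omega> (lambda_of \<alpha>)) \<le> C * norm (\<Psi> n \<omega> \<alpha>)"
      unfolding C_def by (intro lin.TE'_approximate_zero[OF reg \<delta>3]) (use \<alpha> r in auto)
    also have "\<dots> \<le> C * (1 / real (Suc n))" using \<alpha>(2) C by (intro mult_left_mono) auto
    finally show "norm (L n \<omega> - l0) \<le> \<rho> \<and> norm (dTE n \<omega> (L n \<omega>)) \<le> C * (1 / real (Suc n))"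
      using near r(2) by (simp add: L_eq)
  qed
  have "whp M (\<lambda>n \<omega>. sqrt (real n) * norm (dTE n \<omega> (L n \<omega>)) \<le> \<epsilon>)" if "0 < \<epsilon>" for \<epsilon>
  proof (rule whp_mono[OF key])
    \<comment> \<open>For n at least the square of C/\<epsilon> the scaled bound
      \<open>C / sqrt n\<close> is at most \<epsilon>.\<close>
    obtain m :: nat where m: "(C / \<epsilon>)\<^sup>2 \<le> real m" using real_arch_simple by blast
    show "\<forall>\<^sub>F n in sequentially. \<forall>\<omega>\<in>space M.
      norm (L n \<omega> - l0) \<le> \<rho> \<and> norm (dTE n \<omega> (L n \<omega>)) \<le> C * (1 / real (Suc n)) \<longrightarrow>
      sqrt (real n) * norm (dTE n \<omega> (L n \<omega>)) \<le> \<epsilon>"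
      using eventually_ge_at_top[of "max 1 m"]
    proof eventually_elim
      case (elim n)
      have "(C / \<epsilon>)\<^sup>2 \<le> real n" using m elim by linarith
      then have Ce: "C / \<epsilon> \<le> sqrt (real n)" by (rule real_le_rsqrt)
      have n: "0 < real n" using elim by simp
      have "sqrt (real n) * (C * (1 / real (Suc n))) \<le> sqrt (real n) * (C * (1 / real n))"
        using n C by (intro mult_left_mono divide_left_mono) auto
      also have "\<dots> = C / sqrt (real n)"
        using n by (simp add: real_div_sqrt field_simps)
      also have "\<dots> \<le> \<epsilon>" using Ce n \<open>0 < \<epsilon>\<close> by (simp add: divide_le_eq mult.commute)
      finally have bound: "sqrt (real n) * (C * (1 / real (Suc n))) \<le> \<epsilon>" .
      show ?case
      proof (intro ballI impI)
        fix \<omega> assume "norm (L n \<omega> - l0) \<le> \<rho> \<and> norm (dTE n \<omega> (L n \<omega>)) \<le> C * (1 / real (Suc n))"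
        then have "sqrt (real n) * norm (dTE n \<omega> (L n \<omega>)) \<le> sqrt (real n) * (C * (1 / real (Suc n)))"
          by (intro mult_left_mono) auto
        with bound show "sqrt (real n) * norm (dTE n \<omega> (L n \<omega>)) \<le> \<epsilon>" by linarith
      qed
    qed
  qed
  then have "solves_TE M Z \<phi> \<psi> L"
    unfolding solves_TE_def small_op_iff_whp using L_meas by simp
  moreover have "whp M (\<lambda>n \<omega>. norm (L n \<omega> - l0) \<le> \<rho>)"
    by (rule whp_mono[OF key]) simp
  ultimately show ?thesis by blast
qed

text \<open>For each radius a competitor within \<rho>/2 of \<lambda>0 is taken; uniqueness puts
  \<lambda>-hat within \<rho>/2 of it. The competitor may depend on \<rho>.\<close>

lemma lambda_hat_consistent:
  assumes "0 < \<rho>"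
  shows "whp M (\<lambda>n \<omega>. norm (lambda_hat n \<omega> - l0) \<le> \<rho>)"
proof -
  have \<rho>2: "0 < \<rho> / 2" using assms by simp
  obtain L where L: "solves_TE M Z \<phi> \<psi> L" "whp M (\<lambda>n \<omega>. norm (L n \<omega> - l0) \<le> \<rho> / 2)"
    using local_solution_exists[OF \<rho>2] by blast
  then have "whp M (\<lambda>n \<omega>. norm (L n \<omega> - lambda_hat n \<omega>) \<le> \<rho> / 2)"
    using lambda_hat \<rho>2 unfolding unique_solution_TE_def small_op_1_iff_whp by blast
  from whp_conj[OF L(2) this] show ?thesis
  proof (rule whp_mono, intro always_eventually allI ballI impI)
    fix n \<omega> assume "norm (L n \<omega> - l0) \<le> \<rho> / 2 \<and> norm (L n \<omega> - lambda_hat n \<omega>) \<le> \<rho> / 2"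
    then show "norm (lambda_hat n \<omega> - l0) \<le> \<rho>"
      using norm_triangle_ineq4[of "L n \<omega> - l0" "L n \<omega> - lambda_hat n \<omega>"] by simp
  qed
qed

lemma alpha_hat_consistent:
  assumes "0 < \<rho>"
  shows "whp M (\<lambda>n \<omega>. norm (ah n \<omega> - \<alpha>0) \<le> \<rho>)"
proof -
  obtain s where s: "0 < s" "whp M (\<lambda>n \<omega>. tracks s \<rho> n \<omega>)"
    using whp_alpha_hat_near[OF assms] by blast
  from whp_conj[OF s(2) lambda_hat_consistent[OF s(1)]] show ?thesis
  proof (rule whp_mono, intro always_eventually allI ballI impI)
    fix n \<omega>
    assume "(tracks s \<rho> n \<omega>) \<and>
      norm (lambda_hat n \<omega> - l0) \<le> s"
    then show "norm (ah n \<omega> - \<alpha>0) \<le> \<rho>" by simp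
  qed
qed

text \<open>The remainder is the inverse of J applied to T - c, with T = (0, TE', 0) negligible by
  the equation for \<lambda>-hat and c at most \<kappa> times the estimation error x. A crude first
  pass bounds \<open>sqrt n * norm x\<close> in terms of B; then \<kappa> makes c negligible. As
  \<kappa> depends on B, and B on the allowed probability e, that level is fixed first.\<close>

lemma asymptotic_expansion:
  assumes "0 < \<epsilon>"
  shows "whp M (\<lambda>n \<omega>. sqrt (real n) * norm (ah n \<omega> - (\<alpha>0 - matrix_inv J *v \<Psi> n \<omega> \<alpha>0)) \<le> \<epsilon>)"
  unfolding whp_def
proof (intro allI impI)
  fix e :: real assume "0 < e"
  then have e2: "0 < e / 2" by simp
  obtain B where B: "0 < B" "evprob M (\<lambda>n \<omega>. sqrt (real n) * norm (\<Psi> n \<omega> \<alpha>0) \<le> B) (e / 2)"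
    using sample_mean_sqrt_bounded[OF eta_measurable eta0_square e2] by (auto simp: eta_mean_zero Psi_n_def)
  \<comment> \<open>Since \<open>sqrt n * j * norm x\<close> will be at most 2 (1 + B), this makes
    the contribution of c at most half of the target \<open>j\<^sup>2 * \<epsilon>\<close>.\<close>
  define \<kappa> where "\<kappa> = min \<kappa>0 (j\<^sup>2 * \<epsilon> / (4 * (1 + B)))"
  have \<kappa>: "0 < \<kappa>" "\<kappa> \<le> a / 10" "\<kappa> \<le> j / 2"
  proof -
    have "\<kappa> \<le> \<kappa>0" by (simp add: \<kappa>_def)
    then show "\<kappa> \<le> a / 10" "\<kappa> \<le> j / 2" using \<kappa>0 by (blast intro: order_trans)+
    show "0 < \<kappa>" using \<kappa>0(1) lin.j(1) assms B(1) by (simp add: \<kappa>_def)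
  qed
  have "\<kappa> * (1 + B) \<le> j\<^sup>2 * \<epsilon> / (4 * (1 + B)) * (1 + B)"
    using B(1) by (intro mult_right_mono) (auto simp: \<kappa>_def)
  also have "\<dots> = j\<^sup>2 * \<epsilon> / 4"
  proof -
    have cancel: "x / (4 * c) * c = x / 4" if "0 < c" for x c :: real using that by simp
    show ?thesis by (rule cancel) (use B(1) in simp)
  qed
  finally have \<kappa>B: "\<kappa> * (1 + B) \<le> j\<^sup>2 * \<epsilon> / 4" .
  \<comment> \<open>The bound 1 enters the crude rate for x; j \<epsilon> / 2 gives T the other half
    of the target.\<close>
  define \<epsilon>' where "\<epsilon>' = min 1 (j * \<epsilon> / 2)"
  have \<epsilon>': "0 < \<epsilon>'" "\<epsilon>' \<le> 1" "\<epsilon>' \<le> j * \<epsilon> / 2" using lin.j(1) assms by (auto simp: \<epsilon>'_def)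
  obtain \<delta> where \<delta>: "0 < \<delta>" "whp M (\<lambda>n \<omega>. reg n \<omega> \<kappa> \<delta> K)"
    using whp_regular[OF \<kappa>(1)] by blast
  have TE: "whp M (\<lambda>n \<omega>. sqrt (real n) * norm (dTE n \<omega> (lambda_hat n \<omega>)) \<le> \<epsilon>')"
    using lambda_hat \<epsilon>'(1) unfolding unique_solution_TE_def solves_TE_def small_op_iff_whp by blast
  have ev: "evprob M (\<lambda>n \<omega>. ((reg n \<omega> \<kappa> \<delta> K \<and> norm (ah n \<omega> - \<alpha>0) \<le> \<delta>) \<and>
      sqrt (real n) * norm (dTE n \<omega> (lambda_hat n \<omega>)) \<le> \<epsilon>') \<and>
      sqrt (real n) * norm (\<Psi> n \<omega> \<alpha>0) \<le> B) e"
    by (rule whp_evprob_conj[OF whp_conj[OF whp_conj[OF \<delta>(2) alpha_hat_consistent[OF \<delta>(1)]] TE] B(2)]) (use \<open>0 < e\<close> in simp)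
  show "evprob M (\<lambda>n \<omega>. sqrt (real n) * norm (ah n \<omega> - (\<alpha>0 - matrix_inv J *v \<Psi> n \<omega> \<alpha>0)) \<le> \<epsilon>) e"
  proof (rule evprob_mono[OF ev order_refl], intro always_eventually allI ballI impI)
    fix n \<omega>
    assume H: "((reg n \<omega> \<kappa> \<delta> K \<and> norm (ah n \<omega> - \<alpha>0) \<le> \<delta>) \<and>
      sqrt (real n) * norm (dTE n \<omega> (lambda_hat n \<omega>)) \<le> \<epsilon>') \<and>
      sqrt (real n) * norm (\<Psi> n \<omega> \<alpha>0) \<le> B"
    then have reg: "reg n \<omega> \<kappa> \<delta> K" and near: "norm (ah n \<omega> - \<alpha>0) \<le> \<delta>"
      and te: "sqrt (real n) * norm (dTE n \<omega> (lambda_hat n \<omega>)) \<le> \<epsilon>'"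
      and psi: "sqrt (real n) * norm (\<Psi> n \<omega> \<alpha>0) \<le> B" by blast+
    note reg' = reg less_imp_le[OF \<kappa>(1)] \<kappa>(2,3) K_nonneg
    define x where "x = ah n \<omega> - \<alpha>0"
    define p where "p = \<Psi> n \<omega> \<alpha>0"
    define T where "T = \<Psi> n \<omega> (ah n \<omega>)"
    define c where "c = T - p - J *v x"
    have c: "norm c \<le> \<kappa> * norm x"
      using lin.lin[OF reg' near] unfolding c_def T_def p_def x_def .
    have "T = stack 0 (dTE n \<omega> (lambda_hat n \<omega>)) 0"
      unfolding T_def by (rule Psi_n_alpha_hat[OF lin.unique[OF reg'] lin.diff[OF reg']])
    then have "norm T \<le> norm (dTE n \<omega> (lambda_hat n \<omega>))"
      using norm_stack_le[of "0 :: real^'p" "dTE n \<omega> (lambda_hat n \<omega>)" "0 :: real^'q^'p"] by simp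
    then have "sqrt (real n) * norm T \<le> sqrt (real n) * norm (dTE n \<omega> (lambda_hat n \<omega>))"
      by (rule mult_left_mono) simp
    with te have T: "sqrt (real n) * norm T \<le> \<epsilon>'" by linarith
    have Jx: "J *v x = T - p - c" by (simp add: c_def)
    have "j * norm x \<le> norm (T - p - c)" using lin.j(2)[of x] by (simp add: Jx)
    also have "\<dots> \<le> norm T + norm p + norm c"
      using norm_triangle_ineq4[of "T - p" c] norm_triangle_ineq4[of T p] by linarith
    \<comment> \<open>Absorbed into the left-hand side, which leaves half of it.\<close>
    also have "norm c \<le> j / 2 * norm x" using c mult_right_mono[OF \<kappa>(3), of "norm x"] by simp
    finally have "j * norm x \<le> 2 * (norm T + norm p)" by simp
    then have "sqrt (real n) * (j * norm x) \<le> sqrt (real n) * (2 * (norm T + norm p))"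
      by (rule mult_left_mono) simp
    also have "\<dots> \<le> 2 * (1 + B)" using T psi \<epsilon>'(2) by (simp add: p_def algebra_simps)
    finally have jx: "sqrt (real n) * (j * norm x) \<le> 2 * (1 + B)" .
    have "matrix_inv J *v (J *v x) = matrix_inv J *v (T - c) - matrix_inv J *v p"
      unfolding Jx by (simp add: matrix_vector_mult_diff_distrib)
    then have "x + matrix_inv J *v p = matrix_inv J *v (T - c)"
      unfolding lin.J_inv(2) by simp
    then have "norm (x + matrix_inv J *v p) \<le> norm (T - c) / j"
      using lin.J_inv(3)[of "T - c"] by simp
    then have "j * norm (x + matrix_inv J *v p) \<le> norm (T - c)"
      using lin.j(1) by (simp add: pos_le_divide_eq mult.commute)
    also have "\<dots> \<le> norm T + \<kappa> * norm x"
      using norm_triangle_ineq4[of T c] c by linarith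
    finally have "sqrt (real n) * (j * norm (x + matrix_inv J *v p)) \<le> sqrt (real n) * (norm T + \<kappa> * norm x)"
      by (rule mult_left_mono) simp
    then have "j * (sqrt (real n) * (j * norm (x + matrix_inv J *v p))) \<le> j * (sqrt (real n) * (norm T + \<kappa> * norm x))"
      by (rule mult_left_mono) (use lin.j(1) in simp)
    also have "\<dots> = j * (sqrt (real n) * norm T) + \<kappa> * (sqrt (real n) * (j * norm x))"
      by (simp add: algebra_simps)
    also have "\<dots> \<le> j * (j * \<epsilon> / 2) + \<kappa> * (2 * (1 + B))"
      using T \<epsilon>'(3) jx \<kappa>(1) lin.j(1) by (intro add_mono mult_left_mono) auto
    also have "\<dots> \<le> j\<^sup>2 * \<epsilon> / 2 + j\<^sup>2 * \<epsilon> / 2"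
    proof -
      have "\<kappa> * (2 * (1 + B)) = 2 * (\<kappa> * (1 + B))" by simp
      moreover have "j * (j * \<epsilon> / 2) = j\<^sup>2 * \<epsilon> / 2" by (simp add: power2_eq_square)
      ultimately show ?thesis using \<kappa>B by linarith
    qed
    finally have "j\<^sup>2 * (sqrt (real n) * norm (x + matrix_inv J *v p)) \<le> j\<^sup>2 * \<epsilon>"
      by (simp add: power2_eq_square mult_ac)
    then have "sqrt (real n) * norm (x + matrix_inv J *v p) \<le> \<epsilon>"
      using lin.j(1) by simp
    then show "sqrt (real n) * norm (ah n \<omega> - (\<alpha>0 - matrix_inv J *v \<Psi> n \<omega> \<alpha>0)) \<le> \<epsilon>"
      by (simp add: x_def p_def algebra_simps)
  qed
qed

text \<open>The sign and the inverse of J are moved into f, whose sample mean is the linear term of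
  the expansion. The central limit theorem applies to it, and the expansion is the negligible
  difference for the Slutsky lemma.\<close>

lemma asymptotic_normality:
  assumes meas: "\<forall>\<^sub>F n in sequentially. ah n \<in> borel_measurable M"
  shows "\<exists>N. multivariate_normal N 0
      (matrix_inv J ** covariance_matrix F (\<lambda>z. \<eta> z \<alpha>0) ** transpose (matrix_inv J)) \<and>
    converges_in_law M (\<lambda>n \<omega>. sqrt (real n) *\<^sub>R (ah n \<omega> - \<alpha>0)) N"
proof -
  define f where "f z = - (matrix_inv J *v \<eta> z \<alpha>0)" for z
  define V where "V = matrix_inv J ** covariance_matrix F (\<lambda>z. \<eta> z \<alpha>0) ** transpose (matrix_inv J)"
  have bl: "bounded_linear (\<lambda>x. - (matrix_inv J *v x))"
    by (intro bounded_linear_minus matrix_vector_mul_bounded_linear)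
  have f_meas [measurable]: "f \<in> borel_measurable borel"
    unfolding f_def
    by (rule measurable_compose[OF eta_measurable borel_measurable_continuous_onI[OF linear_continuous_on[OF bl]]])
  have f_int: "integrable F f" unfolding f_def by (rule integrable_bounded_linear[OF bl Psi_zero(1)])
  have f_mean: "(LINT z|F. f z) = 0"
    unfolding f_def using integral_bounded_linear[OF bl Psi_zero(1)] by (simp add: eta_mean_zero)
  have f_sq: "integrable F (\<lambda>z. (norm (f z))\<^sup>2)"
  proof (rule square_dominated(1)[OF f_meas envelopes(1) _ envelopes(2)])
    fix z
    have "norm (f z) \<le> norm (\<eta> z \<alpha>0) / j" using lin.J_inv(3) by (simp add: f_def)
    also have "\<dots> \<le> m0 z / j" using eta_m0[of \<alpha>0 z] R lin.j(1) by (intro divide_right_mono) auto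
    finally show "norm (f z) \<le> 1 / j * m0 z" by simp
  qed
  have V: "covariance_matrix F f = V"
    unfolding f_def V_def
    by (rule covariance_matrix_linear_image) (use eta0_square Psi_zero(1) eta_mean_zero in simp_all)
  have "transpose V = V"
    unfolding V[symmetric] by (simp add: covariance_matrix_def transpose_def mult.commute)
  moreover have quad: "t \<bullet> (V *v t) = (LINT z|F. (t \<bullet> f z)\<^sup>2)" for t
    unfolding V[symmetric] by (rule quadratic_form_covariance) (use f_sq f_mean f_int in simp_all)
  then have "0 \<le> t \<bullet> (V *v t)" for t by simp
  ultimately obtain N where N: "multivariate_normal N 0 V"
    "\<And>t. (CLINT x|N. iexp (t \<bullet> x)) = exp (- (t \<bullet> (V *v t)) / 2)"
    using multivariate_normal_exists[of V] by blast
  have "converges_in_law M (\<lambda>n \<omega>. sqrt (real n) *\<^sub>R (ah n \<omega> - \<alpha>0)) N"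
  proof (rule converges_in_law_slutsky[where Y = "\<lambda>n \<omega>. sqrt (real n) *\<^sub>R emp n \<omega> f"])
    show "\<forall>\<^sub>F n in sequentially. (\<lambda>\<omega>. sqrt (real n) *\<^sub>R (ah n \<omega> - \<alpha>0)) \<in> borel_measurable M"
      using meas by eventually_elim (intro borel_measurable_scaleR borel_measurable_diff borel_measurable_const)
    show "(\<lambda>\<omega>. sqrt (real n) *\<^sub>R emp n \<omega> f) \<in> borel_measurable M" for n
      by (intro borel_measurable_scaleR borel_measurable_const sample_mean_measurable f_meas)
    show "prob_space N" "sets N = sets borel" using N(1) unfolding multivariate_normal_def by blast+
    show "(\<lambda>n. CLINT \<omega>|M. iexp (t \<bullet> (sqrt (real n) *\<^sub>R emp n \<omega> f))) \<longlonglongrightarrow> (CLINT x|N. iexp (t \<bullet> x))" for t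
      using central_limit_char[OF f_meas f_sq f_mean, of t] by (simp only: V N(2))
    fix \<epsilon> :: real assume "0 < \<epsilon>"
    have sm: "emp n \<omega> f = - (matrix_inv J *v \<Psi> n \<omega> \<alpha>0)" for n \<omega>
      unfolding f_def Psi_n_def by (rule sample_mean_linear[OF bounded_linear.linear[OF bl], symmetric])
    have assoc: "x - y - - v = x - (y - v)" for x y v :: "('p, 'q) param" by simp
    have "norm (sqrt (real n) *\<^sub>R (ah n \<omega> - \<alpha>0) - sqrt (real n) *\<^sub>R emp n \<omega> f) =
      sqrt (real n) * norm (ah n \<omega> - (\<alpha>0 - matrix_inv J *v \<Psi> n \<omega> \<alpha>0))" for n \<omega>
      by (simp only: sm scaleR_diff_right[symmetric] norm_scaleR assoc) simp
    then show "whp M (\<lambda>n \<omega>. norm (sqrt (real n) *\<^sub>R (ah n \<omega> - \<alpha>0) - sqrt (real n) *\<^sub>R emp n \<omega> f) \<le> \<epsilon>)"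
      using asymptotic_expansion[OF \<open>0 < \<epsilon>\<close>] by simp
  qed
  with N(1) show ?thesis unfolding V_def by blast
qed

end

theorem theorem1:
  fixes M :: "'w measure"
    and Z :: "nat \<Rightarrow> 'w \<Rightarrow> real^'d"
    and F :: "(real^'d) measure"
    and \<phi> :: "real^'d \<Rightarrow> real^'p \<Rightarrow> real^'q \<Rightarrow> real^'p"
    and \<psi> :: "real^'d \<Rightarrow> real^'p \<Rightarrow> real"
    and lambda_hat :: "nat \<Rightarrow> 'w \<Rightarrow> real^'q"
    and \<alpha>\<^sub>0 :: "('p, 'q) param"
    and m\<^sub>0 m\<^sub>1 :: "real^'d \<Rightarrow> real"
  defines "ah \<equiv> \<lambda>n \<omega>. alpha_hat \<phi> n (\<lambda>i. Z i \<omega>) (lambda_hat n \<omega>)"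
    and "J \<equiv> jacobian (Psi F \<phi> \<psi>) (at \<alpha>\<^sub>0)"
  assumes "prob_space M"
    and iid: "prob_space.indep_vars M (\<lambda>_. borel) Z UNIV" "\<And>i. distr M borel (Z i) = F"
    and meas: "\<And>t l. (\<lambda>z. \<phi> z t l) \<in> borel_measurable borel"
      "\<And>t. (\<lambda>z. \<psi> z t) \<in> borel_measurable borel"
    and smooth_\<phi>: "\<And>z. (\<lambda>x. \<phi> z (fst x) (snd x)) differentiable_on UNIV"
    and smooth_\<psi>: "\<And>z. \<psi> z differentiable_on UNIV"
    and theta_hat: "\<forall>\<^sub>F n in sequentially. AE \<omega> in M. \<forall>l.
      (\<exists>!t. sample_mean n (\<lambda>i. Z i \<omega>) (\<lambda>z. \<phi> z t l) = 0) \<and>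
      theta_hat \<phi> n (\<lambda>i. Z i \<omega>) differentiable (at l)"
    and lambda_hat: "unique_solution_TE M Z \<phi> \<psi> lambda_hat"
    and alpha_hat_measurable: "\<forall>\<^sub>F n in sequentially. ah n \<in> borel_measurable M"
    and \<alpha>\<^sub>0: "\<And>\<alpha>. integrable F (\<lambda>z. eta \<phi> \<psi> z \<alpha>) \<and> Psi F \<phi> \<psi> \<alpha> = 0 \<longleftrightarrow> \<alpha> = \<alpha>\<^sub>0"
    and Psi_C1: "\<forall>\<^sub>F \<alpha> in nhds \<alpha>\<^sub>0. Psi F \<phi> \<psi> differentiable (at \<alpha>) \<and>
      isCont (\<lambda>\<beta>. jacobian (Psi F \<phi> \<psi>) (at \<beta>)) \<alpha>"
    and J_nonsingular: "invertible J"
    and eta_bounds: "\<forall>\<^sub>F \<alpha> in nhds \<alpha>\<^sub>0. \<forall>z.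
      eta \<phi> \<psi> z differentiable (at \<alpha>) \<and>
      norm (eta \<phi> \<psi> z \<alpha>) \<le> m\<^sub>0 z \<and>
      (\<forall>k l. \<bar>jacobian (eta \<phi> \<psi> z) (at \<alpha>) $ k $ l\<bar> \<le> m\<^sub>1 z)"
    and envelopes: "m\<^sub>0 \<in> borel_measurable borel" "integrable F (\<lambda>z. (m\<^sub>0 z)\<^sup>2)"
      "m\<^sub>1 \<in> borel_measurable borel" "integrable F (\<lambda>z. (m\<^sub>1 z)\<^sup>2)"
  shows "converges_in_prob M ah \<alpha>\<^sub>0 \<and>
    small_op M
      (\<lambda>n \<omega>. ah n \<omega> -
         (\<alpha>\<^sub>0 - matrix_inv J *v sample_mean n (\<lambda>i. Z i \<omega>) (\<lambda>z. eta \<phi> \<psi> z \<alpha>\<^sub>0)))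
      (\<lambda>n. 1 / sqrt (real n)) \<and>
    (\<exists>N. multivariate_normal N 0
        (matrix_inv J ** covariance_matrix F (\<lambda>z. eta \<phi> \<psi> z \<alpha>\<^sub>0) ** transpose (matrix_inv J)) \<and>
      converges_in_law M (\<lambda>n \<omega>. sqrt (real n) *\<^sub>R (ah n \<omega> - \<alpha>\<^sub>0)) N)"
proof -
  interpret prob_space M by fact
  interpret iid_sample M Z F by unfold_locales (rule iid)+
  interpret estimating_functions \<phi> \<psi> by unfold_locales (rule meas smooth_\<phi> smooth_\<psi>)+
  obtain R where "0 < R" and R: "\<And>\<alpha>. dist \<alpha> \<alpha>\<^sub>0 < R \<Longrightarrow> \<forall>z.
      eta \<phi> \<psi> z differentiable (at \<alpha>) \<and>
      norm (eta \<phi> \<psi> z \<alpha>) \<le> m\<^sub>0 z \<and>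
      (\<forall>k l. \<bar>jacobian (eta \<phi> \<psi> z) (at \<alpha>) $ k $ l\<bar> \<le> m\<^sub>1 z)"
    using eta_bounds unfolding eventually_nhds_metric by blast
  \<comment> \<open>The neighbourhood is an open ball, while \<open>m_estimation\<close> works on a
    closed one; half the radius fits inside.\<close>
  have near: "dist \<alpha> \<alpha>\<^sub>0 < R" if "norm (\<alpha> - \<alpha>\<^sub>0) \<le> R / 2" for \<alpha>
    using that \<open>0 < R\<close> by (simp add: dist_norm)
  have zero: "integrable F (\<lambda>z. eta \<phi> \<psi> z \<alpha>\<^sub>0)" "Psi F \<phi> \<psi> \<alpha>\<^sub>0 = 0"
    using \<alpha>\<^sub>0[of \<alpha>\<^sub>0] by simp_all
  interpret m_estimation M Z F \<phi> \<psi> \<alpha>\<^sub>0 m\<^sub>0 m\<^sub>1 "R / 2"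
    using theta_hat zero J_nonsingular R[OF near] \<open>0 < R\<close> envelopes
    unfolding J_def by unfold_locales auto
  obtain a b d j where lin: "linearised_estimator \<phi> \<psi> t0 l0 D0 \<alpha>\<^sub>0 (jacobian (Psi F \<phi> \<psi>) (at \<alpha>\<^sub>0)) A a b d j"
    using linearised_estimator_exists by blast
  interpret tuned_estimation M Z F \<phi> \<psi> \<alpha>\<^sub>0 m\<^sub>0 m\<^sub>1 "R / 2" lambda_hat a b d j
    by (intro tuned_estimation.intro tuned_estimation_axioms.intro m_estimation_axioms lin lambda_hat)
  have "converges_in_prob M ah \<alpha>\<^sub>0"
    unfolding converges_in_prob_iff_whp dist_norm ah_def using alpha_hat_consistent by blast
  moreover have "small_op M
      (\<lambda>n \<omega>. ah n \<omega> -
         (\<alpha>\<^sub>0 - matrix_inv J *v sample_mean n (\<lambda>i. Z i \<omega>) (\<lambda>z. eta \<phi> \<psi> z \<alpha>\<^sub>0)))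
      (\<lambda>n. 1 / sqrt (real n))"
    unfolding small_op_iff_whp ah_def J_def using asymptotic_expansion unfolding Psi_n_def by blast
  moreover have "\<exists>N. multivariate_normal N 0
        (matrix_inv J ** covariance_matrix F (\<lambda>z. eta \<phi> \<psi> z \<alpha>\<^sub>0) ** transpose (matrix_inv J)) \<and>
      converges_in_law M (\<lambda>n \<omega>. sqrt (real n) *\<^sub>R (ah n \<omega> - \<alpha>\<^sub>0)) N"
    using asymptotic_normality alpha_hat_measurable unfolding ah_def J_def by blast
  ultimately show ?thesis by blast
qed

end
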